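(* Given an $\alpha$-approximation algorithm for 2CorrKO, one can obtain an $O(\alpha)$-approximation algorithm for knapsack orienteering with knapsack deadlines (Knap-OrientKD).
   Context: CorrKO: a finite metric $(V,d)$ with integer distances, root $\rho$, travel budget $B$, processing budget $W$; each vertex $v$ has random integer size $S_v\ge0$ and correlated random reward $R_v\ge0$, independent across vertices; a policy starts at $\rho$ and visits distinct vertices, processing jobs non-preemptively with $(S_v,R_v)$ revealed on completion; if it visits $\rho=v_0,\dots,v_\ell$ then $\sum_{i}d(v_{i-1},v_i)\le B$ and $\sum_{i=1}^{\ell-1}S_{v_i}\le W$, and the reward of $v_i$ is collected iff $\sum_{h\le i}S_{v_h}\le W$; approximation is relative to the optimal adaptive policy. 2CorrKO is CorrKO where each $S_v$ is supported on at most two values. OrientKD (rooted): metric $(V,d)$, root $\rho$, budget $B$, rewards $\pi_v\ge0$, knapsack weights $\mathrm{wt}_v\ge0$ and knapsack deadlines $\mathrm{KD}_v$; a path $P$ starting at $\rho$ is feasible if $d(P)\le B$ and $\sum_{u\in P_{\rho,v}}\mathrm{wt}_u\le \mathrm{KD}_v$ for every $v\in P$; maximize $\sum_{v\in P}\pi_v$. Knap-OrientKD additionally has nonnegative weights $b_v$ and a budget $T$, requiring $\sum_{v\in P}b_v\le T$. *)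

theory Defs
  imports
    "HOL-Probability.Probability"
    "HOL-Library.Log_Nat"
    "HOL-Computational_Algebra.Polynomial"
begin

section \<open>Polynomial-time algorithms\<close>

text \<open>
  The machine model is a WHILE language over binary trees with integer leaves, under the
  logarithmic cost criterion: executing a construct costs the bit size of the data it is applied to,
  in addition to the cost of its parts. Every primitive is computable in polynomial time on the
  binary representation, so the running time agrees with that of a Turing machine up to a polynomial.
\<close>

datatype dat = Leaf int | Node dat dat

primrec dsize :: "dat \<Rightarrow> nat" where
  "dsize (Leaf i) = 1 + floorlog 2 (nat \<bar>i\<bar>)"
| "dsize (Node x y) = 1 + dsize x + dsize y"

datatype prim = Ident | Fst | Snd | IsNode | Add | Sub | Mul | Div | Leq

text \<open>Primitives are total: ill-typed arguments give \<open>Leaf 0\<close>. Truth values are \<open>Leaf 1\<close> and \<open>Leaf 0\<close>.\<close>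

fun app_prim :: "prim \<Rightarrow> dat \<Rightarrow> dat" where
  "app_prim Ident x = x"
| "app_prim Fst (Node x y) = x"
| "app_prim Snd (Node x y) = y"
| "app_prim IsNode (Node x y) = Leaf 1"
| "app_prim Add (Node (Leaf a) (Leaf b)) = Leaf (a + b)"
| "app_prim Sub (Node (Leaf a) (Leaf b)) = Leaf (a - b)"
| "app_prim Mul (Node (Leaf a) (Leaf b)) = Leaf (a * b)"
| "app_prim Div (Node (Leaf a) (Leaf b)) = Leaf (a div b)"
| "app_prim Leq (Node (Leaf a) (Leaf b)) = Leaf (if a \<le> b then 1 else 0)"
| "app_prim _ _ = Leaf 0"

datatype prog =
    Prim prim
  | Const dat
  | Seq prog prog
  | Fork prog prog
  | Cond prog prog prog
  | While prog prog

text \<open>\<open>exec p x y t\<close>: on input \<open>x\<close> the program \<open>p\<close> halts with output \<open>y\<close> after time \<open>t\<close>.\<close>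

inductive exec :: "prog \<Rightarrow> dat \<Rightarrow> dat \<Rightarrow> nat \<Rightarrow> bool" where
  Prim: "exec (Prim f) x (app_prim f x) (dsize x)"
| Const: "exec (Const c) x c (dsize x + dsize c)"
| Seq: "exec f x y s \<Longrightarrow> exec g y z t \<Longrightarrow> exec (Seq f g) x z (dsize x + s + t)"
| Fork: "exec f x y s \<Longrightarrow> exec g x z t \<Longrightarrow> exec (Fork f g) x (Node y z) (dsize x + s + t)"
| Cond_True: "exec c x b s \<Longrightarrow> b \<noteq> Leaf 0 \<Longrightarrow> exec f x y t \<Longrightarrow> exec (Cond c f g) x y (dsize x + s + t)"
| Cond_False: "exec c x (Leaf 0) s \<Longrightarrow> exec g x y t \<Longrightarrow> exec (Cond c f g) x y (dsize x + s + t)"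
| While_True: "exec c x b s \<Longrightarrow> b \<noteq> Leaf 0 \<Longrightarrow> exec f x y t \<Longrightarrow> exec (While c f) y z u
    \<Longrightarrow> exec (While c f) x z (dsize x + s + t + u)"
| While_False: "exec c x (Leaf 0) s \<Longrightarrow> exec (While c f) x x (dsize x + s)"

definition computes_within :: "prog \<Rightarrow> nat poly \<Rightarrow> dat \<Rightarrow> dat \<Rightarrow> bool" where
  "computes_within p q x y \<longleftrightarrow> (\<exists>t. exec p x y t \<and> t \<le> poly q (dsize x))"

subsection \<open>Encodings\<close>

definition enc_nat :: "nat \<Rightarrow> dat" where
  "enc_nat n = Leaf (int n)"

definition enc_rat :: "rat \<Rightarrow> dat" where
  "enc_rat r = (case quotient_of r of (a, b) \<Rightarrow> Node (Leaf a) (Leaf b))"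

definition enc_prod :: "('a \<Rightarrow> dat) \<Rightarrow> ('b \<Rightarrow> dat) \<Rightarrow> 'a \<times> 'b \<Rightarrow> dat" where
  "enc_prod f g p = Node (f (fst p)) (g (snd p))"

definition enc_list :: "('a \<Rightarrow> dat) \<Rightarrow> 'a list \<Rightarrow> dat" where
  "enc_list f xs = foldr (\<lambda>x y. Node (f x) y) xs (Leaf 0)"

definition enc_option :: "('a \<Rightarrow> dat) \<Rightarrow> 'a option \<Rightarrow> dat" where
  "enc_option f x = (case x of None \<Rightarrow> Leaf 0 | Some a \<Rightarrow> Node (Leaf 1) (f a))"

definition enc_vec :: "('a \<Rightarrow> dat) \<Rightarrow> nat \<Rightarrow> (nat \<Rightarrow> 'a) \<Rightarrow> dat" where
  "enc_vec f n a = enc_list f (map a [0..<n])"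

definition enc_mat :: "('a \<Rightarrow> dat) \<Rightarrow> nat \<Rightarrow> (nat \<Rightarrow> nat \<Rightarrow> 'a) \<Rightarrow> dat" where
  "enc_mat f n a = enc_vec (enc_vec f n) n a"

section \<open>Walks\<close>

definition walk_length :: "('v \<Rightarrow> 'v \<Rightarrow> 'a::comm_monoid_add) \<Rightarrow> 'v list \<Rightarrow> 'a" where
  "walk_length d p = (\<Sum>i<length p - 1. d (p ! i) (p ! Suc i))"

section \<open>Correlated knapsack orienteering\<close>

text \<open>
  The vertex set is \<open>{..<co_n I}\<close>. The joint distribution of size and reward of a vertex is given
  explicitly, as a list of pairs (size, reward) with rational probabilities.
\<close>

record corrko =
  co_n :: nat
  co_root :: nat
  co_dist :: "nat \<Rightarrow> nat \<Rightarrow> nat"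
  co_B :: nat
  co_W :: nat
  co_job :: "nat \<Rightarrow> ((nat \<times> rat) \<times> rat) list"

definition job_list :: "corrko \<Rightarrow> nat \<Rightarrow> ((nat \<times> rat) \<times> real) list" where
  "job_list I v = map (map_prod id real_of_rat) (co_job I v)"

definition job_pmf :: "corrko \<Rightarrow> nat \<Rightarrow> (nat \<times> rat) pmf" where
  "job_pmf I v = pmf_of_list (job_list I v)"

text \<open>
  \<open>Metric_space\<close> asks for symmetry also outside the vertex set; this is no restriction, as
  distances outside the vertex set are neither encoded nor used and may be taken to be 0.
  The root carries the trivial job of size and reward 0.
\<close>

definition is_CorrKO :: "corrko \<Rightarrow> bool" where
  "is_CorrKO I \<longleftrightarrow>
     co_root I < co_n I \<and>
     Metric_space {..<co_n I} (\<lambda>u v. real (co_dist I u v)) \<and>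
     (\<forall>v<co_n I. pmf_of_list_wf (job_list I v)) \<and>
     (\<forall>v<co_n I. \<forall>(s, r)\<in>set_pmf (job_pmf I v). 0 \<le> r) \<and>
     set_pmf (job_pmf I (co_root I)) = {(0, 0)}"

definition is_2CorrKO :: "corrko \<Rightarrow> bool" where
  "is_2CorrKO I \<longleftrightarrow>
     is_CorrKO I \<and> (\<forall>v<co_n I. card (set_pmf (map_pmf fst (job_pmf I v))) \<le> 2)"

text \<open>An outcome fixes the size and reward of every vertex, independently across vertices.\<close>

type_synonym outcome = "nat \<Rightarrow> nat \<times> rat"

definition outcomes :: "corrko \<Rightarrow> outcome pmf" where
  "outcomes I = Pi_pmf {..<co_n I} (0, 0) (job_pmf I)"

text \<open>
  A history lists the vertices visited after the root, in order, with their revealed sizes and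
  rewards. An adaptive policy chooses the next vertex from the history, or stops.
\<close>

type_synonym history = "(nat \<times> nat \<times> rat) list"

type_synonym policy = "history \<Rightarrow> nat option"

primrec play :: "policy \<Rightarrow> outcome \<Rightarrow> nat \<Rightarrow> history" where
  "play \<pi> \<omega> 0 = []"
| "play \<pi> \<omega> (Suc k) =
     (let h = play \<pi> \<omega> k in case \<pi> h of None \<Rightarrow> h | Some v \<Rightarrow> h @ [(v, \<omega> v)])"

definition hist_size :: "history \<Rightarrow> nat" where
  "hist_size h = (\<Sum>(v, s, r)\<leftarrow>h. s)"

text \<open>The last vertex visited may overrun the processing budget.\<close>

definition hist_feasible :: "corrko \<Rightarrow> history \<Rightarrow> bool" where
  "hist_feasible I h \<longleftrightarrow>
     (let p = co_root I # map fst h in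
        set p \<subseteq> {..<co_n I} \<and> distinct p \<and> walk_length (co_dist I) p \<le> co_B I) \<and>
     hist_size (butlast h) \<le> co_W I"

definition hist_reward :: "corrko \<Rightarrow> history \<Rightarrow> rat" where
  "hist_reward I h =
     (\<Sum>i | i < length h \<and> hist_size (take (Suc i) h) \<le> co_W I. snd (snd (h ! i)))"

text \<open>
  A feasible policy has stopped after fewer than \<open>co_n I\<close> steps: a feasible history consists of
  distinct vertices other than the root. Thus \<open>play \<pi> \<omega> (co_n I)\<close> is its complete run.
\<close>

definition policy_feasible :: "corrko \<Rightarrow> policy \<Rightarrow> bool" where
  "policy_feasible I \<pi> \<longleftrightarrow>
     (\<forall>\<omega>\<in>set_pmf (outcomes I). hist_feasible I (play \<pi> \<omega> (co_n I)))"

definition policy_value :: "corrko \<Rightarrow> policy \<Rightarrow> real" where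
  "policy_value I \<pi> =
     measure_pmf.expectation (outcomes I) (\<lambda>\<omega>. real_of_rat (hist_reward I (play \<pi> \<omega> (co_n I))))"

definition enc_corrko :: "corrko \<Rightarrow> dat" where
  "enc_corrko I =
     Node (enc_nat (co_n I)) (Node (enc_nat (co_root I))
       (Node (enc_mat enc_nat (co_n I) (co_dist I)) (Node (enc_nat (co_B I)) (Node (enc_nat (co_W I))
         (enc_vec (enc_list (enc_prod (enc_prod enc_nat enc_rat) enc_rat)) (co_n I) (co_job I))))))"

definition enc_history :: "history \<Rightarrow> dat" where
  "enc_history = enc_list (enc_prod enc_nat (enc_prod enc_nat enc_rat))"

text \<open>
  A policy may depend on exponentially many histories, so an algorithm does not output it as a
  table. Rather, given the instance and a history that can arise when running the policy, it
  computes the next decision in time polynomial in the size of this input.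
  The approximation factor may depend on the number of vertices.
\<close>

definition approx_alg_2CorrKO :: "(nat \<Rightarrow> real) \<Rightarrow> prog \<Rightarrow> bool" where
  "approx_alg_2CorrKO \<alpha> A \<longleftrightarrow>
     (\<exists>q. \<forall>I. is_2CorrKO I \<longrightarrow>
        (\<exists>\<pi>. policy_feasible I \<pi> \<and>
             (\<forall>\<pi>'. policy_feasible I \<pi>' \<longrightarrow> policy_value I \<pi>' \<le> \<alpha> (co_n I) * policy_value I \<pi>) \<and>
             (\<forall>\<omega>\<in>set_pmf (outcomes I). \<forall>k.
                computes_within A q (Node (enc_corrko I) (enc_history (play \<pi> \<omega> k)))
                  (enc_option enc_nat (\<pi> (play \<pi> \<omega> k))))))"

section \<open>Knapsack orienteering with knapsack deadlines\<close>

record knap_orientkd =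
  ok_n :: nat
  ok_root :: nat
  ok_dist :: "nat \<Rightarrow> nat \<Rightarrow> rat"
  ok_B :: rat
  ok_reward :: "nat \<Rightarrow> rat"
  ok_wt :: "nat \<Rightarrow> rat"
  ok_KD :: "nat \<Rightarrow> rat"
  ok_b :: "nat \<Rightarrow> rat"
  ok_T :: rat

definition is_KnapOrientKD :: "knap_orientkd \<Rightarrow> bool" where
  "is_KnapOrientKD J \<longleftrightarrow>
     ok_root J < ok_n J \<and>
     Metric_space {..<ok_n J} (\<lambda>u v. real_of_rat (ok_dist J u v)) \<and>
     (\<forall>v<ok_n J. 0 \<le> ok_reward J v \<and> 0 \<le> ok_wt J v \<and> 0 \<le> ok_b J v)"

definition ok_feasible :: "knap_orientkd \<Rightarrow> nat list \<Rightarrow> bool" where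
  "ok_feasible J p \<longleftrightarrow>
     p \<noteq> [] \<and> hd p = ok_root J \<and> set p \<subseteq> {..<ok_n J} \<and> distinct p \<and>
     walk_length (ok_dist J) p \<le> ok_B J \<and>
     (\<forall>i<length p. (\<Sum>u\<leftarrow>take (Suc i) p. ok_wt J u) \<le> ok_KD J (p ! i)) \<and>
     (\<Sum>u\<in>set p. ok_b J u) \<le> ok_T J"

definition ok_value :: "knap_orientkd \<Rightarrow> nat list \<Rightarrow> rat" where
  "ok_value J p = (\<Sum>v\<in>set p. ok_reward J v)"

definition enc_knap_orientkd :: "knap_orientkd \<Rightarrow> dat" where
  "enc_knap_orientkd J =
     Node (enc_nat (ok_n J)) (Node (enc_nat (ok_root J))
       (Node (enc_mat enc_rat (ok_n J) (ok_dist J)) (Node (enc_rat (ok_B J))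
         (Node (enc_vec enc_rat (ok_n J) (ok_reward J)) (Node (enc_vec enc_rat (ok_n J) (ok_wt J))
           (Node (enc_vec enc_rat (ok_n J) (ok_KD J)) (Node (enc_vec enc_rat (ok_n J) (ok_b J))
             (enc_rat (ok_T J)))))))))"

text \<open>The answer \<open>None\<close> reports that there is no feasible path.\<close>

definition approx_alg_KnapOrientKD :: "(nat \<Rightarrow> real) \<Rightarrow> prog \<Rightarrow> bool" where
  "approx_alg_KnapOrientKD \<alpha> A \<longleftrightarrow>
     (\<exists>q. \<forall>J. is_KnapOrientKD J \<longrightarrow>
        (\<exists>ans. computes_within A q (enc_knap_orientkd J) (enc_option (enc_list enc_nat) ans) \<and>
           (case ans of
              None \<Rightarrow> \<not> (\<exists>p. ok_feasible J p)
            | Some p \<Rightarrow> ok_feasible J p \<and>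
                (\<forall>p'. ok_feasible J p' \<longrightarrow>
                   real_of_rat (ok_value J p') \<le> \<alpha> (ok_n J) * real_of_rat (ok_value J p)))))"

end

theory Submission
  imports Defs "HOL-Library.Sublist"
begin

text \<open>
  After scaling to integers, a vertex of the deadline problem becomes a job that is small and worthless
  with high probability, and otherwise big and worth its reward. The big size is chosen such that it
  still fits iff the load so far respects the knapsack deadline, and such that two big jobs never fit;
  hence only the run on which all jobs are small matters. The probability of being big grows with
  \<open>b\<^sub>v\<close>: along a feasible path these probabilities add up to at most \<open>1/2\<close>, so following it loses only
  a factor 2, whereas the value of a run decays geometrically with its \<open>b\<close>-weight, so one of its
  segments of weight at most \<open>T\<close> has a constant fraction of the value. The algorithm simulates the
  policy on small jobs, drops the vertices that miss their deadline and returns the best segment.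
\<close>

section \<open>Polynomial-time computable functions\<close>

text \<open>The obstacle is that there are two knapsack constraints but one processing budget, which
  the deadlines occupy. So \<open>b\<close> moves into the probabilities: a big job pays
  \<open>r v * k v\<close>, its expected reward is \<open>r v\<close> whatever \<open>k v\<close>
  is, and \<open>k v\<close> is free to encode \<open>b\<close>. A further summand
  \<open>1 / (4 * n)\<close> keeps the probability positive where \<open>b\<close> vanishes; over at
  most \<open>n\<close> vertices it adds up to at most 1/4, as do the \<open>b\<close>-parts. Using
  \<open>T + 1\<close> in place of \<open>T\<close> admits \<open>T = 0\<close> and fits
  integrality: a weight above \<open>T\<close> is at least \<open>T + 1\<close>. Adaptivity is
  harmless, since on the all-small run the next vertex is determined and a policy shrinks to one
  walk. This run has positive probability, so feasibility and running time are guaranteed along it,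
  and \<open>n\<close> queries reveal it. Deleting vertices from the walk is safe by the triangle
  inequality and nonnegativity of the weights. The constant is \<open>36 = 2 * 18\<close>: 2 for
  following an optimal path, 18 for cutting out a segment. The root earns nothing in the gadget; its
  reward is restored on both sides at the end.\<close>

lemma poly_nat_mono: "x \<le> y \<Longrightarrow> poly p x \<le> poly p y" for p :: "nat poly" and x y :: nat
  by (induction p) (auto intro!: add_mono mult_mono)

lemma dsize_pos: "Suc 0 \<le> dsize x"
  by (cases x) auto

lemma abs_less_dsize: "nat \<bar>i\<bar> < 2 ^ (dsize (Leaf i) - 1)"
  using floorlog_le_iff[of 2 "nat \<bar>i\<bar>" "dsize (Leaf i) - 1"] by auto

lemma dsize_Leaf_le: "nat \<bar>i\<bar> < 2 ^ k \<Longrightarrow> dsize (Leaf i) \<le> Suc k"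
  using floorlog_le_iff[of 2 "nat \<bar>i\<bar>" k] by auto

lemma dsize_Leaf_mono: "\<bar>i\<bar> \<le> \<bar>j\<bar> \<Longrightarrow> dsize (Leaf i) \<le> dsize (Leaf j)"
  by (auto intro!: floorlog_mono)

lemma dsize_add: "dsize (Leaf (a + b)) \<le> dsize (Leaf a) + dsize (Leaf b)"
proof -
  define m where "m = dsize (Leaf a) - 1"
  define n where "n = dsize (Leaf b) - 1"
  have "nat \<bar>a\<bar> < 2 ^ m" "nat \<bar>b\<bar> < 2 ^ n"
    using abs_less_dsize by (auto simp: m_def n_def)
  moreover have "(2::nat) ^ m \<le> 2 ^ (m + n)" "(2::nat) ^ n \<le> 2 ^ (m + n)"
    by auto
  ultimately have "nat \<bar>a\<bar> < 2 ^ (m + n)" "nat \<bar>b\<bar> < 2 ^ (m + n)" by linarith+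
  hence "nat \<bar>a + b\<bar> < 2 * 2 ^ (m + n)" by linarith
  hence "nat \<bar>a + b\<bar> < 2 ^ Suc (m + n)" by simp
  hence "dsize (Leaf (a + b)) \<le> Suc (Suc (m + n))" by (rule dsize_Leaf_le)
  thus ?thesis by (simp add: m_def n_def)
qed

lemma dsize_diff: "dsize (Leaf (a - b)) \<le> dsize (Leaf a) + dsize (Leaf b)"
  using dsize_add[of a "- b"] by simp

lemma dsize_mult: "dsize (Leaf (a * b)) \<le> dsize (Leaf a) + dsize (Leaf b)"
proof -
  define m where "m = dsize (Leaf a) - 1"
  define n where "n = dsize (Leaf b) - 1"
  have "nat \<bar>a\<bar> < 2 ^ m" "nat \<bar>b\<bar> < 2 ^ n"
    using abs_less_dsize by (auto simp: m_def n_def)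
  hence "nat \<bar>a\<bar> * nat \<bar>b\<bar> < 2 ^ m * 2 ^ n" by (intro mult_strict_mono) auto
  hence "nat \<bar>a * b\<bar> < 2 ^ (m + n)" by (simp add: abs_mult nat_mult_distrib power_add)
  hence "dsize (Leaf (a * b)) \<le> Suc (m + n)" by (rule dsize_Leaf_le)
  thus ?thesis by (simp add: m_def n_def)
qed

lemma dsize_div: "dsize (Leaf (a div b)) \<le> dsize (Leaf a)"
proof (rule dsize_Leaf_mono)
  show "\<bar>a div b\<bar> \<le> \<bar>a\<bar>"
    by (smt (verit, del_insts) div_by_1 div_int_pos_iff div_minus_minus
      div_nonpos_pos_le0 int_div_le_self neg_imp_zdiv_neg_iff nonneg1_imp_zdiv_pos_iff
      of_int_0_le_iff of_int_add of_int_eq_iff of_int_le_0_iff zdiv_mono2_neg)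
qed

lemma dsize_int_le: "dsize (Leaf (int n)) \<le> Suc n"
  by (rule dsize_Leaf_le) simp

text \<open>Bit sizes at most add up under all arithmetic primitives, multiplication included, and
  the argument pair already contains both operands.\<close>

lemma dsize_app_prim: "dsize (app_prim f x) \<le> dsize x"
proof (cases "(f, x)" rule: app_prim.cases)
  case (5 a b)
  thus ?thesis using dsize_add[of a b] by simp
next
  case (6 a b)
  thus ?thesis using dsize_diff[of a b] by simp
next
  case (7 a b)
  thus ?thesis using dsize_mult[of a b] by simp
next
  case (8 a b)
  thus ?thesis using dsize_div[of a b] by simp
qed (use dsize_pos in \<open>auto simp: floorlog_def intro: trans_le_add1\<close>)

text \<open>Every rule charges at least the size of what it produces. Hence a time bound is also a
  bound on the output size, which is what composition needs.\<close>

lemma exec_dsize: "exec p x y t \<Longrightarrow> dsize y \<le> t"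
proof (induction rule: exec.induct)
  case (Fork f x y s g z t)
  thus ?case using dsize_pos[of x] by simp
qed (use dsize_app_prim in auto)

text \<open>
  The index set makes it possible to speak of programs that are only correct on certain inputs.
\<close>

definition ptime :: "'i set \<Rightarrow> ('i \<Rightarrow> dat) \<Rightarrow> ('i \<Rightarrow> dat) \<Rightarrow> bool" where
  "ptime X e f \<longleftrightarrow> (\<exists>p q. \<forall>i\<in>X. computes_within p q (e i) (f i))"

lemma ptimeI:
  assumes "\<And>i. i \<in> X \<Longrightarrow> \<exists>t. exec p (e i) (f i) t \<and> t \<le> poly q (dsize (e i))"
  shows "ptime X e f"
  using assms unfolding ptime_def computes_within_def by blast

lemma ptimeE:
  assumes "ptime X e f"
  obtains p q t where "\<forall>i\<in>X. exec p (e i) (f i) (t i) \<and> t i \<le> poly q (dsize (e i))"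
proof -
  obtain p q where "\<forall>i\<in>X. \<exists>t. exec p (e i) (f i) t \<and> t \<le> poly q (dsize (e i))"
    using assms unfolding ptime_def computes_within_def by blast
  from bchoice[OF this] that show ?thesis by blast
qed

lemma ptime_size:
  assumes "ptime X e f"
  obtains q where "\<And>i. i \<in> X \<Longrightarrow> dsize (f i) \<le> poly q (dsize (e i))"
proof -
  obtain p q t where "\<forall>i\<in>X. exec p (e i) (f i) (t i) \<and> t i \<le> poly q (dsize (e i))"
    by (rule ptimeE[OF assms])
  thus ?thesis by (intro that[of q]) (meson exec_dsize order_trans)
qed

section \<open>Closure of polynomial time under composition, pairing, branching and loops\<close>

lemma ptime_subset: "ptime X e f \<Longrightarrow> Y \<subseteq> X \<Longrightarrow> ptime Y e f"
  unfolding ptime_def by blast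

lemma ptime_cong: "ptime X e f \<Longrightarrow> (\<And>i. i \<in> X \<Longrightarrow> f i = g i) \<Longrightarrow> ptime X e g"
  unfolding ptime_def by (auto cong: ball_cong)

lemma ptime_reindex: "ptime X e f \<Longrightarrow> (\<And>j. j \<in> Y \<Longrightarrow> m j \<in> X) \<Longrightarrow> ptime Y (\<lambda>j. e (m j)) (\<lambda>j. f (m j))"
  unfolding ptime_def by blast

lemma ptime_prim: "ptime X e (\<lambda>i. app_prim g (e i))"
proof (rule ptimeI)
  fix i show "\<exists>t. exec (Prim g) (e i) (app_prim g (e i)) t \<and> t \<le> poly [:0,1:] (dsize (e i))"
    using exec.Prim by force
qed

lemma ptime_id: "ptime X e e"
  using ptime_prim[of X e Ident] by simp

lemma ptime_const: "ptime X e (\<lambda>i. c)"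
proof (rule ptimeI)
  fix i show "\<exists>t. exec (Const c) (e i) c t \<and> t \<le> poly [:dsize c,1:] (dsize (e i))"
    using exec.Const by force
qed

text \<open>The middle function \<open>f\<close> is an output of the first program and an encoding
  for the second. Its size is polynomial by \<open>exec_dsize\<close>, and polynomials
  compose.\<close>

lemma ptime_comp:
  assumes "ptime X e f" "ptime X f g"
  shows "ptime X e g"
proof -
  obtain p q t where 1: "\<forall>i\<in>X. exec p (e i) (f i) (t i) \<and> t i \<le> poly q (dsize (e i))"
    by (rule ptimeE[OF assms(1)])
  obtain p' q' t' where 2: "\<forall>i\<in>X. exec p' (f i) (g i) (t' i) \<and> t' i \<le> poly q' (dsize (f i))"
    by (rule ptimeE[OF assms(2)])
  show ?thesis
  proof (rule ptimeI)
    fix i assume i: "i \<in> X"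
    note 1 = 1[rule_format, OF i] and 2 = 2[rule_format, OF i]
    have "dsize (f i) \<le> poly q (dsize (e i))"
      using exec_dsize 1 by (meson order_trans)
    hence "t' i \<le> poly q' (poly q (dsize (e i)))"
      using 2 poly_nat_mono by (meson order_trans)
    thus "\<exists>t. exec (Seq p p') (e i) (g i) t \<and> t \<le> poly ([:0,1:] + q + pcompose q' q) (dsize (e i))"
      using exec.Seq[of p "e i" "f i" "t i" p' "g i" "t' i"] 1 2
      by (intro exI[of _ "dsize (e i) + t i + t' i"]) (auto simp: poly_pcompose)
  qed
qed

lemma ptime_Node:
  assumes "ptime X e f" "ptime X e g"
  shows "ptime X e (\<lambda>i. Node (f i) (g i))"
proof -
  obtain p q t where 1: "\<forall>i\<in>X. exec p (e i) (f i) (t i) \<and> t i \<le> poly q (dsize (e i))"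
    by (rule ptimeE[OF assms(1)])
  obtain p' q' t' where 2: "\<forall>i\<in>X. exec p' (e i) (g i) (t' i) \<and> t' i \<le> poly q' (dsize (e i))"
    by (rule ptimeE[OF assms(2)])
  show ?thesis
  proof (rule ptimeI)
    fix i assume i: "i \<in> X"
    show "\<exists>t. exec (Fork p p') (e i) (Node (f i) (g i)) t \<and> t \<le> poly ([:0,1:] + q + q') (dsize (e i))"
      using exec.Fork[of p "e i" "f i" "t i" p' "g i" "t' i"] 1 2 i
      by (intro exI[of _ "dsize (e i) + t i + t' i"]) (auto intro!: add_mono)
  qed
qed

text \<open>Each branch need only be computable on the inputs that reach it, so operations that make
  sense only under the guard are admissible there.\<close>

lemma ptime_if:
  assumes "ptime X e (\<lambda>i. Leaf (of_bool (P i)))" "ptime {i\<in>X. P i} e f" "ptime {i\<in>X. \<not> P i} e g"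
  shows "ptime X e (\<lambda>i. if P i then f i else g i)"
proof -
  obtain c qc tc where c: "\<forall>i\<in>X. exec c (e i) (Leaf (of_bool (P i))) (tc i) \<and> tc i \<le> poly qc (dsize (e i))"
    by (rule ptimeE[OF assms(1)])
  obtain p q t where 1: "\<forall>i\<in>{i\<in>X. P i}. exec p (e i) (f i) (t i) \<and> t i \<le> poly q (dsize (e i))"
    by (rule ptimeE[OF assms(2)])
  obtain p' q' t' where 2: "\<forall>i\<in>{i\<in>X. \<not> P i}. exec p' (e i) (g i) (t' i) \<and> t' i \<le> poly q' (dsize (e i))"
    by (rule ptimeE[OF assms(3)])
  show ?thesis
  proof (rule ptimeI)
    fix i assume i: "i \<in> X"
    show "\<exists>t. exec (Cond c p p') (e i) (if P i then f i else g i) t \<and>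
        t \<le> poly ([:0,1:] + qc + q + q') (dsize (e i))"
    proof (cases "P i")
      case True
      with i c 1 show ?thesis
        using exec.Cond_True[of c "e i" "Leaf 1" "tc i" p "f i" "t i" p']
        by (intro exI[of _ "dsize (e i) + tc i + t i"]) fastforce
    next
      case False
      with i c 2 show ?thesis
        using exec.Cond_False[of c "e i" "tc i" p' "g i" "t' i" p]
        by (intro exI[of _ "dsize (e i) + tc i + t' i"]) fastforce
    qed
  qed
qed

text \<open>The loop is described by its sequence of states, and the induction peels off the first
  round. A round costs the state size plus one test and one body, at most
  \<open>\<sigma> + 2 * \<tau>\<close>; the failing last test makes it \<open>Suc N\<close>
  rounds.\<close>

lemma exec_While_iterate:
  assumes "\<And>k. k < N \<Longrightarrow> exec c (st k) (b k) (s k) \<and> b k \<noteq> Leaf 0 \<and> exec f (st k) (st (Suc k)) (t k)"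
    and "exec c (st N) (Leaf 0) s'"
    and "\<And>k. k \<le> N \<Longrightarrow> dsize (st k) \<le> \<sigma>" "\<And>k. k < N \<Longrightarrow> s k \<le> \<tau>" "\<And>k. k < N \<Longrightarrow> t k \<le> \<tau>" "s' \<le> \<tau>"
  shows "\<exists>u. exec (While c f) (st 0) (st N) u \<and> u \<le> Suc N * (\<sigma> + 2 * \<tau>)"
  using assms
proof (induction N arbitrary: st b s t)
  case 0
  thus ?case using exec.While_False[of c "st 0" s' f]
    by (intro exI[of _ "dsize (st 0) + s'"]) (auto intro!: add_mono intro: trans_le_add1)
next
  case (Suc N)
  from Suc.IH[of "\<lambda>k. st (Suc k)" "\<lambda>k. b (Suc k)" "\<lambda>k. s (Suc k)" "\<lambda>k. t (Suc k)"] Suc.prems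
  obtain u where u: "exec (While c f) (st 1) (st (Suc N)) u" "u \<le> Suc N * (\<sigma> + 2 * \<tau>)"
    by auto
  have "exec (While c f) (st 0) (st (Suc N)) (dsize (st 0) + s 0 + t 0 + u)"
    using Suc.prems(1)[of 0] u(1) by (auto intro: exec.While_True)
  moreover have "dsize (st 0) + s 0 + t 0 + u \<le> Suc (Suc N) * (\<sigma> + 2 * \<tau>)"
    using Suc.prems(3-5)[of 0] u(2) by simp
  ultimately show ?case by blast
qed

text \<open>The bound \<open>size\<close> on all states in terms of the original input is essential:
  iterating a polynomial body could otherwise let the state grow exponentially. Test and body see
  only the state, so they are indexed by pairs of input and round.\<close>

lemma ptime_loop:
  assumes init: "ptime X e (\<lambda>i. st i 0)"
    and cond: "ptime (SIGMA i:X. {..N i}) (\<lambda>z. st (fst z) (snd z)) (\<lambda>z. Leaf (of_bool (snd z < N (fst z))))"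
    and body: "ptime (SIGMA i:X. {..<N i}) (\<lambda>z. st (fst z) (snd z)) (\<lambda>z. st (fst z) (Suc (snd z)))"
    and size: "\<And>i k. i \<in> X \<Longrightarrow> k \<le> N i \<Longrightarrow> dsize (st i k) \<le> poly qs (dsize (e i))"
    and iter: "\<And>i. i \<in> X \<Longrightarrow> N i \<le> poly qn (dsize (e i))"
  shows "ptime X e (\<lambda>i. st i (N i))"
proof -
  obtain p0 q0 t0 where p0: "\<forall>i\<in>X. exec p0 (e i) (st i 0) (t0 i) \<and> t0 i \<le> poly q0 (dsize (e i))"
    by (rule ptimeE[OF init])
  obtain c qc tc where "\<forall>z\<in>(SIGMA i:X. {..N i}). exec c (st (fst z) (snd z))
        (Leaf (of_bool (snd z < N (fst z)))) (tc z) \<and> tc z \<le> poly qc (dsize (st (fst z) (snd z)))"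
    by (rule ptimeE[OF cond])
  hence c: "exec c (st i k) (Leaf (of_bool (k < N i))) (tc (i, k))" "tc (i, k) \<le> poly qc (dsize (st i k))"
    if "i \<in> X" "k \<le> N i" for i k
    using that by auto
  obtain p q t where "\<forall>z\<in>(SIGMA i:X. {..<N i}). exec p (st (fst z) (snd z))
        (st (fst z) (Suc (snd z))) (t z) \<and> t z \<le> poly q (dsize (st (fst z) (snd z)))"
    by (rule ptimeE[OF body])
  hence b: "exec p (st i k) (st i (Suc k)) (t (i, k))" "t (i, k) \<le> poly q (dsize (st i k))"
    if "i \<in> X" "k < N i" for i k
    using that by auto
  show ?thesis
  proof (rule ptimeI)
    fix i assume i: "i \<in> X"
    define x where "x = dsize (e i)"
    define \<tau> where "\<tau> = poly qc (poly qs x) + poly q (poly qs x)"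
    have sz: "dsize (st i k) \<le> poly qs x" if "k \<le> N i" for k
      using size[OF i that] by (simp add: x_def)
    have tc: "tc (i, k) \<le> \<tau>" if "k \<le> N i" for k
      using c(2)[OF i that] poly_nat_mono[OF sz[OF that], of qc] by (simp add: \<tau>_def)
    have tb: "t (i, k) \<le> \<tau>" if "k < N i" for k
      using b(2)[OF i that] poly_nat_mono[OF sz[of k], of q] that by (simp add: \<tau>_def)
    have "exec c (st i k) (Leaf 1) (tc (i, k)) \<and> Leaf 1 \<noteq> Leaf 0 \<and> exec p (st i k) (st i (Suc k)) (t (i, k))"
      if "k < N i" for k
      using c(1)[OF i, of k] b(1)[OF i that] that by auto
    from exec_While_iterate[of "N i" c "st i" "\<lambda>_. Leaf 1" "\<lambda>k. tc (i, k)", OF this, of "tc (i, N i)" "poly qs x" \<tau>]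
    obtain u where u: "exec (While c p) (st i 0) (st i (N i)) u" "u \<le> Suc (N i) * (poly qs x + 2 * \<tau>)"
      using c(1)[OF i, of "N i"] sz tc tb by auto
    have "Suc (N i) \<le> Suc (poly qn x)" using iter[OF i] by (simp add: x_def)
    hence "u \<le> Suc (poly qn x) * (poly qs x + 2 * \<tau>)"
      using u(2) by (meson mult_le_mono1 order_trans)
    hence "dsize (e i) + t0 i + u \<le> poly ([:0,1:] + q0 + ([:1:] + qn) * (qs + [:2:] * (pcompose qc qs + pcompose q qs))) (dsize (e i))"
      using conjunct2[OF bspec[OF p0 i]] by (simp add: \<tau>_def x_def poly_pcompose algebra_simps)
    thus "\<exists>t. exec (Seq p0 (While c p)) (e i) (st i (N i)) t \<and> t \<le> poly
        ([:0,1:] + q0 + ([:1:] + qn) * (qs + [:2:] * (pcompose qc qs + pcompose q qs))) (dsize (e i))"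
      using exec.Seq[OF _ u(1)] p0 i by blast
  qed
qed

lemma ptime_prim': "ptime X e f \<Longrightarrow> ptime X e (\<lambda>i. app_prim g (f i))"
  by (rule ptime_comp[OF _ ptime_prim])

lemma ptime_fst: "ptime X e (\<lambda>i. Node (f i) (g i)) \<Longrightarrow> ptime X e f"
  using ptime_prim'[of X e _ Fst] by fastforce

lemma ptime_snd: "ptime X e (\<lambda>i. Node (f i) (g i)) \<Longrightarrow> ptime X e g"
  using ptime_prim'[of X e _ Snd] by fastforce

context
  fixes X :: "'i set" and e a b
  assumes a: "ptime X e (\<lambda>i. Leaf (a i))" and b: "ptime X e (\<lambda>i. Leaf (b i))"
begin

lemma ptime_add: "ptime X e (\<lambda>i. Leaf (a i + b i))"
  using ptime_prim'[OF ptime_Node[OF a b], of Add] by simp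

lemma ptime_diff: "ptime X e (\<lambda>i. Leaf (a i - b i))"
  using ptime_prim'[OF ptime_Node[OF a b], of Sub] by simp

lemma ptime_mult: "ptime X e (\<lambda>i. Leaf (a i * b i))"
  using ptime_prim'[OF ptime_Node[OF a b], of Mul] by simp

lemma ptime_div: "ptime X e (\<lambda>i. Leaf (a i div b i))"
  using ptime_prim'[OF ptime_Node[OF a b], of Div] by simp

lemma ptime_le: "ptime X e (\<lambda>i. Leaf (of_bool (a i \<le> b i)))"
  using ptime_prim'[OF ptime_Node[OF a b], of Leq] by (simp add: of_bool_def)

end

lemma ptime_less:
  fixes a b :: "'i \<Rightarrow> int"
  assumes "ptime X e (\<lambda>i. Leaf (a i))" and "ptime X e (\<lambda>i. Leaf (b i))"
  shows "ptime X e (\<lambda>i. Leaf (of_bool (a i < b i)))"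
  using ptime_le[OF ptime_add[OF assms(1) ptime_const[of _ _ "Leaf 1"]] assms(2)]
  by (simp add: add1_zle_eq)

lemma ptime_conj:
  assumes "ptime X e (\<lambda>i. Leaf (of_bool (P i)))" and "ptime X e (\<lambda>i. Leaf (of_bool (Q i)))"
  shows "ptime X e (\<lambda>i. Leaf (of_bool (P i \<and> Q i)))"
  using ptime_mult[OF assms] by (simp add: of_bool_conj)

lemma ptime_not:
  assumes "ptime X e (\<lambda>i. Leaf (of_bool (P i)))"
  shows "ptime X e (\<lambda>i. Leaf (of_bool (\<not> P i)))"
  using ptime_diff[OF ptime_const[of _ _ "Leaf 1"] assms] by (simp add: of_bool_not_iff)

lemma ptime_neq:
  fixes a b :: "'i \<Rightarrow> int"
  assumes "ptime X e (\<lambda>i. Leaf (a i))" and "ptime X e (\<lambda>i. Leaf (b i))"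
  shows "ptime X e (\<lambda>i. Leaf (of_bool (a i \<noteq> b i)))"
proof -
  have "(a i \<noteq> b i) = (\<not> (a i \<le> b i \<and> b i \<le> a i))" for i by auto
  thus ?thesis
    using ptime_not[OF ptime_conj[OF ptime_le[OF assms] ptime_le[OF assms(2,1)]]] by simp
qed

text \<open>Inside a map, filter or fold, the current item is paired with the outer input. This
  makes everything computable from the outer input available there.\<close>

lemma ptime_lift:
  assumes "ptime X e f"
  shows "ptime (Sigma X S) (\<lambda>z. Node (e (fst z)) (g z)) (\<lambda>z. f (fst z))"
proof (rule ptime_comp)
  show "ptime (Sigma X S) (\<lambda>z. Node (e (fst z)) (g z)) (\<lambda>z. e (fst z))"
    by (rule ptime_fst[OF ptime_id])
  show "ptime (Sigma X S) (\<lambda>z. e (fst z)) (\<lambda>z. f (fst z))"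
    by (rule ptime_reindex[OF assms]) auto
qed

lemma ptime_item: "ptime (Sigma X S) (\<lambda>z. Node (e (fst z)) (g z)) g"
  by (rule ptime_snd[OF ptime_id])

lemma ptime_item_nat: "ptime (Sigma X S) (\<lambda>z. Node (e (fst z)) (enc_nat (snd z))) (\<lambda>z. Leaf (int (snd z)))"
  using ptime_item[of X S e "\<lambda>z. enc_nat (snd z)"] by (simp add: enc_nat_def)

subsection \<open>Lists\<close>

lemma enc_list_simps [simp]: "enc_list h [] = Leaf 0" "enc_list h (x # xs) = Node (h x) (enc_list h xs)"
  by (simp_all add: enc_list_def)

lemma enc_list_map [simp]: "enc_list h (map f xs) = enc_list (\<lambda>x. h (f x)) xs"
  by (induction xs) auto

lemma enc_list_cong: "(\<And>x. x \<in> set xs \<Longrightarrow> f x = g x) \<Longrightarrow> enc_list f xs = enc_list g xs"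
  by (induction xs) auto

lemma dsize_Leaf_0 [simp]: "floorlog 2 0 = 0"
  by (simp add: floorlog_def)

lemma dsize_enc_list: "dsize (enc_list h xs) = Suc (\<Sum>x\<leftarrow>xs. Suc (dsize (h x)))"
  by (induction xs) auto

lemma length_le_dsize: "length xs \<le> dsize (enc_list h xs)"
  by (induction xs) auto

lemma item_le_dsize: "x \<in> set xs \<Longrightarrow> dsize (h x) \<le> dsize (enc_list h xs)"
  by (induction xs) auto

lemma dsize_enc_list_le:
  assumes "\<And>x. x \<in> set xs \<Longrightarrow> dsize (h x) \<le> B"
  shows "dsize (enc_list h xs) \<le> Suc (length xs * Suc B)"
  using assms
proof (induction xs)
  case (Cons x xs)
  have "dsize (h x) \<le> B" "dsize (enc_list h xs) \<le> Suc (length xs * Suc B)"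
    using Cons by auto
  thus ?case by simp
qed simp

lemma dsize_enc_list_take: "dsize (enc_list h (take k xs)) \<le> dsize (enc_list h xs)"
  by (induction xs arbitrary: k) (auto simp: take_Cons split: nat.splits)

lemma dsize_enc_list_drop: "dsize (enc_list h (drop k xs)) \<le> dsize (enc_list h xs)"
  by (induction xs arbitrary: k) (auto simp: drop_Cons intro: le_SucI trans_le_add2 split: nat.splits)

lemma dsize_enc_list_filter: "dsize (enc_list h (filter P xs)) \<le> dsize (enc_list h xs)"
  by (induction xs) auto

lemma dsize_enc_list_rev: "dsize (enc_list h (rev xs)) = dsize (enc_list h xs)"
  by (simp add: dsize_enc_list flip: rev_map)

lemma dsize_enc_list_append: "dsize (enc_list h (xs @ ys)) \<le> dsize (enc_list h xs) + dsize (enc_list h ys)"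
  by (simp add: dsize_enc_list)

text \<open>The workhorse for lists. \<open>acc i k\<close> is the accumulator after
  \<open>k\<close> items; as in \<open>ptime_loop\<close>, its size has to be bounded for all
  \<open>k\<close> at once.\<close>

lemma ptime_fold:
  assumes xs: "ptime X e (\<lambda>i. enc_list h (xs i))"
    and init: "ptime X e (\<lambda>i. acc i 0)"
    and step: "ptime (SIGMA i:X. {..<length (xs i)})
      (\<lambda>z. Node (e (fst z)) (Node (h (xs (fst z) ! snd z)) (acc (fst z) (snd z))))
      (\<lambda>z. acc (fst z) (Suc (snd z)))"
    and size: "\<And>i k. i \<in> X \<Longrightarrow> k \<le> length (xs i) \<Longrightarrow> dsize (acc i k) \<le> poly q (dsize (e i))"
  shows "ptime X e (\<lambda>i. acc i (length (xs i)))"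
proof -
  \<comment> \<open>The state holds the unread suffix, whose being a \<open>Node\<close> is the loop
    test, an untouched copy of the input for the step to consult, and the accumulator.\<close>
  define st where "st = (\<lambda>i k. Node (enc_list h (drop k (xs i))) (Node (e i) (acc i k)))"
  obtain ql where ql: "\<And>i. i \<in> X \<Longrightarrow> dsize (enc_list h (xs i)) \<le> poly ql (dsize (e i))"
    using ptime_size[OF xs] by blast
  have "ptime X e (\<lambda>i. st i (length (xs i)))"
  proof (rule ptime_loop)
    show "ptime X e (\<lambda>i. st i 0)"
      unfolding st_def by (intro ptime_Node ptime_id init) (simp add: xs)
    show "ptime (SIGMA i:X. {..length (xs i)}) (\<lambda>z. st (fst z) (snd z))
       (\<lambda>z. Leaf (of_bool (snd z < length (xs (fst z)))))"
    proof (rule ptime_cong)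
      show "ptime (SIGMA i:X. {..length (xs i)}) (\<lambda>z. st (fst z) (snd z))
        (\<lambda>z. app_prim IsNode (enc_list h (drop (snd z) (xs (fst z)))))"
        unfolding st_def by (intro ptime_prim' ptime_fst[OF ptime_id])
      fix z show "app_prim IsNode (enc_list h (drop (snd z) (xs (fst z)))) = Leaf (of_bool (snd z < length (xs (fst z))))"
        by (cases "drop (snd z) (xs (fst z))") (auto simp: drop_eq_Nil2 dest: arg_cong[of _ _ length])
    qed
    show "ptime (SIGMA i:X. {..<length (xs i)}) (\<lambda>z. st (fst z) (snd z)) (\<lambda>z. st (fst z) (Suc (snd z)))"
    proof -
      let ?Y = "SIGMA i:X. {..<length (xs i)}"
      let ?st = "\<lambda>z. st (fst z) (snd z)"
      have "ptime ?Y ?st (\<lambda>z. enc_list h (drop (snd z) (xs (fst z))))"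
        unfolding st_def by (rule ptime_fst[OF ptime_id])
      hence hd: "ptime ?Y ?st (\<lambda>z. Node (h (xs (fst z) ! snd z)) (enc_list h (drop (Suc (snd z)) (xs (fst z)))))"
        by (rule ptime_cong) (auto simp flip: Cons_nth_drop_Suc)
      have tl: "ptime ?Y ?st (\<lambda>z. Node (e (fst z)) (acc (fst z) (snd z)))"
        unfolding st_def by (rule ptime_snd[OF ptime_id])
      have "ptime ?Y ?st (\<lambda>z. acc (fst z) (Suc (snd z)))"
        by (rule ptime_comp[OF _ step]) (intro ptime_Node ptime_fst[OF tl] ptime_snd[OF tl] ptime_fst[OF hd])
      with ptime_snd[OF hd] ptime_fst[OF tl] show ?thesis
        unfolding st_def by (intro ptime_Node)
    qed
    fix i k assume i: "i \<in> X" "k \<le> length (xs i)"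
    show "dsize (st i k) \<le> poly ([:2,1:] + ql + q) (dsize (e i))"
      using size[OF i] ql[OF i(1)] dsize_enc_list_drop[of h k "xs i"] by (simp add: st_def)
  next
    fix i assume "i \<in> X"
    from ql[OF this] show "length (xs i) \<le> poly ql (dsize (e i))"
      using length_le_dsize order_trans by blast
  qed
  hence "ptime X e (\<lambda>i. Node (enc_list h (drop (length (xs i)) (xs i))) (Node (e i) (acc i (length (xs i)))))"
    unfolding st_def .
  from ptime_snd[OF ptime_snd[OF this]] show ?thesis .
qed

text \<open>A list can be extended only in front, so a fold naturally reverses. The folds for map
  and filter build their results backwards and then apply this.\<close>

lemma ptime_rev:
  assumes "ptime X e (\<lambda>i. enc_list h (xs i))"
  shows "ptime X e (\<lambda>i. enc_list h (rev (xs i)))"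
proof -
  obtain q where q: "\<And>i. i \<in> X \<Longrightarrow> dsize (enc_list h (xs i)) \<le> poly q (dsize (e i))"
    using ptime_size[OF assms] by blast
  let ?Y = "SIGMA i:X. {..<length (xs i)}"
  have "ptime X e (\<lambda>i. enc_list h (rev (take (length (xs i)) (xs i))))"
  proof (rule ptime_fold[OF assms, where acc = "\<lambda>i k. enc_list h (rev (take k (xs i)))"])
    have "ptime ?Y (\<lambda>z. Node (e (fst z)) (Node (h (xs (fst z) ! snd z)) (enc_list h (rev (take (snd z) (xs (fst z)))))))
      (\<lambda>z. Node (h (xs (fst z) ! snd z)) (enc_list h (rev (take (snd z) (xs (fst z))))))"
      by (rule ptime_item)
    thus "ptime ?Y (\<lambda>z. Node (e (fst z)) (Node (h (xs (fst z) ! snd z)) (enc_list h (rev (take (snd z) (xs (fst z)))))))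
      (\<lambda>z. enc_list h (rev (take (Suc (snd z)) (xs (fst z)))))"
      by (rule ptime_cong) (auto simp: take_Suc_conv_app_nth)
    fix i k assume "i \<in> X"
    from q[OF this] show "dsize (enc_list h (rev (take k (xs i)))) \<le> poly q (dsize (e i))"
      using dsize_enc_list_take[of h k "xs i"] by (simp add: dsize_enc_list_rev)
  qed (simp add: ptime_const)
  thus ?thesis by simp
qed

lemma ptime_append:
  assumes "ptime X e (\<lambda>i. enc_list h (xs i))" and ys: "ptime X e (\<lambda>i. enc_list h (ys i))"
  shows "ptime X e (\<lambda>i. enc_list h (xs i @ ys i))"
proof -
  define rs where "rs = (\<lambda>i. rev (xs i))"
  have rs: "ptime X e (\<lambda>i. enc_list h (rs i))"
    unfolding rs_def by (rule ptime_rev[OF assms(1)])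
  obtain q1 where q1: "\<And>i. i \<in> X \<Longrightarrow> dsize (enc_list h (rs i)) \<le> poly q1 (dsize (e i))"
    using ptime_size[OF rs] by blast
  obtain q2 where q2: "\<And>i. i \<in> X \<Longrightarrow> dsize (enc_list h (ys i)) \<le> poly q2 (dsize (e i))"
    using ptime_size[OF ys] by blast
  let ?Y = "SIGMA i:X. {..<length (rs i)}"
  have "ptime X e (\<lambda>i. enc_list h (rev (take (length (rs i)) (rs i)) @ ys i))"
  proof (rule ptime_fold[OF rs, where acc = "\<lambda>i k. enc_list h (rev (take k (rs i)) @ ys i)"])
    have "ptime ?Y (\<lambda>z. Node (e (fst z)) (Node (h (rs (fst z) ! snd z)) (enc_list h (rev (take (snd z) (rs (fst z))) @ ys (fst z)))))
      (\<lambda>z. Node (h (rs (fst z) ! snd z)) (enc_list h (rev (take (snd z) (rs (fst z))) @ ys (fst z))))"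
      by (rule ptime_item)
    thus "ptime ?Y (\<lambda>z. Node (e (fst z)) (Node (h (rs (fst z) ! snd z)) (enc_list h (rev (take (snd z) (rs (fst z))) @ ys (fst z)))))
      (\<lambda>z. enc_list h (rev (take (Suc (snd z)) (rs (fst z))) @ ys (fst z)))"
      by (rule ptime_cong) (auto simp: take_Suc_conv_app_nth)
    fix i k assume "i \<in> X"
    from q1[OF this] q2[OF this] show "dsize (enc_list h (rev (take k (rs i)) @ ys i)) \<le> poly (q1 + q2) (dsize (e i))"
      using dsize_enc_list_take[of h k "rs i"] dsize_enc_list_append[of h "rev (take k (rs i))" "ys i"]
      by (simp add: dsize_enc_list_rev)
  qed (use ys in simp)
  thus ?thesis by (simp add: rs_def)
qed

text \<open>The image list is the same list under another encoding: \<open>g i x\<close> is the code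
  of the image of \<open>x\<close>, so any type of images is covered.\<close>

lemma ptime_map:
  assumes xs: "ptime X e (\<lambda>i. enc_list h (xs i))"
    and f: "ptime (SIGMA i:X. set (xs i)) (\<lambda>z. Node (e (fst z)) (h (snd z))) (\<lambda>z. g (fst z) (snd z))"
  shows "ptime X e (\<lambda>i. enc_list (g i) (xs i))"
proof -
  obtain q where q: "\<And>i. i \<in> X \<Longrightarrow> dsize (enc_list h (xs i)) \<le> poly q (dsize (e i))"
    using ptime_size[OF xs] by blast
  obtain r where "\<And>z. z \<in> (SIGMA i:X. set (xs i)) \<Longrightarrow> dsize (g (fst z) (snd z)) \<le> poly r (dsize (Node (e (fst z)) (h (snd z))))"
    using ptime_size[OF f] by blast
  hence r: "dsize (g i x) \<le> poly r (Suc (dsize (e i) + dsize (h x)))" if "i \<in> X" "x \<in> set (xs i)" for i x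
    using that by fastforce
  let ?Y = "SIGMA i:X. {..<length (xs i)}"
  let ?e = "\<lambda>z. Node (e (fst z)) (Node (h (xs (fst z) ! snd z)) (enc_list (g (fst z)) (rev (take (snd z) (xs (fst z))))))"
  have "ptime X e (\<lambda>i. enc_list (g i) (rev (take (length (xs i)) (xs i))))"
  proof (rule ptime_fold[OF xs, where acc = "\<lambda>i k. enc_list (g i) (rev (take k (xs i)))"])
    have tl: "ptime ?Y ?e (\<lambda>z. Node (h (xs (fst z) ! snd z)) (enc_list (g (fst z)) (rev (take (snd z) (xs (fst z))))))"
      by (rule ptime_item)
    have "ptime ?Y ?e (\<lambda>z. g (fst z) (xs (fst z) ! snd z))"
    proof (rule ptime_comp)
      show "ptime ?Y ?e (\<lambda>z. Node (e (fst z)) (h (xs (fst z) ! snd z)))"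
        by (intro ptime_Node ptime_fst[OF tl] ptime_lift[OF ptime_id])
      show "ptime ?Y (\<lambda>z. Node (e (fst z)) (h (xs (fst z) ! snd z))) (\<lambda>z. g (fst z) (xs (fst z) ! snd z))"
        using ptime_reindex[OF f, of ?Y "\<lambda>z. (fst z, xs (fst z) ! snd z)"] by force
    qed
    from ptime_Node[OF this ptime_snd[OF tl]]
    show "ptime ?Y ?e (\<lambda>z. enc_list (g (fst z)) (rev (take (Suc (snd z)) (xs (fst z)))))"
      by (rule ptime_cong) (auto simp: take_Suc_conv_app_nth)
    fix i k assume i: "i \<in> X" "k \<le> length (xs i)"
    define x where "x = dsize (e i)"
    \<comment> \<open>An item is no larger than the list containing it, so \<open>b\<close> bounds
      the code of every image uniformly.\<close>
    define b where "b = poly r (Suc (x + poly q x))"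
    have "dsize (g i v) \<le> b" if "v \<in> set (xs i)" for v
    proof -
      have "dsize (h v) \<le> poly q x"
        using q[OF i(1)] item_le_dsize[OF that, of h] by (simp add: x_def)
      hence "poly r (Suc (dsize (e i) + dsize (h v))) \<le> b"
        unfolding b_def x_def by (intro poly_nat_mono) auto
      with r[OF i(1) that] show ?thesis by simp
    qed
    hence "dsize (enc_list (g i) (xs i)) \<le> Suc (length (xs i) * Suc b)"
      by (rule dsize_enc_list_le)
    also have "\<dots> \<le> Suc (poly q x * Suc b)"
      using q[OF i(1)] length_le_dsize[of "xs i" h] by (intro Suc_le_mono[THEN iffD2] mult_le_mono1) (auto simp: x_def)
    finally show "dsize (enc_list (g i) (rev (take k (xs i)))) \<le>
       poly ([:1:] + q * ([:1:] + pcompose r ([:1,1:] + q))) (dsize (e i))"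
      using dsize_enc_list_take[of "g i" k "xs i"]
      by (simp add: dsize_enc_list_rev poly_pcompose b_def x_def)
  qed (simp add: ptime_const)
  \<comment> \<open>The encoding \<open>g i\<close> depends on the input, whereas
    \<open>ptime_rev\<close> wants a fixed one; so the codes themselves become the list
    items.\<close>
  hence "ptime X e (\<lambda>i. enc_list (\<lambda>y. y) (rev (map (g i) (xs i))))"
    by (simp add: rev_map)
  from ptime_rev[OF this] show ?thesis by simp
qed

lemma ptime_filter:
  assumes xs: "ptime X e (\<lambda>i. enc_list h (xs i))"
    and P: "ptime (SIGMA i:X. set (xs i)) (\<lambda>z. Node (e (fst z)) (h (snd z))) (\<lambda>z. Leaf (of_bool (P (fst z) (snd z))))"
  shows "ptime X e (\<lambda>i. enc_list h (filter (P i) (xs i)))"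
proof -
  obtain q where q: "\<And>i. i \<in> X \<Longrightarrow> dsize (enc_list h (xs i)) \<le> poly q (dsize (e i))"
    using ptime_size[OF xs] by blast
  let ?Y = "SIGMA i:X. {..<length (xs i)}"
  let ?a = "\<lambda>z. enc_list h (rev (filter (P (fst z)) (take (snd z) (xs (fst z)))))"
  let ?e = "\<lambda>z. Node (e (fst z)) (Node (h (xs (fst z) ! snd z)) (?a z))"
  have "ptime X e (\<lambda>i. enc_list h (rev (filter (P i) (take (length (xs i)) (xs i)))))"
  proof (rule ptime_fold[OF xs, where acc = "\<lambda>i k. enc_list h (rev (filter (P i) (take k (xs i))))"])
    have tl: "ptime ?Y ?e (\<lambda>z. Node (h (xs (fst z) ! snd z)) (?a z))"
      by (rule ptime_item)
    have "ptime ?Y ?e (\<lambda>z. Leaf (of_bool (P (fst z) (xs (fst z) ! snd z))))"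
    proof (rule ptime_comp)
      show "ptime ?Y ?e (\<lambda>z. Node (e (fst z)) (h (xs (fst z) ! snd z)))"
        by (intro ptime_Node ptime_fst[OF tl] ptime_lift[OF ptime_id])
      show "ptime ?Y (\<lambda>z. Node (e (fst z)) (h (xs (fst z) ! snd z))) (\<lambda>z. Leaf (of_bool (P (fst z) (xs (fst z) ! snd z))))"
        using ptime_reindex[OF P, of ?Y "\<lambda>z. (fst z, xs (fst z) ! snd z)"] by force
    qed
    hence "ptime ?Y ?e (\<lambda>z. if P (fst z) (xs (fst z) ! snd z) then Node (h (xs (fst z) ! snd z)) (?a z) else ?a z)"
      by (rule ptime_if) (rule ptime_subset[OF tl] ptime_subset[OF ptime_snd[OF tl]], blast)+
    thus "ptime ?Y ?e (\<lambda>z. enc_list h (rev (filter (P (fst z)) (take (Suc (snd z)) (xs (fst z))))))"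
      by (rule ptime_cong) (auto simp: take_Suc_conv_app_nth)
    fix i k assume "i \<in> X"
    from q[OF this] show "dsize (enc_list h (rev (filter (P i) (take k (xs i))))) \<le> poly q (dsize (e i))"
      using dsize_enc_list_take[of h k "xs i"] dsize_enc_list_filter[of h "P i" "take k (xs i)"]
      by (simp add: dsize_enc_list_rev)
  qed (simp add: ptime_const)
  from ptime_rev[OF this] show ?thesis by simp
qed

lemma dsize_sum_list: "dsize (Leaf (sum_list xs)) \<le> dsize (enc_list Leaf xs)"
proof (induction xs)
  case (Cons x xs)
  thus ?case using dsize_add[of x "sum_list xs"] by simp
qed simp

text \<open>Sizes add under multiplication, so a product over a list stays as short as the list. The
  \<open>Suc\<close> pays for the empty product \<open>Leaf 1\<close>. This keeps the common
  denominator polynomial.\<close>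

lemma dsize_prod_list: "dsize (Leaf (prod_list xs)) \<le> Suc (dsize (enc_list Leaf xs))"
proof (induction xs)
  case (Cons x xs)
  thus ?case using dsize_mult[of x "prod_list xs"] by simp
qed (simp add: floorlog_def)

lemma ptime_sum_list:
  assumes xs: "ptime X e (\<lambda>i. enc_list Leaf (xs i))"
  shows "ptime X e (\<lambda>i. Leaf (sum_list (xs i)))"
proof -
  obtain q where q: "\<And>i. i \<in> X \<Longrightarrow> dsize (enc_list Leaf (xs i)) \<le> poly q (dsize (e i))"
    using ptime_size[OF xs] by blast
  let ?Y = "SIGMA i:X. {..<length (xs i)}"
  let ?a = "\<lambda>z. Leaf (sum_list (take (snd z) (xs (fst z))))"
  let ?e = "\<lambda>z. Node (e (fst z)) (Node (Leaf (xs (fst z) ! snd z)) (?a z))"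
  have "ptime X e (\<lambda>i. Leaf (sum_list (take (length (xs i)) (xs i))))"
  proof (rule ptime_fold[OF xs, where acc = "\<lambda>i k. Leaf (sum_list (take k (xs i)))"])
    have tl: "ptime ?Y ?e (\<lambda>z. Node (Leaf (xs (fst z) ! snd z)) (?a z))"
      by (rule ptime_item)
    from ptime_add[OF ptime_snd[OF tl] ptime_fst[OF tl]]
    show "ptime ?Y ?e (\<lambda>z. Leaf (sum_list (take (Suc (snd z)) (xs (fst z)))))"
      by (rule ptime_cong) (auto simp: take_Suc_conv_app_nth)
    fix i k assume "i \<in> X"
    from q[OF this] show "dsize (Leaf (sum_list (take k (xs i)))) \<le> poly q (dsize (e i))"
      using dsize_enc_list_take[of Leaf k "xs i"] dsize_sum_list[of "take k (xs i)"]
      by linarith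
  qed (simp add: ptime_const)
  thus ?thesis by simp
qed

lemma ptime_prod_list:
  assumes xs: "ptime X e (\<lambda>i. enc_list Leaf (xs i))"
  shows "ptime X e (\<lambda>i. Leaf (prod_list (xs i)))"
proof -
  obtain q where q: "\<And>i. i \<in> X \<Longrightarrow> dsize (enc_list Leaf (xs i)) \<le> poly q (dsize (e i))"
    using ptime_size[OF xs] by blast
  let ?Y = "SIGMA i:X. {..<length (xs i)}"
  let ?a = "\<lambda>z. Leaf (prod_list (take (snd z) (xs (fst z))))"
  let ?e = "\<lambda>z. Node (e (fst z)) (Node (Leaf (xs (fst z) ! snd z)) (?a z))"
  have "ptime X e (\<lambda>i. Leaf (prod_list (take (length (xs i)) (xs i))))"
  proof (rule ptime_fold[OF xs, where acc = "\<lambda>i k. Leaf (prod_list (take k (xs i)))"])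
    have tl: "ptime ?Y ?e (\<lambda>z. Node (Leaf (xs (fst z) ! snd z)) (?a z))"
      by (rule ptime_item)
    from ptime_mult[OF ptime_snd[OF tl] ptime_fst[OF tl]]
    show "ptime ?Y ?e (\<lambda>z. Leaf (prod_list (take (Suc (snd z)) (xs (fst z)))))"
      by (rule ptime_cong) (auto simp: take_Suc_conv_app_nth)
    fix i k assume "i \<in> X"
    from q[OF this] show "dsize (Leaf (prod_list (take k (xs i)))) \<le> poly ([:1:] + q) (dsize (e i))"
      using dsize_enc_list_take[of Leaf k "xs i"] dsize_prod_list[of "take k (xs i)"]
      by simp
  qed (simp add: ptime_const)
  thus ?thesis by simp
qed

text \<open>The range is counted along a list that is already present: up to a number given in
  binary it could be exponentially long.\<close>

lemma ptime_upt:
  assumes xs: "ptime X e (\<lambda>i. enc_list h (xs i))"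
  shows "ptime X e (\<lambda>i. enc_list enc_nat [0..<length (xs i)])"
proof -
  obtain q where q: "\<And>i. i \<in> X \<Longrightarrow> dsize (enc_list h (xs i)) \<le> poly q (dsize (e i))"
    using ptime_size[OF xs] by blast
  let ?Y = "SIGMA i:X. {..<length (xs i)}"
  let ?a = "\<lambda>z. Node (Leaf (int (snd z))) (enc_list enc_nat (rev [0..<snd z]))"
  let ?e = "\<lambda>z. Node (e (fst z)) (Node (h (xs (fst z) ! snd z)) (?a z))"
  have "ptime X e (\<lambda>i. Node (Leaf (int (length (xs i)))) (enc_list enc_nat (rev [0..<length (xs i)])))"
  proof (rule ptime_fold[OF xs, where acc = "\<lambda>i k. Node (Leaf (int k)) (enc_list enc_nat (rev [0..<k]))"])
    have tl: "ptime ?Y ?e (\<lambda>z. Node (h (xs (fst z) ! snd z)) (?a z))"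
      by (rule ptime_item)
    note acc = ptime_snd[OF tl]
    have "ptime ?Y ?e (\<lambda>z. Node (Leaf (int (snd z) + 1)) (Node (Leaf (int (snd z))) (enc_list enc_nat (rev [0..<snd z]))))"
      by (intro ptime_Node ptime_add ptime_const ptime_fst[OF acc] ptime_snd[OF acc])
    thus "ptime ?Y ?e (\<lambda>z. Node (Leaf (int (Suc (snd z)))) (enc_list enc_nat (rev [0..<Suc (snd z)])))"
      by (rule ptime_cong) (auto simp: enc_nat_def)
    fix i k assume i: "i \<in> X" and k: "k \<le> length (xs i)"
    have k: "k \<le> poly q (dsize (e i))"
      using k q[OF i] length_le_dsize[of "xs i" h] by linarith
    have "dsize (enc_list enc_nat (rev [0..<k])) \<le> Suc (length (rev [0..<k]) * Suc (Suc k))"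
    proof (rule dsize_enc_list_le)
      fix x assume "x \<in> set (rev [0..<k])"
      thus "dsize (enc_nat x) \<le> Suc k"
        using dsize_int_le[of x] unfolding enc_nat_def by simp
    qed
    also have "\<dots> \<le> Suc (poly q (dsize (e i)) * Suc (Suc (poly q (dsize (e i)))))"
      using k by (simp add: add_mono mult_mono)
    finally show "dsize (Node (Leaf (int k)) (enc_list enc_nat (rev [0..<k]))) \<le>
        poly ([:3:] + q + q * ([:2:] + q)) (dsize (e i))"
      using dsize_int_le[of k] k by simp
  qed (simp add: ptime_const)
  from ptime_rev[OF ptime_snd[OF this]] show ?thesis by simp
qed

lemma ptime_nth:
  assumes xs: "ptime X e (\<lambda>i. enc_list h (xs i))" and k: "ptime X e (\<lambda>i. Leaf (int (k i)))"
    and len: "\<And>i. i \<in> X \<Longrightarrow> k i < length (xs i)"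
  shows "ptime X e (\<lambda>i. h (xs i ! k i))"
proof -
  obtain q where q: "\<And>i. i \<in> X \<Longrightarrow> dsize (enc_list h (xs i)) \<le> poly q (dsize (e i))"
    using ptime_size[OF xs] by blast
  let ?Y = "SIGMA i:X. {..<length (xs i)}"
  \<comment> \<open>A countdown from \<open>k i\<close> together with the item last copied. Items
    are copied while the countdown is nonnegative, so the copy freezes at index \<open>k i\<close>;
    \<open>Leaf 0\<close> is a dummy before the first item.\<close>
  define acc where "acc = (\<lambda>i j. Node (Leaf (int (k i) - int j)) (if j = 0 then Leaf 0 else h (xs i ! min (j - 1) (k i))))"
  let ?e = "\<lambda>z. Node (e (fst z)) (Node (h (xs (fst z) ! snd z)) (acc (fst z) (snd z)))"
  have "ptime X e (\<lambda>i. acc i (length (xs i)))"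
  proof (rule ptime_fold[OF xs])
    show "ptime X e (\<lambda>i. acc i 0)"
      unfolding acc_def using k by (auto intro!: ptime_Node ptime_const)
    have tl: "ptime ?Y ?e (\<lambda>z. Node (h (xs (fst z) ! snd z)) (acc (fst z) (snd z)))"
      by (rule ptime_item)
    note acc = ptime_snd[OF tl, unfolded acc_def]
    have "ptime ?Y ?e (\<lambda>z. Node (Leaf (int (k (fst z)) - int (snd z) - 1))
      (if 0 \<le> int (k (fst z)) - int (snd z) then h (xs (fst z) ! snd z)
       else (if snd z = 0 then Leaf 0 else h (xs (fst z) ! min (snd z - 1) (k (fst z))))))"
      unfolding acc_def
      by (intro ptime_Node ptime_diff ptime_const ptime_if ptime_le ptime_fst[OF acc]
          ptime_subset[OF ptime_snd[OF acc]] ptime_subset[OF ptime_fst[OF tl[unfolded acc_def]]]) auto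
    thus "ptime ?Y ?e (\<lambda>z. acc (fst z) (Suc (snd z)))"
    proof (rule ptime_cong)
      fix z assume "z \<in> ?Y"
      have "min (snd z - 1) (k (fst z)) = min (snd z) (k (fst z))" if "\<not> snd z \<le> k (fst z)"
        using that by simp
      thus "Node (Leaf (int (k (fst z)) - int (snd z) - 1))
        (if 0 \<le> int (k (fst z)) - int (snd z) then h (xs (fst z) ! snd z)
         else (if snd z = 0 then Leaf 0 else h (xs (fst z) ! min (snd z - 1) (k (fst z))))) = acc (fst z) (Suc (snd z))"
        by (auto simp: acc_def)
    qed
    fix i j assume i: "i \<in> X" and j: "j \<le> length (xs i)"
    have kl: "k i < length (xs i)" by (rule len[OF i])
    have l: "length (xs i) \<le> poly q (dsize (e i))"
      using q[OF i] length_le_dsize[of "xs i" h] by linarith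
    have "dsize (Leaf (int (k i) - int j)) \<le> Suc (k i) + Suc j"
      using dsize_diff[of "int (k i)" "int j"] dsize_int_le[of "k i"] dsize_int_le[of j] by linarith
    moreover have "dsize (if j = 0 then Leaf 0 else h (xs i ! min (j - 1) (k i))) \<le> poly q (dsize (e i))"
    proof (cases "j = 0")
      case True
      thus ?thesis using l kl by auto
    next
      case False
      hence "xs i ! min (j - 1) (k i) \<in> set (xs i)" using kl by (intro nth_mem) auto
      from item_le_dsize[OF this, of h] q[OF i] False show ?thesis by auto
    qed
    ultimately show "dsize (acc i j) \<le> poly ([:3:] + 3 * q) (dsize (e i))"
      using j kl l by (simp add: acc_def)
  qed
  from ptime_snd[OF this[unfolded acc_def]] show ?thesis
  proof (rule ptime_cong)
    fix i assume "i \<in> X"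
    from len[OF this] have "length (xs i) \<noteq> 0" "min (length (xs i) - 1) (k i) = k i" by auto
    thus "(if length (xs i) = 0 then Leaf 0 else h (xs i ! min (length (xs i) - 1) (k i))) = h (xs i ! k i)"
      by simp
  qed
qed

lemma ptime_take:
  assumes xs: "ptime X e (\<lambda>i. enc_list h (xs i))" and k: "ptime X e (\<lambda>i. Leaf (int (k i)))"
  shows "ptime X e (\<lambda>i. enc_list h (take (k i) (xs i)))"
proof -
  have "filter (\<lambda>j. int j < int k) [0..<n] = [0..<min k n]" for k n
    by (induction n) (auto simp: min_def le_Suc_eq)
  moreover have "map ((!) xs) [0..<min k (length xs)] = take k xs" for xs :: "'b list" and k
    by (rule nth_equalityI) auto
  ultimately have *: "map ((!) xs) (filter (\<lambda>j. int j < int k) [0..<length xs]) = take k xs" for xs :: "'b list" and k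
    by simp
  have "ptime X e (\<lambda>i. enc_list enc_nat (filter (\<lambda>j. int j < int (k i)) [0..<length (xs i)]))"
    by (rule ptime_filter[OF ptime_upt[OF xs]])
      (intro ptime_less ptime_lift[OF k] ptime_item_nat)
  hence "ptime X e (\<lambda>i. enc_list (\<lambda>j. h (xs i ! j)) (filter (\<lambda>j. int j < int (k i)) [0..<length (xs i)]))"
    by (rule ptime_map) (intro ptime_nth ptime_lift[OF xs]
      ptime_item_nat, auto)
  thus ?thesis by (simp only: enc_list_map[symmetric] *)
qed

lemma ptime_drop:
  assumes xs: "ptime X e (\<lambda>i. enc_list h (xs i))" and k: "ptime X e (\<lambda>i. Leaf (int (k i)))"
  shows "ptime X e (\<lambda>i. enc_list h (drop (k i) (xs i)))"
proof -
  have "filter (\<lambda>j. int k \<le> int j) [0..<n] = [k..<n]" for k n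
    by (induction n) auto
  moreover have "map ((!) xs) [k..<length xs] = drop k xs" for xs :: "'b list" and k
    by (rule nth_equalityI) auto
  ultimately have *: "map ((!) xs) (filter (\<lambda>j. int k \<le> int j) [0..<length xs]) = drop k xs" for xs :: "'b list" and k
    by simp
  have "ptime X e (\<lambda>i. enc_list enc_nat (filter (\<lambda>j. int (k i) \<le> int j) [0..<length (xs i)]))"
    by (rule ptime_filter[OF ptime_upt[OF xs]])
      (intro ptime_le ptime_lift[OF k] ptime_item_nat)
  hence "ptime X e (\<lambda>i. enc_list (\<lambda>j. h (xs i ! j)) (filter (\<lambda>j. int (k i) \<le> int j) [0..<length (xs i)]))"
    by (rule ptime_map) (intro ptime_nth ptime_lift[OF xs]
      ptime_item_nat, auto)
  thus ?thesis by (simp only: enc_list_map[symmetric] *)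
qed


section \<open>Selecting an element of maximum value\<close>

definition best :: "('a \<Rightarrow> int) \<Rightarrow> 'a \<Rightarrow> 'a list \<Rightarrow> 'a" where
  "best f = foldl (\<lambda>a x. if f a < f x then x else a)"

lemma best_mem: "best f a xs \<in> insert a (set xs)"
  unfolding best_def by (induction xs arbitrary: a) fastforce+

lemma best_ge: "x \<in> insert a (set xs) \<Longrightarrow> f x \<le> f (best f a xs)"
proof (induction xs arbitrary: a x)
  case (Cons y ys)
  let ?a = "if f a < f y then y else a"
  have "f x \<le> f ?a \<or> x \<in> set ys" "f ?a \<le> f (best f ?a ys)" "x \<in> set ys \<Longrightarrow> f x \<le> f (best f ?a ys)"
    using Cons by auto
  moreover have "best f a (y # ys) = best f ?a ys" by (simp add: best_def)
  ultimately show ?case by fastforce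
qed (simp add: best_def)

lemma ptime_best:
  assumes xs: "ptime X e (\<lambda>i. enc_list h (xs i))" and a: "ptime X e (\<lambda>i. h (a i))"
    and f: "ptime (SIGMA i:X. insert (a i) (set (xs i))) (\<lambda>z. Node (e (fst z)) (h (snd z)))
      (\<lambda>z. Leaf (f (fst z) (snd z)))"
  shows "ptime X e (\<lambda>i. h (best (f i) (a i) (xs i)))"
proof -
  obtain q where q: "\<And>i. i \<in> X \<Longrightarrow> dsize (enc_list h (xs i)) \<le> poly q (dsize (e i))"
    using ptime_size[OF xs] by blast
  obtain r where r: "\<And>i. i \<in> X \<Longrightarrow> dsize (h (a i)) \<le> poly r (dsize (e i))"
    using ptime_size[OF a] by blast
  let ?Y = "SIGMA i:X. {..<length (xs i)}"
  let ?b = "\<lambda>z. best (f (fst z)) (a (fst z)) (take (snd z) (xs (fst z)))"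
  let ?x = "\<lambda>z. xs (fst z) ! snd z"
  let ?e = "\<lambda>z. Node (e (fst z)) (Node (h (?x z)) (h (?b z)))"
  have mem: "best (f i) (a i) (take k (xs i)) \<in> insert (a i) (set (xs i))" for i k
    using best_mem[of "f i" "a i" "take k (xs i)"] set_take_subset[of k "xs i"] by auto
  have "ptime X e (\<lambda>i. h (best (f i) (a i) (take (length (xs i)) (xs i))))"
  proof (rule ptime_fold[OF xs, where acc = "\<lambda>i k. h (best (f i) (a i) (take k (xs i)))"])
    have tl: "ptime ?Y ?e (\<lambda>z. Node (h (?x z)) (h (?b z)))"
      by (rule ptime_item)
    have fx: "ptime ?Y ?e (\<lambda>z. Leaf (f (fst z) (?x z)))"
    proof (rule ptime_comp)
      show "ptime ?Y ?e (\<lambda>z. Node (e (fst z)) (h (?x z)))"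
        by (intro ptime_Node ptime_fst[OF tl] ptime_lift[OF ptime_id])
      show "ptime ?Y (\<lambda>z. Node (e (fst z)) (h (?x z))) (\<lambda>z. Leaf (f (fst z) (?x z)))"
        using ptime_reindex[OF f, of ?Y "\<lambda>z. (fst z, ?x z)"] by force
    qed
    have fb: "ptime ?Y ?e (\<lambda>z. Leaf (f (fst z) (?b z)))"
    proof (rule ptime_comp)
      show "ptime ?Y ?e (\<lambda>z. Node (e (fst z)) (h (?b z)))"
        by (intro ptime_Node ptime_snd[OF tl] ptime_lift[OF ptime_id])
      show "ptime ?Y (\<lambda>z. Node (e (fst z)) (h (?b z))) (\<lambda>z. Leaf (f (fst z) (?b z)))"
        using ptime_reindex[OF f, of ?Y "\<lambda>z. (fst z, ?b z)"] mem by force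
    qed
    have "ptime ?Y ?e (\<lambda>z. if f (fst z) (?b z) < f (fst z) (?x z) then h (?x z) else h (?b z))"
      by (intro ptime_if ptime_less fx fb ptime_subset[OF ptime_fst[OF tl]] ptime_subset[OF ptime_snd[OF tl]]) auto
    thus "ptime ?Y ?e (\<lambda>z. h (best (f (fst z)) (a (fst z)) (take (Suc (snd z)) (xs (fst z)))))"
      by (rule ptime_cong) (auto simp: take_Suc_conv_app_nth best_def)
    fix i k assume i: "i \<in> X"
    show "dsize (h (best (f i) (a i) (take k (xs i)))) \<le> poly (q + r) (dsize (e i))"
      using mem[of i k] q[OF i] r[OF i] item_le_dsize[of "best (f i) (a i) (take k (xs i))" "xs i" h]
      by auto
  qed (use a in \<open>simp add: best_def\<close>)
  thus ?thesis by simp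
qed

section \<open>Walks\<close>

lemma walk_length_single [simp]: "walk_length d [x] = 0"
  by (simp add: walk_length_def)

lemma walk_length_Cons: "walk_length d (x # y # p) = d x y + walk_length d (y # p)"
  unfolding walk_length_def by (simp add: sum.lessThan_Suc_shift del: sum.lessThan_Suc)

lemma walk_length_nonneg:
  fixes d :: "'v \<Rightarrow> 'v \<Rightarrow> 'a::ordered_comm_monoid_add"
  assumes "\<And>u v. 0 \<le> d u v"
  shows "0 \<le> walk_length d p"
  unfolding walk_length_def using assms by (intro sum_nonneg) auto

text \<open>The triangle inequality removes one vertex at a time. The set \<open>S\<close> is there
  because the inequality is known only between vertices of the instance.\<close>

lemma walk_length_subseq:
  fixes d :: "'v \<Rightarrow> 'v \<Rightarrow> nat"
  assumes "subseq ys xs" "\<And>x y z. x \<in> S \<Longrightarrow> y \<in> S \<Longrightarrow> z \<in> S \<Longrightarrow> d x z \<le> d x y + d y z"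
    "x \<in> S" "set xs \<subseteq> S"
  shows "walk_length d (x # ys) \<le> walk_length d (x # xs)"
  using assms(1,3,4)
proof (induction arbitrary: x rule: list_emb.induct)
  case (list_emb_Cons ys xs y)
  show ?case
  proof (cases ys)
    case Nil
    thus ?thesis by simp
  next
    case (Cons z zs)
    have *: "walk_length d (y # ys) \<le> walk_length d (y # xs)"
      using list_emb_Cons by auto
    have "d x z \<le> d x y + d y z"
      using list_emb_Cons.prems list_emb_set[OF list_emb_Cons.hyps(1), of z] Cons
      by (intro assms(2)) auto
    with * show ?thesis by (simp add: Cons walk_length_Cons)
  qed
next
  case (list_emb_Cons2 y z ys xs)
  thus ?case by (simp add: walk_length_Cons)
qed simp

section \<open>Sequential choices with random termination\<close>

text \<open>Expected value of passing through a list that pays \<open>c x\<close> at \<open>x\<close> and stops there with probability \<open>p x\<close>.\<close>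

primrec stop_value :: "('a \<Rightarrow> real) \<Rightarrow> ('a \<Rightarrow> real) \<Rightarrow> 'a list \<Rightarrow> real" where
  "stop_value c p [] = 0"
| "stop_value c p (x # xs) = c x + (1 - p x) * stop_value c p xs"

lemma stop_value_append:
  "stop_value c p (xs @ ys) = stop_value c p xs + (\<Prod>x\<leftarrow>xs. 1 - p x) * stop_value c p ys"
  by (induction xs) (auto simp: algebra_simps)

context
  fixes c p :: "'a \<Rightarrow> real"
begin

lemma stop_value_nonneg:
  "(\<And>x. x \<in> set xs \<Longrightarrow> 0 \<le> c x \<and> 0 \<le> p x \<and> p x \<le> 1) \<Longrightarrow> 0 \<le> stop_value c p xs"
  by (induction xs) auto

lemma stop_value_le:
  "(\<And>x. x \<in> set xs \<Longrightarrow> 0 \<le> c x \<and> 0 \<le> p x \<and> p x \<le> 1) \<Longrightarrow> stop_value c p xs \<le> (\<Sum>x\<leftarrow>xs. c x)"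
proof (induction xs)
  case (Cons x xs)
  have "(1 - p x) * stop_value c p xs \<le> 1 * stop_value c p xs"
    using Cons.prems by (intro mult_right_mono stop_value_nonneg) auto
  also have "\<dots> \<le> (\<Sum>x\<leftarrow>xs. c x)" using Cons by simp
  finally show ?case by simp
qed simp

text \<open>A union bound: an item is reached unless the process stopped before, which has
  probability at most the sum of all \<open>p x\<close>.\<close>

lemma stop_value_ge:
  "(\<And>x. x \<in> set xs \<Longrightarrow> 0 \<le> c x \<and> 0 \<le> p x \<and> p x \<le> 1) \<Longrightarrow>
    (1 - (\<Sum>x\<leftarrow>xs. p x)) * (\<Sum>x\<leftarrow>xs. c x) \<le> stop_value c p xs"
proof (induction xs)
  case (Cons x xs)
  define P C where "P = (\<Sum>x\<leftarrow>xs. p x)" and "C = (\<Sum>x\<leftarrow>xs. c x)"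
  have P: "0 \<le> P" unfolding P_def using Cons.prems by (intro sum_list_nonneg) auto
  have C: "0 \<le> C" unfolding C_def using Cons.prems by (intro sum_list_nonneg) auto
  have x: "0 \<le> c x" "0 \<le> p x" "p x \<le> 1" using Cons.prems by auto
  have "(1 - P) * C \<le> stop_value c p xs" using Cons by (simp add: P_def C_def)
  hence "(1 - p x) * ((1 - P) * C) \<le> (1 - p x) * stop_value c p xs"
    using x by (intro mult_left_mono) auto
  \<comment> \<open>These two terms are exactly the slack in the induction step.\<close>
  moreover have "0 \<le> p x * P * C" "0 \<le> (p x + P) * c x" using x P C by auto
  ultimately show ?case by (simp add: P_def [symmetric] C_def [symmetric] algebra_simps)
qed simp

text \<open>An elementary substitute for the exponential bound on the survival probability: it is at
  most \<open>1 / (1 + P)\<close>, where \<open>P\<close> is the sum of the stopping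
  probabilities.\<close>

lemma prod_list_one_minus_le:
  "(\<And>x. x \<in> set xs \<Longrightarrow> 0 \<le> p x \<and> p x \<le> 1) \<Longrightarrow>
    0 \<le> (\<Prod>x\<leftarrow>xs. 1 - p x) \<and> (\<Prod>x\<leftarrow>xs. 1 - p x) * (1 + (\<Sum>x\<leftarrow>xs. p x)) \<le> 1"
proof (induction xs)
  case (Cons x xs)
  define P Q where "P = (\<Sum>x\<leftarrow>xs. p x)" and "Q = (\<Prod>x\<leftarrow>xs. 1 - p x)"
  have IH: "0 \<le> Q" "Q * (1 + P) \<le> 1" using Cons by (auto simp: P_def Q_def)
  have P: "0 \<le> P" unfolding P_def using Cons.prems by (intro sum_list_nonneg) auto
  have x: "0 \<le> p x" "p x \<le> 1" using Cons.prems by auto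
  have "(1 - p x) * (1 + (p x + P)) = 1 + P - p x * (p x + P)" by (simp add: algebra_simps)
  also have "\<dots> \<le> 1 + P" using x P by simp
  finally have "Q * ((1 - p x) * (1 + (p x + P))) \<le> Q * (1 + P)" using IH by (intro mult_left_mono)
  with IH x show ?case by (simp add: P_def [symmetric] Q_def [symmetric] mult_ac)
qed simp

text \<open>
  Split off a maximal prefix of weight at most \<open>T\<close> together with the next element \<open>x\<close>. Both the prefix
  and \<open>[x]\<close> are light segments, and the process survives them with probability at most \<open>8/9\<close>; hence
  the value is at most \<open>2 M / (1 - 8/9)\<close>.
\<close>

lemma stop_value_le_segment:
  fixes b :: "'a \<Rightarrow> int"
  assumes "\<And>x. x \<in> set xs \<Longrightarrow> 0 \<le> c x \<and> 0 \<le> p x \<and> p x \<le> 1 \<and> 0 \<le> b x \<and> b x \<le> T \<and>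
        real_of_int (b x) \<le> p x * real_of_int (8 * (T + 1))"
    and "0 \<le> T"
    and seg: "\<And>as ys bs. xs = as @ ys @ bs \<Longrightarrow> (\<Sum>x\<leftarrow>ys. b x) \<le> T \<Longrightarrow> (\<Sum>x\<leftarrow>ys. c x) \<le> M"
  shows "stop_value c p xs \<le> 18 * M"
  using assms(1,3)
proof (induction "length xs" arbitrary: xs rule: less_induct)
  case less
  have M: "0 \<le> M" using less.prems(2)[of "[]" "[]" xs] \<open>0 \<le> T\<close> by simp
  show ?case
  proof (cases "(\<Sum>x\<leftarrow>xs. b x) \<le> T")
    case True
    hence "(\<Sum>x\<leftarrow>xs. c x) \<le> M" using less.prems(2)[of "[]" xs "[]"] by simp
    moreover have "stop_value c p xs \<le> (\<Sum>x\<leftarrow>xs. c x)"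
      using less.prems(1) by (intro stop_value_le) auto
    ultimately show ?thesis using M by linarith
  next
    case False
    \<comment> \<open>\<open>take k xs\<close> is the maximal light prefix: \<open>k\<close> is the
      first position whose element pushes the weight above \<open>T\<close>.\<close>
    define k where "k = (LEAST k. \<not> (\<Sum>x\<leftarrow>take (Suc k) xs. b x) \<le> T)"
    have ex: "\<not> (\<Sum>x\<leftarrow>take (Suc (length xs)) xs. b x) \<le> T" using False by simp
    have big: "\<not> (\<Sum>x\<leftarrow>take (Suc k) xs. b x) \<le> T"
      unfolding k_def using ex by (rule LeastI)
    have small: "(\<Sum>x\<leftarrow>take k xs. b x) \<le> T"
    proof (cases k)
      case 0
      thus ?thesis using \<open>0 \<le> T\<close> by simp
    next
      case (Suc j)
      thus ?thesis using not_less_Least[of j "\<lambda>k. \<not> (\<Sum>x\<leftarrow>take (Suc k) xs. b x) \<le> T"] by (simp add: k_def)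
    qed
    have k: "k < length xs"
    proof (rule ccontr)
      assume "\<not> k < length xs"
      hence "take (Suc k) xs = take k xs" by simp
      with big small show False by metis
    qed
    define C x R where "C = take k xs" and "x = xs ! k" and "R = drop (Suc k) xs"
    have xs: "xs = C @ x # R" using k by (simp add: C_def x_def R_def id_take_nth_drop)
    have Cx: "take (Suc k) xs = C @ [x]" using k by (simp add: C_def x_def take_Suc_conv_app_nth)
    have "(\<Sum>x\<leftarrow>C. c x) \<le> M" using less.prems(2)[of "[]" C "x # R", OF _ small [folded C_def]] xs by simp
    moreover have "stop_value c p C \<le> (\<Sum>x\<leftarrow>C. c x)"
      using less.prems(1) xs by (intro stop_value_le) auto
    ultimately have 1: "stop_value c p C \<le> M" by linarith
    have 2: "c x \<le> M" using less.prems(2)[of C "[x]" R] less.prems(1)[of x] xs by simp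
    have 3: "stop_value c p R \<le> 18 * M"
    proof (rule less.hyps)
      show "length R < length xs" using k by (simp add: R_def)
      fix as ys bs assume "R = as @ ys @ bs" "(\<Sum>x\<leftarrow>ys. b x) \<le> T"
      thus "(\<Sum>x\<leftarrow>ys. c x) \<le> M" using less.prems(2)[of "C @ x # as" ys bs] xs by simp
    qed (use less.prems(1) xs in auto)
    define Q P where "Q = (\<Prod>x\<leftarrow>C @ [x]. 1 - p x)" and "P = (\<Sum>x\<leftarrow>C @ [x]. p x)"
    have Q: "0 \<le> Q" "Q * (1 + P) \<le> 1"
      using prod_list_one_minus_le[of "C @ [x]"] less.prems(1) xs unfolding Q_def P_def by auto
    have "real_of_int (\<Sum>x\<leftarrow>ys. b x) \<le> (\<Sum>x\<leftarrow>ys. p x) * (8 * (T + 1))" if "set ys \<subseteq> set xs" for ys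
      using that
    proof (induction ys)
      case (Cons y ys)
      have "real_of_int (b y) \<le> p y * (8 * (T + 1))" using less.prems(1)[of y] Cons.prems by auto
      with Cons show ?case by (simp add: algebra_simps)
    qed simp
    moreover have "set (C @ [x]) \<subseteq> set xs" using xs by auto
    ultimately have "real_of_int (\<Sum>x\<leftarrow>C @ [x]. b x) \<le> P * (8 * (T + 1))"
      unfolding P_def by blast
    \<comment> \<open>By integrality, exceeding \<open>T\<close> means reaching
      \<open>T + 1\<close>, which cancels against the same factor in the lower bound on
      \<open>p\<close>.\<close>
    moreover have "real_of_int (T + 1) \<le> real_of_int (\<Sum>x\<leftarrow>C @ [x]. b x)"
      using big unfolding Cx of_int_le_iff by linarith
    ultimately have "real_of_int (T + 1) \<le> P * real_of_int (8 * (T + 1))" by (rule order_trans[rotated])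
    hence "1 * real_of_int (T + 1) \<le> 8 * P * real_of_int (T + 1)" by (simp add: algebra_simps)
    hence "1 \<le> 8 * P" by (rule mult_right_le_imp_le) (use \<open>0 \<le> T\<close> in simp)
    hence "1 / 8 \<le> P" by simp
    have "Q * (9 / 8) \<le> Q * (1 + P)" using \<open>1 / 8 \<le> P\<close> Q(1) by (intro mult_left_mono) auto
    hence Q': "Q \<le> 8 / 9" using Q(2) by linarith
    have px: "0 \<le> p x" "p x \<le> 1" using less.prems(1)[of x] xs by auto
    have PC: "0 \<le> (\<Prod>x\<leftarrow>C. 1 - p x)" "(\<Prod>x\<leftarrow>C. 1 - p x) \<le> 1"
    proof -
      have *: "0 \<le> (\<Prod>x\<leftarrow>C. 1 - p x) \<and> (\<Prod>x\<leftarrow>C. 1 - p x) * (1 + (\<Sum>x\<leftarrow>C. p x)) \<le> 1"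
        using less.prems(1) xs by (intro prod_list_one_minus_le) auto
      thus "0 \<le> (\<Prod>x\<leftarrow>C. 1 - p x)" by simp
      have "0 \<le> (\<Sum>x\<leftarrow>C. p x)" using less.prems(1) xs by (intro sum_list_nonneg) auto
      hence "0 \<le> (\<Prod>x\<leftarrow>C. 1 - p x) * (\<Sum>x\<leftarrow>C. p x)" using * by simp
      thus "(\<Prod>x\<leftarrow>C. 1 - p x) \<le> 1" using * by (simp add: algebra_simps)
    qed
    have "stop_value c p xs = stop_value c p C + (\<Prod>x\<leftarrow>C. 1 - p x) * c x + Q * stop_value c p R"
      by (simp add: xs stop_value_append Q_def algebra_simps)
    also have "(\<Prod>x\<leftarrow>C. 1 - p x) * c x \<le> 1 * M"
      using PC 2 less.prems(1)[of x] xs by (intro mult_mono) auto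
    also have "Q * stop_value c p R \<le> 8 / 9 * (18 * M)"
      using Q Q' 3 less.prems(1) xs by (intro mult_mono stop_value_nonneg) auto
    finally show ?thesis using 1 by simp
  qed
qed

end

section \<open>Knapsack deadlines along a list\<close>


text \<open>The load \<open>s\<close> also counts the items that are dropped, since this is the load
  that the policy has really accumulated when it processes \<open>v\<close>.\<close>

primrec ontime :: "'a set \<Rightarrow> ('a \<Rightarrow> nat) \<Rightarrow> ('a \<Rightarrow> nat) \<Rightarrow> nat \<Rightarrow> 'a list \<Rightarrow> 'a list" where
  "ontime U w K s [] = []"
| "ontime U w K s (v # vs) = (if v \<in> U \<and> s + w v \<le> K v then [v] else []) @ ontime U w K (s + w v) vs"

text \<open>The form in which the list is computed: a filter on indices with prefix sums.\<close>

lemma ontime_filter: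
  "ontime U w K s vs = map ((!) vs) (filter (\<lambda>i. vs ! i \<in> U \<and> s + (\<Sum>v\<leftarrow>take (Suc i) vs. w v) \<le> K (vs ! i)) [0..<length vs])"
proof (induction vs arbitrary: s)
  case (Cons v vs)
  have "[0..<length (v # vs)] = 0 # map Suc [0..<length vs]"
    by (simp add: upt_conv_Cons map_Suc_upt del: upt_Suc)
  thus ?case by (simp add: Cons filter_map comp_def add.assoc del: upt_Suc)
qed simp

lemma subseq_ontime: "subseq (ontime U w K s vs) vs"
  by (induction vs arbitrary: s) auto

lemma set_ontime: "set (ontime U w K s vs) \<subseteq> U \<inter> set vs"
  by (induction vs arbitrary: s) auto

text \<open>The test for \<open>v\<close> was made against the load of all earlier items, of which
  \<open>as\<close> is only a part.\<close>

lemma ontime_deadline: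
  "ontime U w K s vs = as @ v # bs \<Longrightarrow> s + (\<Sum>u\<leftarrow>as. w u) + w v \<le> K v"
proof (induction vs arbitrary: s as)
  case (Cons x vs)
  show ?case
  proof (cases "x \<in> U \<and> s + w x \<le> K x")
    case True
    hence *: "x # ontime U w K (s + w x) vs = as @ v # bs" using Cons.prems by simp
    show ?thesis
    proof (cases as)
      case Nil
      with * True show ?thesis by simp
    next
      case (Cons a as')
      with * have "ontime U w K (s + w x) vs = as' @ v # bs" "a = x" by auto
      from Cons.IH[OF this(1)] this(2) Cons show ?thesis by simp
    qed
  next
    case False
    hence "ontime U w K (s + w x) vs = as @ v # bs" using Cons.prems by auto
    from Cons.IH[OF this] show ?thesis by simp
  qed
qed simp

lemma ontime_idI:
  "(\<And>as v bs. vs = as @ v # bs \<Longrightarrow> v \<in> U \<and> s + (\<Sum>u\<leftarrow>as. w u) + w v \<le> K v) \<Longrightarrow> ontime U w K s vs = vs"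
proof (induction vs arbitrary: s)
  case (Cons x vs)
  have "ontime U w K (s + w x) vs = vs"
  proof (rule Cons.IH)
    fix as v bs assume "vs = as @ v # bs"
    with Cons.prems[of "x # as" v bs]
    show "v \<in> U \<and> s + w x + (\<Sum>u\<leftarrow>as. w u) + w v \<le> K v" by simp
  qed
  thus ?case using Cons.prems[of "[]" x vs] by simp
qed simp


text \<open>The expected reward of a walk in the gadget: a late vertex pays nothing, but its job may
  still turn out big and end the earnings.\<close>

primrec deadline_value ::
  "'a set \<Rightarrow> ('a \<Rightarrow> nat) \<Rightarrow> ('a \<Rightarrow> nat) \<Rightarrow> ('a \<Rightarrow> real) \<Rightarrow> ('a \<Rightarrow> real) \<Rightarrow> nat \<Rightarrow> 'a list \<Rightarrow> real" where
  "deadline_value U w K c p s [] = 0"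
| "deadline_value U w K c p s (v # vs) =
     (if v \<in> U \<and> s + w v \<le> K v then c v else 0) + (1 - p v) * deadline_value U w K c p (s + w v) vs"

text \<open>Deleting an item that pays nothing only removes a chance to stop.\<close>

lemma deadline_value_le_ontime:
  assumes "\<And>v. v \<in> set vs \<Longrightarrow> 0 \<le> c v \<and> 0 \<le> p v \<and> p v \<le> 1"
  shows "deadline_value U w K c p s vs \<le> stop_value c p (ontime U w K s vs)"
  using assms
proof (induction vs arbitrary: s)
  case (Cons x vs)
  let ?D = "deadline_value U w K c p (s + w x) vs" and ?S = "stop_value c p (ontime U w K (s + w x) vs)"
  have IH: "?D \<le> ?S" using Cons by auto
  have S: "0 \<le> ?S"
    using Cons.prems set_ontime[of U w K "s + w x" vs] by (intro stop_value_nonneg) auto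
  have x: "0 \<le> c x" "0 \<le> p x" "p x \<le> 1" using Cons.prems by auto
  have le: "(1 - p x) * ?D \<le> (1 - p x) * ?S" using IH x by (intro mult_left_mono) auto
  have "(1 - p x) * ?S \<le> 1 * ?S" using S x by (intro mult_right_mono) auto
  with le x show ?case by auto
qed simp

lemma deadline_value_eq_stop_value:
  "ontime U w K s vs = vs \<Longrightarrow> deadline_value U w K c p s vs = stop_value c p vs"
proof (induction vs arbitrary: s)
  case (Cons x vs)
  \<comment> \<open>If \<open>x\<close> were dropped, the remaining list would be too short to equal
    \<open>x # vs\<close>.\<close>
  have "length (ontime U w K (s + w x) vs) \<le> length vs"
    using subseq_ontime by (rule list_emb_length)
  hence "x \<in> U \<and> s + w x \<le> K x"
    using arg_cong[OF Cons.prems, of length] by (auto split: if_splits)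
  with Cons show ?case by simp
qed simp

section \<open>Runs of policies\<close>

lemma hist_size_append [simp]: "hist_size (g @ h) = hist_size g + hist_size h"
  by (simp add: hist_size_def)

lemma hist_reward_Nil [simp]: "hist_reward I [] = 0"
  by (simp add: hist_reward_def)

lemma hist_reward_snoc:
  "hist_reward I (h @ [x]) = hist_reward I h + (if hist_size (h @ [x]) \<le> co_W I then snd (snd x) else 0)"
proof -
  have *: "hist_reward I h = (\<Sum>i<length h. if hist_size (take (Suc i) h) \<le> co_W I then snd (snd (h ! i)) else 0)" for h
  proof -
    have "{i. i < length h \<and> hist_size (take (Suc i) h) \<le> co_W I} = {i \<in> {..<length h}. hist_size (take (Suc i) h) \<le> co_W I}"
      by auto
    thus ?thesis unfolding hist_reward_def by (simp only: sum.inter_filter finite_lessThan)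
  qed
  have "take (Suc i) (h @ [x]) = take (Suc i) h" if "i < length h" for i
    using that by (simp add: Suc_leI)
  hence "(\<Sum>i<length h. if hist_size (take (Suc i) (h @ [x])) \<le> co_W I then snd (snd ((h @ [x]) ! i)) else 0) =
      hist_reward I h"
    unfolding * by (intro sum.cong) (auto simp del: take_append simp add: nth_append)
  thus ?thesis unfolding *[of "h @ [x]"] by (simp del: take_append)
qed

lemma play_entries: "(v, x) \<in> set (play \<pi> \<omega> m) \<Longrightarrow> x = \<omega> v"
  by (induction m) (auto simp: Let_def split: option.splits)

lemma length_play: "length (play \<pi> \<omega> m) \<le> m"
  by (induction m) (auto simp: Let_def split: option.splits)

lemma play_prefix: "m \<le> m' \<Longrightarrow> \<exists>h. play \<pi> \<omega> m' = play \<pi> \<omega> m @ h"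
  by (induction m' rule: dec_induct) (auto simp: Let_def split: option.splits)

lemma play_stops: "m \<le> m' \<Longrightarrow> play \<pi> \<omega> (Suc m) = play \<pi> \<omega> m \<Longrightarrow> play \<pi> \<omega> m' = play \<pi> \<omega> m"
  by (induction m' rule: dec_induct) (auto simp: Let_def split: option.splits)

lemma length_play_eq: "play \<pi> \<omega> (Suc m) \<noteq> play \<pi> \<omega> m \<Longrightarrow> length (play \<pi> \<omega> m) = m"
proof (induction m)
  case (Suc m)
  have "play \<pi> \<omega> (Suc m) \<noteq> play \<pi> \<omega> m"
    using Suc.prems play_stops[of m "Suc m" \<pi> \<omega>] play_stops[of m "Suc (Suc m)" \<pi> \<omega>] by auto
  with Suc.IH show ?case by (auto simp: Let_def split: option.splits)
qed simp

text \<open>A history grows by one entry per step until the policy stops for good, so the prefix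
  \<open>g\<close> is the history after exactly \<open>length g\<close> steps.\<close>

lemma play_split:
  assumes "play \<pi> \<omega> m = g @ (v, x) # h"
  shows "length g < m" "play \<pi> \<omega> (length g) = g" "\<pi> g = Some v"
proof -
  have "length g < m \<and> play \<pi> \<omega> (length g) = g \<and> \<pi> g = Some v"
    using assms
  proof (induction m arbitrary: h)
    case (Suc m)
    show ?case
    proof (cases "\<pi> (play \<pi> \<omega> m)")
      case None
      hence "play \<pi> \<omega> m = g @ (v, x) # h" using Suc.prems by simp
      from Suc.IH[OF this] show ?thesis by simp
    next
      case (Some u)
      hence eq: "play \<pi> \<omega> m @ [(u, \<omega> u)] = g @ (v, x) # h" using Suc.prems by simp
      show ?thesis
      proof (cases h rule: rev_cases)
        case Nil
        with eq have g: "play \<pi> \<omega> m = g" "u = v" by auto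
        have "play \<pi> \<omega> (Suc m) \<noteq> play \<pi> \<omega> m" using Some by simp
        from length_play_eq[OF this] g Some show ?thesis by auto
      next
        case (snoc h' y)
        with eq have "play \<pi> \<omega> m = g @ (v, x) # h'" by simp
        from Suc.IH[OF this] show ?thesis by simp
      qed
    qed
  qed simp
  thus "length g < m" "play \<pi> \<omega> (length g) = g" "\<pi> g = Some v" by auto
qed

text \<open>A policy learns outcomes only at the vertices it visits, so agreement along the run
  under \<open>\<sigma>\<close> keeps both runs together.\<close>

lemma play_cong:
  assumes "\<And>v x. (v, x) \<in> set (play \<pi> \<sigma> m) \<Longrightarrow> \<omega> v = \<sigma> v"
  shows "play \<pi> \<omega> m = play \<pi> \<sigma> m"
  using assms
proof (induction m)
  case (Suc m)
  have "play \<pi> \<omega> m = play \<pi> \<sigma> m"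
  proof (rule Suc.IH)
    fix v x assume "(v, x) \<in> set (play \<pi> \<sigma> m)"
    moreover obtain h where "play \<pi> \<sigma> (Suc m) = play \<pi> \<sigma> m @ h"
      using play_prefix[of m "Suc m" \<pi> \<sigma>] by auto
    ultimately show "\<omega> v = \<sigma> v" by (metis Suc.prems Un_iff set_append)
  qed
  moreover have "\<omega> u = \<sigma> u" if "\<pi> (play \<pi> \<sigma> m) = Some u" for u
    using Suc.prems[of u "\<sigma> u"] that by simp
  ultimately show ?case by (simp add: Let_def split: option.splits)
qed simp

section \<open>The reduction\<close>

text \<open>
  A job \<open>v \<in> U\<close> is usually small and worthless. With probability \<open>1 / k v\<close> it is big and carries the
  reward; the big size is chosen such that it fits into \<open>W\<close> iff \<open>v\<close> meets its deadline \<open>K v\<close>,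
  provided that all earlier jobs were small. As \<open>2 * K v < W\<close>, two big jobs never fit.
\<close>

locale deadline_gadget =
  fixes n root :: nat and d :: "nat \<Rightarrow> nat \<Rightarrow> nat" and B W :: nat
    and U :: "nat set" and w K k r :: "nat \<Rightarrow> nat"
  assumes root: "root < n" and metric: "Metric_space {..<n} (\<lambda>u v. real (d u v))"
    and U: "U \<subseteq> {..<n} - {root}" and w0: "v \<notin> U \<Longrightarrow> w v = 0" and wK: "v \<in> U \<Longrightarrow> w v \<le> K v"
    and KW: "v \<in> U \<Longrightarrow> 2 * K v < W" and k2: "v \<in> U \<Longrightarrow> 2 \<le> k v"
begin

definition small :: outcome where "small v = (w v, 0)"

text \<open>The factor \<open>k v\<close> cancels the probability \<open>1 / k v\<close> in the
  expectation. After an earlier load \<open>s\<close>, the size fits into \<open>W\<close> iff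
  \<open>s + w v \<le> K v\<close>.\<close>

definition big :: outcome where "big v = (W - K v + w v, of_nat (r v * k v))"

definition job :: "nat \<Rightarrow> ((nat \<times> rat) \<times> rat) list" where
  "job v = (if v \<in> U then [(big v, 1 / of_nat (k v)), (small v, of_nat (k v - 1) / of_nat (k v))]
     else [((0, 0), 1)])"

definition inst :: corrko where
  "inst = \<lparr>co_n = n, co_root = root, co_dist = d, co_B = B, co_W = W, co_job = job\<rparr>"

definition p :: "nat \<Rightarrow> real" where "p v = (if v \<in> U then 1 / real (k v) else 0)"

lemma inst_simps [simp]: "co_n inst = n" "co_root inst = root" "co_dist inst = d" "co_B inst = B"
  "co_W inst = W" "co_job inst = job"
  by (simp_all add: inst_def)

lemma big_neq_small: "v \<in> U \<Longrightarrow> big v \<noteq> small v"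
  using KW[of v] by (auto simp: big_def small_def)

lemma small_outside: "v \<notin> U \<Longrightarrow> small v = (0, 0)"
  by (simp add: small_def w0)

lemma p_bounds: "0 \<le> p v" "p v < 1"
  using k2[of v] by (auto simp: p_def)

lemma job_list_inst: "job_list inst v =
  (if v \<in> U then [(big v, p v), (small v, 1 - p v)] else [(small v, 1)])"
proof (cases "v \<in> U")
  case True
  hence "real_of_rat (of_nat (k v - 1) / of_nat (k v)) = 1 - p v"
    using k2[of v] by (simp add: p_def of_rat_divide of_rat_diff field_simps of_nat_diff)
  moreover have "real_of_rat (1 / of_nat (k v)) = p v" using True by (simp add: p_def of_rat_divide)
  ultimately show ?thesis using True by (simp add: job_list_def job_def)
qed (simp add: job_list_def job_def small_outside)

lemma wf_job: "pmf_of_list_wf (job_list inst v)"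
  using p_bounds[of v] by (auto simp: job_list_inst pmf_of_list_wf_def)

lemma set_job_pmf: "set_pmf (job_pmf inst v) = (if v \<in> U then {big v, small v} else {small v})"
proof -
  have "v \<in> U \<Longrightarrow> 0 < p v" using k2[of v] by (simp add: p_def)
  thus ?thesis unfolding job_pmf_def using p_bounds[of v]
    by (subst set_pmf_of_list_eq[OF wf_job]) (auto simp: job_list_inst split: if_splits)
qed

lemma pmf_big: "v \<in> U \<Longrightarrow> pmf (job_pmf inst v) (big v) = p v"
  and pmf_small: "pmf (job_pmf inst v) (small v) = 1 - p v"
  unfolding job_pmf_def pmf_pmf_of_list[OF wf_job] using big_neq_small[of v] big_neq_small[of v, symmetric]
  by (auto simp: job_list_inst p_def)

lemma is_2CorrKO_inst: "is_2CorrKO inst"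
proof -
  have "card (set_pmf (map_pmf fst (job_pmf inst v))) \<le> 2" for v
    by (auto simp: set_job_pmf card_insert_if)
  thus ?thesis
    unfolding is_2CorrKO_def is_CorrKO_def using root metric wf_job U
    by (auto simp: set_job_pmf big_def small_outside) (auto simp: small_def)
qed

section \<open>Expected reward of a policy in the gadget\<close>

lemma set_outcomes: "set_pmf (outcomes inst) = PiE_dflt {..<n} (0, 0) (\<lambda>v. set_pmf (job_pmf inst v))"
  unfolding outcomes_def by (simp add: set_Pi_pmf comp_def)

lemma outcomes_cases:
  assumes "\<omega> \<in> set_pmf (outcomes inst)"
  shows "\<omega> v = small v \<or> v \<in> U \<and> \<omega> v = big v"
proof (cases "v < n")
  case True
  thus ?thesis using assms by (auto simp: set_outcomes PiE_dflt_def set_job_pmf split: if_splits)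
next
  case False
  hence "v \<notin> U" using U by auto
  thus ?thesis using assms False by (auto simp: set_outcomes PiE_dflt_def small_outside)
qed

text \<open>As every \<open>p v\<close> is below 1, all jobs may be small at once. Hence whatever is
  promised on possible outcomes, feasibility as well as running time, is promised for this
  one.\<close>

lemma small_in_outcomes: "small \<in> set_pmf (outcomes inst)"
  using U by (auto simp: set_outcomes PiE_dflt_def set_job_pmf small_outside)

primrec run_reward :: "outcome \<Rightarrow> nat \<Rightarrow> nat list \<Rightarrow> real" where
  "run_reward \<omega> s [] = 0"
| "run_reward \<omega> s (v # vs) = (if \<omega> v = small v then run_reward \<omega> (s + w v) vs
     else if s + w v \<le> K v then real (r v * k v) else 0)"

lemma run_reward_cong: "(\<And>v. v \<in> set vs \<Longrightarrow> \<omega> v = \<omega>' v) \<Longrightarrow> run_reward \<omega> s vs = run_reward \<omega>' s vs"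
  by (induction vs arbitrary: s) auto

lemma run_reward_append:
  "(\<And>v. v \<in> set us \<Longrightarrow> \<omega> v = small v) \<Longrightarrow>
    run_reward \<omega> s (us @ vs) = run_reward \<omega> (s + (\<Sum>u\<leftarrow>us. w u)) vs"
  by (induction us arbitrary: s) (auto simp: add.assoc)

text \<open>By independence, the outcome of the head \<open>v\<close> can be drawn first;
  \<open>v\<close> does not recur in the tail, which therefore depends only on the remaining
  vertices. The load \<open>s\<close> and the set \<open>A\<close> vary in the induction.\<close>

lemma expectation_run_reward:
  "finite A \<Longrightarrow> set vs \<subseteq> A \<Longrightarrow> distinct vs \<Longrightarrow>
    measure_pmf.expectation (Pi_pmf A (0, 0) (job_pmf inst)) (\<lambda>\<omega>. run_reward \<omega> s vs) =
    deadline_value U w K (\<lambda>v. real (r v)) p s vs"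
proof (induction vs arbitrary: A s)
  case (Cons v vs)
  define A' where "A' = A - {v}"
  have A: "A = insert v A'" "v \<notin> A'" "finite A'" "set vs \<subseteq> A'"
    using Cons.prems by (auto simp: A'_def)
  let ?P = "Pi_pmf A' (0, 0) (job_pmf inst)"
  have fin: "finite (set_pmf (Pi_pmf S (0, 0) (job_pmf inst)))" if "finite S" for S :: "nat set"
    using that by (auto simp: set_Pi_pmf set_job_pmf intro!: finite_PiE_dflt)
  have E: "measure_pmf.expectation (map_pmf (\<lambda>f. f(v := y)) ?P) (\<lambda>\<omega>. run_reward \<omega> s (v # vs)) =
     (if y = small v then deadline_value U w K (\<lambda>v. real (r v)) p (s + w v) vs
      else if s + w v \<le> K v then real (r v * k v) else 0)" for y
  proof -
    have "run_reward (f(v := y')) t vs = run_reward f t vs" for f t y'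
      using Cons.prems by (intro run_reward_cong) auto
    moreover have "measure_pmf.expectation ?P (\<lambda>\<omega>. run_reward \<omega> (s + w v) vs) =
        deadline_value U w K (\<lambda>v. real (r v)) p (s + w v) vs"
      using A Cons.prems by (intro Cons.IH) auto
    ultimately show ?thesis by simp
  qed
  have "measure_pmf.expectation (Pi_pmf A (0, 0) (job_pmf inst)) (\<lambda>\<omega>. run_reward \<omega> s (v # vs)) =
     (\<Sum>y\<in>set_pmf (job_pmf inst v). pmf (job_pmf inst v) y *\<^sub>R
        measure_pmf.expectation (map_pmf (\<lambda>f. f(v := y)) ?P) (\<lambda>\<omega>. run_reward \<omega> s (v # vs)))"
  proof -
    have "Pi_pmf A (0, 0) (job_pmf inst) = job_pmf inst v \<bind> (\<lambda>y. map_pmf (\<lambda>f. f(v := y)) ?P)"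
      unfolding A(1) map_pmf_def by (rule Pi_pmf_insert'[OF A(3,2)])
    thus ?thesis using fin[OF A(3)]
      by (simp only:) (intro pmf_expectation_bind, auto simp: set_job_pmf)
  qed
  \<comment> \<open>For \<open>v \<in> U\<close> the big outcome contributes
    \<open>p v * (r v * k v) = r v\<close> if on time.\<close>
  also have "\<dots> = deadline_value U w K (\<lambda>v. real (r v)) p s (v # vs)"
    unfolding E using big_neq_small[of v] k2[of v]
    by (auto simp: set_job_pmf pmf_big pmf_small) (auto simp: p_def)
  finally show ?case .
qed simp

lemma hist_reward_small:
  "(\<And>v x. (v, x) \<in> set h \<Longrightarrow> x = small v) \<Longrightarrow> hist_reward inst h = 0"
proof (induction h rule: rev_induct)
  case (snoc y h)
  have "snd y = small (fst y)" using snoc.prems[of "fst y" "snd y"] by simp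
  hence "snd (snd y) = 0" by (simp add: small_def)
  with snoc show ?case by (simp add: hist_reward_snoc)
qed simp

lemma hist_size_small:
  "(\<And>v x. (v, x) \<in> set h \<Longrightarrow> x = small v) \<Longrightarrow> hist_size h = (\<Sum>v\<leftarrow>map fst h. w v)"
proof (induction h)
  case (Cons y h)
  have "snd y = small (fst y)" using Cons.prems[of "fst y" "snd y"] by simp
  moreover have "hist_size h = (\<Sum>v\<leftarrow>map fst h. w v)"
    by (rule Cons.IH, rule Cons.prems) simp
  ultimately show ?case by (cases y) (simp add: hist_size_def small_def)
qed (simp add: hist_size_def)

text \<open>Later small jobs are worthless and a later big job overruns \<open>W\<close>, so the
  first big job settles the reward.\<close>

lemma hist_reward_after_big:
  assumes "v \<in> U" "\<And>u x. (u, x) \<in> set h \<Longrightarrow> x = small u \<or> u \<in> U \<and> x = big u"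
  shows "hist_reward inst (g @ [(v, big v)] @ h) = hist_reward inst (g @ [(v, big v)])"
  using assms(2)
proof (induction h rule: rev_induct)
  case (snoc y h)
  obtain u x where y: "y = (u, x)" by (cases y)
  have IH: "hist_reward inst (g @ [(v, big v)] @ h) = hist_reward inst (g @ [(v, big v)])"
    using snoc by auto
  from snoc.prems[of u x] consider "x = small u" | "u \<in> U" "x = big u" by (auto simp: y)
  hence "(if hist_size ((g @ [(v, big v)] @ h) @ [y]) \<le> W then snd (snd y) else 0) = 0"
  proof cases
    case 2
    with KW[OF assms(1)] KW[of u]
    have "hist_size ((g @ [(v, big v)] @ h) @ [y]) > W"
      by (simp add: y hist_size_def big_def)
    thus ?thesis by simp
  qed (simp add: y small_def)
  with IH hist_reward_snoc[of inst "g @ [(v, big v)] @ h" y] show ?case by simp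
qed simp

text \<open>The walk to which an adaptive policy is reduced: its visits as long as every job turns
  out small.\<close>

definition quiet_run :: "policy \<Rightarrow> nat list" where
  "quiet_run \<pi> = map fst (play \<pi> small n)"

text \<open>Until the first big job on the quiet run, the policy cannot distinguish
  \<open>\<omega>\<close> from \<open>small\<close>. Afterwards it may deviate arbitrarily, but
  earns nothing more.\<close>

lemma hist_reward_play:
  assumes \<omega>: "\<omega> \<in> set_pmf (outcomes inst)"
  shows "real_of_rat (hist_reward inst (play \<pi> \<omega> n)) = run_reward \<omega> 0 (quiet_run \<pi>)"
proof (cases "\<forall>v\<in>set (quiet_run \<pi>). \<omega> v = small v")
  case True
  have eq: "play \<pi> \<omega> n = play \<pi> small n"
    using True by (intro play_cong) (force simp: quiet_run_def)
  have "hist_reward inst (play \<pi> small n) = 0"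
    by (rule hist_reward_small) (rule play_entries)
  moreover have "run_reward \<omega> 0 (quiet_run \<pi>) = 0"
    using True run_reward_append[of "quiet_run \<pi>" \<omega> 0 "[]"] by simp
  ultimately show ?thesis by (simp add: eq)
next
  case False
  then obtain us v vs where q: "quiet_run \<pi> = us @ v # vs" and us: "\<forall>u\<in>set us. \<omega> u = small u"
    and v: "\<omega> v \<noteq> small v"
    using split_list_first_prop[of "quiet_run \<pi>" "\<lambda>v. \<omega> v \<noteq> small v"] by blast
  have vU: "v \<in> U" "\<omega> v = big v" using outcomes_cases[OF \<omega>, of v] v by auto
  obtain g x h where gh: "play \<pi> small n = g @ (v, x) # h" and g: "map fst g = us"
    using q unfolding quiet_run_def by (auto simp: map_eq_append_conv map_eq_Cons_conv)
  note sp = play_split[OF gh]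
  have small: "y = small u" if "(u, y) \<in> set g" for u y
    using play_entries[of u y \<pi> small n] that gh by simp
  have "play \<pi> \<omega> (length g) = play \<pi> small (length g)"
    using us g by (intro play_cong) (force simp: sp)
  hence "play \<pi> \<omega> (Suc (length g)) = g @ [(v, big v)]"
    using sp vU by simp
  then obtain h' where h': "play \<pi> \<omega> n = g @ [(v, big v)] @ h'"
    using play_prefix[of "Suc (length g)" n \<pi> \<omega>] sp(1) by auto
  have "hist_reward inst (play \<pi> \<omega> n) = hist_reward inst (g @ [(v, big v)])"
    unfolding h' using vU(1)
  proof (rule hist_reward_after_big)
    fix u y assume "(u, y) \<in> set h'"
    hence "y = \<omega> u" using play_entries[of u y \<pi> \<omega> n] h' by simp
    thus "y = small u \<or> u \<in> U \<and> y = big u" using outcomes_cases[OF \<omega>, of u] by auto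
  qed
  \<comment> \<open>The size of \<open>big v\<close> turns the test against \<open>W\<close> into
    the deadline test.\<close>
  also have "\<dots> = (if (\<Sum>u\<leftarrow>us. w u) + w v \<le> K v then of_nat (r v * k v) else 0)"
    using hist_reward_small[of g] hist_size_small[of g] small KW[OF vU(1)] g
    by (auto simp: hist_reward_snoc) (auto simp: hist_size_def big_def)
  also have "real_of_rat \<dots> = run_reward \<omega> 0 (quiet_run \<pi>)"
    using us v by (simp add: q run_reward_append of_rat_mult)
  finally show ?thesis .
qed

lemma quiet_run_feasible:
  assumes "policy_feasible inst \<pi>"
  shows "set (quiet_run \<pi>) \<subseteq> {..<n}" "distinct (root # quiet_run \<pi>)" "walk_length d (root # quiet_run \<pi>) \<le> B"
  using assms small_in_outcomes by (auto simp: policy_feasible_def hist_feasible_def Let_def quiet_run_def)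

lemma policy_value_eq:
  assumes "policy_feasible inst \<pi>"
  shows "policy_value inst \<pi> = deadline_value U w K (\<lambda>v. real (r v)) p 0 (quiet_run \<pi>)"
proof -
  have "policy_value inst \<pi> = measure_pmf.expectation (outcomes inst) (\<lambda>\<omega>. run_reward \<omega> 0 (quiet_run \<pi>))"
    unfolding policy_value_def
    by (intro integral_cong_AE) (auto simp: AE_measure_pmf_iff hist_reward_play)
  also have "\<dots> = deadline_value U w K (\<lambda>v. real (r v)) p 0 (quiet_run \<pi>)"
    unfolding outcomes_def inst_simps using quiet_run_feasible[OF assms]
    by (intro expectation_run_reward) auto
  finally show ?thesis .
qed


text \<open>Stops once some entry is not small. Thus only the last job of a run can be big, and the
  last job is the one that may overrun the budget.\<close>

definition follow :: "nat list \<Rightarrow> policy" where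
  "follow ps h = (if h = map (\<lambda>v. (v, small v)) (take (length h) ps) \<and> length h < length ps
     then Some (ps ! length h) else None)"

lemma play_follow_small: "play (follow ps) small m = map (\<lambda>v. (v, small v)) (take m ps)"
proof (induction m)
  case (Suc m)
  have "follow ps (map (\<lambda>v. (v, small v)) (take m ps)) = (if m < length ps then Some (ps ! m) else None)"
    by (auto simp: follow_def min_def)
  thus ?case by (simp add: Suc take_Suc_conv_app_nth)
qed simp

text \<open>The bound \<open>j - 1\<close> exempts the last entry, which may be the big job that
  makes the policy stop.\<close>

lemma play_follow:
  "\<exists>j\<le>length ps. play (follow ps) \<omega> m = map (\<lambda>v. (v, \<omega> v)) (take j ps) \<and> (\<forall>v\<in>set (take (j - 1) ps). \<omega> v = small v)"
proof (induction m)
  case 0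
  show ?case by (intro exI[of _ 0]) simp
next
  case (Suc m)
  then obtain j where j: "j \<le> length ps" "play (follow ps) \<omega> m = map (\<lambda>v. (v, \<omega> v)) (take j ps)"
    "\<forall>v\<in>set (take (j - 1) ps). \<omega> v = small v" by blast
  show ?case
  proof (cases "follow ps (play (follow ps) \<omega> m)")
    case None
    thus ?thesis using j by auto
  next
    case (Some u)
    \<comment> \<open>The policy moves on only if all \<open>j\<close> entries so far are small,
      including the one exempted before.\<close>
    hence *: "map (\<lambda>v. (v, \<omega> v)) (take j ps) = map (\<lambda>v. (v, small v)) (take j ps)" "j < length ps" "u = ps ! j"
      using j(1) unfolding j(2) by (auto simp: follow_def min_def split: if_splits)
    have "play (follow ps) \<omega> (Suc m) = play (follow ps) \<omega> m @ [(u, \<omega> u)]"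
      using Some by (simp add: Let_def)
    hence "play (follow ps) \<omega> (Suc m) = map (\<lambda>v. (v, \<omega> v)) (take (Suc j) ps)"
      using *(2,3) j(2) by (simp add: take_Suc_conv_app_nth)
    moreover have "\<forall>v\<in>set (take j ps). \<omega> v = small v"
      using *(1) by simp
    ultimately show ?thesis using *(2)
      by (intro exI[of _ "Suc j"]) auto
  qed
qed

context
  fixes ps
  assumes distinct: "distinct (root # ps)" and psU: "set ps \<subseteq> U" and length: "walk_length d (root # ps) \<le> B"
    and deadline: "\<And>as v bs. ps = as @ v # bs \<Longrightarrow> (\<Sum>u\<leftarrow>as. w u) + w v \<le> K v"
begin

lemma follow_feasible: "policy_feasible inst (follow ps)"
  unfolding policy_feasible_def inst_simps
proof
  fix \<omega>
  obtain j where j: "j \<le> length ps" "play (follow ps) \<omega> n = map (\<lambda>v. (v, \<omega> v)) (take j ps)"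
    "\<forall>v\<in>set (take (j - 1) ps). \<omega> v = small v" using play_follow[of ps \<omega> n] by blast
  have tri: "d x z \<le> d x y + d y z" if "x \<in> {..<n}" "y \<in> {..<n}" "z \<in> {..<n}" for x y z
    using Metric_space.triangle[OF metric that] by linarith
  have sub: "subseq (take j ps) ps" by (intro prefix_imp_subseq take_is_prefix)
  have "root \<in> {..<n}" "set ps \<subseteq> {..<n}" using root psU U by auto
  with sub tri have "walk_length d (root # take j ps) \<le> walk_length d (root # ps)"
    by (intro walk_length_subseq[where S = "{..<n}"])
  hence walk: "walk_length d (root # take j ps) \<le> B" using length by linarith
  have but: "butlast (play (follow ps) \<omega> n) = map (\<lambda>v. (v, \<omega> v)) (take (j - 1) ps)"
    unfolding j(2) map_butlast[symmetric] butlast_take[OF j(1)] ..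
  have "hist_size (butlast (play (follow ps) \<omega> n)) = (\<Sum>v\<leftarrow>take (j - 1) ps. w v)"
    unfolding but using j(3) by (subst hist_size_small) (auto simp: comp_def)
  \<comment> \<open>The deadline of the last job in this prefix bounds its whole load, and deadlines
    are below \<open>W\<close>.\<close>
  also have "\<dots> \<le> W"
  proof (cases "j - 1")
    case (Suc i)
    hence i: "i < length ps" using j(1) by linarith
    hence "take (j - 1) ps = take i ps @ [ps ! i]" using Suc by (simp add: take_Suc_conv_app_nth)
    moreover have "(\<Sum>u\<leftarrow>take i ps. w u) + w (ps ! i) \<le> K (ps ! i)"
      using i by (intro deadline) (rule id_take_nth_drop)
    moreover have "2 * K (ps ! i) < W" using i psU by (intro KW) auto
    ultimately show ?thesis by simp
  qed simp
  finally have "hist_size (butlast (play (follow ps) \<omega> n)) \<le> W" .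
  moreover have "map fst (play (follow ps) \<omega> n) = take j ps" using j(2) by (simp add: comp_def)
  moreover have "set (root # take j ps) \<subseteq> {..<n}" "distinct (root # take j ps)"
    using distinct root psU U set_take_subset[of j ps] by auto
  ultimately show "hist_feasible inst (play (follow ps) \<omega> n)"
    using walk by (simp add: hist_feasible_def Let_def)
qed

lemma follow_value:
  "(1 - (\<Sum>v\<leftarrow>ps. p v)) * (\<Sum>v\<leftarrow>ps. real (r v)) \<le> policy_value inst (follow ps)"
proof -
  have "set ps \<subseteq> {..<n}" "distinct ps" using psU U distinct by auto
  \<comment> \<open>So the \<open>n\<close> steps of a run suffice to visit all of
    \<open>ps\<close>.\<close>
  hence "length ps \<le> n" using card_mono[of "{..<n}" "set ps"] by (simp add: distinct_card)
  hence q: "quiet_run (follow ps) = ps" by (simp add: quiet_run_def play_follow_small comp_def)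
  have "ontime U w K 0 ps = ps"
    using psU deadline by (intro ontime_idI) auto
  hence "policy_value inst (follow ps) = stop_value (\<lambda>v. real (r v)) p ps"
    by (simp add: policy_value_eq[OF follow_feasible] q deadline_value_eq_stop_value)
  moreover have "(1 - (\<Sum>v\<leftarrow>ps. p v)) * (\<Sum>v\<leftarrow>ps. real (r v)) \<le> stop_value (\<lambda>v. real (r v)) p ps"
    by (rule stop_value_ge) (use p_bounds in \<open>auto intro: less_imp_le\<close>)
  ultimately show ?thesis by simp
qed

end

end

section \<open>Scaling and correctness\<close>

definition den :: "rat \<Rightarrow> int" where "den r = snd (quotient_of r)"

text \<open>Computes \<open>r * D\<close> by integer operations; the division is exact when
  \<open>D\<close> is a multiple of the denominator.\<close>

definition scale :: "int \<Rightarrow> rat \<Rightarrow> int" where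
  "scale D r = fst (quotient_of r) * (D div den r)"

lemma den_pos: "0 < den r"
  unfolding den_def by (metis prod.collapse quotient_of_denom_pos)

lemma of_int_scale: "den r dvd D \<Longrightarrow> of_int (scale D r) = r * of_int D"
proof -
  assume "den r dvd D"
  then obtain k where k: "D = den r * k" by blast
  have "r = of_int (fst (quotient_of r)) / of_int (den r)"
    unfolding den_def by (metis prod.collapse quotient_of_div)
  thus ?thesis using den_pos[of r] by (simp add: scale_def k field_simps)
qed

definition vec_den :: "nat \<Rightarrow> (nat \<Rightarrow> rat) \<Rightarrow> int" where
  "vec_den n a = prod_list (map (\<lambda>v. den (a v)) [0..<n])"

text \<open>One factor for all data, so that every comparison survives scaling. A plain product
  avoids computing a least common multiple and still has polynomial bit size.\<close>

definition common_den :: "knap_orientkd \<Rightarrow> int" where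
  "common_den J = prod_list (map (\<lambda>u. vec_den (ok_n J) (ok_dist J u)) [0..<ok_n J]) * den (ok_B J) *
     vec_den (ok_n J) (ok_reward J) * vec_den (ok_n J) (ok_wt J) * vec_den (ok_n J) (ok_KD J) *
     vec_den (ok_n J) (ok_b J) * den (ok_T J)"

lemma dvd_prod_list: "x \<in> set xs \<Longrightarrow> f x dvd prod_list (map f xs)" for f :: "'a \<Rightarrow> int"
  by (induction xs) auto

lemma prod_list_pos: "(\<And>x. x \<in> set xs \<Longrightarrow> 0 < f x) \<Longrightarrow> 0 < prod_list (map f xs)" for f :: "'a \<Rightarrow> int"
  by (induction xs) auto

lemma vec_den_pos: "0 < vec_den n a"
  unfolding vec_den_def by (rule prod_list_pos) (rule den_pos)

lemma common_den_pos: "0 < common_den J"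
  unfolding common_den_def by (intro mult_pos_pos prod_list_pos vec_den_pos den_pos)

lemma den_dvd_vec_den: "v < n \<Longrightarrow> den (a v) dvd vec_den n a"
  unfolding vec_den_def by (rule dvd_prod_list[of v "[0..<n]" "\<lambda>v. den (a v)"]) simp

lemma den_dvd_common_den:
  "u < ok_n J \<Longrightarrow> v < ok_n J \<Longrightarrow> den (ok_dist J u v) dvd common_den J"
  "den (ok_B J) dvd common_den J" "den (ok_T J) dvd common_den J"
  "v < ok_n J \<Longrightarrow> den (ok_reward J v) dvd common_den J"
  "v < ok_n J \<Longrightarrow> den (ok_wt J v) dvd common_den J"
  "v < ok_n J \<Longrightarrow> den (ok_KD J v) dvd common_den J"
  "v < ok_n J \<Longrightarrow> den (ok_b J v) dvd common_den J"
proof -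
  assume "u < ok_n J" "v < ok_n J"
  hence "den (ok_dist J u v) dvd vec_den (ok_n J) (ok_dist J u)"
    "vec_den (ok_n J) (ok_dist J u) dvd prod_list (map (\<lambda>u. vec_den (ok_n J) (ok_dist J u)) [0..<ok_n J])"
    using den_dvd_vec_den dvd_prod_list[of u "[0..<ok_n J]" "\<lambda>u. vec_den (ok_n J) (ok_dist J u)"] by auto
  thus "den (ok_dist J u v) dvd common_den J" unfolding common_den_def by (simp add: dvd_trans)
qed (use den_dvd_vec_den in \<open>auto simp: common_den_def intro: dvd_mult dvd_mult2\<close>)

text \<open>
  The contribution of the root, which lies on every path, is
  subtracted from the deadlines and from the budget \<open>T\<close>.
\<close>

definition wt' :: "knap_orientkd \<Rightarrow> nat \<Rightarrow> int" where
  "wt' J v = scale (common_den J) (ok_wt J v)"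

definition KD' :: "knap_orientkd \<Rightarrow> nat \<Rightarrow> int" where
  "KD' J v = scale (common_den J) (ok_KD J v) - wt' J (ok_root J)"

definition b' :: "knap_orientkd \<Rightarrow> nat \<Rightarrow> int" where
  "b' J v = scale (common_den J) (ok_b J v)"

definition T' :: "knap_orientkd \<Rightarrow> int" where
  "T' J = scale (common_den J) (ok_T J) - b' J (ok_root J)"

definition B' :: "knap_orientkd \<Rightarrow> int" where
  "B' J = scale (common_den J) (ok_B J)"

definition reward' :: "knap_orientkd \<Rightarrow> nat \<Rightarrow> int" where
  "reward' J v = scale (common_den J) (ok_reward J v)"

definition dist' :: "knap_orientkd \<Rightarrow> nat \<Rightarrow> nat \<Rightarrow> nat" where
  "dist' J u v = (if u < ok_n J \<and> v < ok_n J then nat (scale (common_den J) (ok_dist J u v)) else 0)"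

text \<open>The vertices that meet both knapsack constraints next to the root alone. All others get
  a job of size and reward 0: a policy may pass through them without effect.\<close>

definition usable :: "knap_orientkd \<Rightarrow> nat set" where
  "usable J = {v. v < ok_n J \<and> v \<noteq> ok_root J \<and> wt' J v \<le> KD' J v \<and> b' J v \<le> T' J}"

definition size' :: "knap_orientkd \<Rightarrow> nat \<Rightarrow> nat" where
  "size' J v = (if v \<in> usable J then nat (wt' J v) else 0)"

definition deadline' :: "knap_orientkd \<Rightarrow> nat \<Rightarrow> nat" where
  "deadline' J v = nat (KD' J v)"

text \<open>The probability \<open>1 / rarity J v\<close> is \<open>b\<^sub>v / (4 (T + 1)) + 1 / (4 n)\<close> up to a factor of 2.\<close>

definition rarity :: "knap_orientkd \<Rightarrow> nat \<Rightarrow> nat" where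
  "rarity J v = nat ((4 * int (ok_n J) * (T' J + 1)) div (int (ok_n J) * b' J v + (T' J + 1)) + 1)"

text \<open>A budget above twice every deadline, by a bound that is easier to compute than the
  maximum.\<close>

definition W' :: "knap_orientkd \<Rightarrow> int" where
  "W' J = 2 * sum_list (map (\<lambda>v. \<bar>KD' J v\<bar>) [0..<ok_n J]) + 1"

text \<open>The path consisting of the root alone is feasible; recall that \<open>KD'\<close> and
  \<open>T'\<close> already have the share of the root subtracted.\<close>

definition root_ok :: "knap_orientkd \<Rightarrow> bool" where
  "root_ok J \<longleftrightarrow> 0 \<le> B' J \<and> 0 \<le> KD' J (ok_root J) \<and> 0 \<le> T' J"

abbreviation gadget :: "knap_orientkd \<Rightarrow> corrko" where
  "gadget J \<equiv> deadline_gadget.inst (ok_n J) (ok_root J) (dist' J) (nat (B' J)) (nat (W' J)) (usable J)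
     (size' J) (deadline' J) (rarity J) (\<lambda>v. nat (reward' J v))"

abbreviation quiet :: "knap_orientkd \<Rightarrow> outcome" where
  "quiet J \<equiv> deadline_gadget.small (size' J)"

section \<open>The path extracted from a policy\<close>

definition visited :: "knap_orientkd \<Rightarrow> policy \<Rightarrow> nat list" where
  "visited J \<pi> = map fst (play \<pi> (quiet J) (ok_n J))"

definition in_time :: "knap_orientkd \<Rightarrow> policy \<Rightarrow> nat list" where
  "in_time J \<pi> = ontime (usable J) (size' J) (deadline' J) 0 (visited J \<pi>)"

text \<open>Too heavy segments are replaced by the empty one, so that the search can run over all
  pairs of indices.\<close>

definition segment :: "knap_orientkd \<Rightarrow> nat list \<Rightarrow> nat \<Rightarrow> nat \<Rightarrow> nat list" where
  "segment J vs i j = (if (\<Sum>v\<leftarrow>take (Suc j) (drop i vs). b' J v) \<le> T' J then take (Suc j) (drop i vs) else [])"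

abbreviation reward_sum :: "knap_orientkd \<Rightarrow> nat list \<Rightarrow> int" where
  "reward_sum J vs \<equiv> (\<Sum>v\<leftarrow>vs. reward' J v)"

definition best_from :: "knap_orientkd \<Rightarrow> nat list \<Rightarrow> nat \<Rightarrow> nat list" where
  "best_from J vs i = best (reward_sum J) [] (map (segment J vs i) [0..<length vs])"

definition best_segment :: "knap_orientkd \<Rightarrow> nat list \<Rightarrow> nat list" where
  "best_segment J vs = best (reward_sum J) [] (map (best_from J vs) [0..<length vs])"

lemma best_segment_cases:
  assumes "0 \<le> T' J"
  obtains as bs where "vs = as @ best_segment J vs @ bs" "(\<Sum>v\<leftarrow>best_segment J vs. b' J v) \<le> T' J"
proof -
  have seg: "\<exists>as bs. vs = as @ segment J vs i j @ bs \<and> (\<Sum>v\<leftarrow>segment J vs i j. b' J v) \<le> T' J" for i j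
  proof -
    have "vs = take i vs @ take (Suc j) (drop i vs) @ drop (Suc j) (drop i vs)"
      by (metis append_take_drop_id)
    thus ?thesis using assms by (auto simp: segment_def)
  qed
  have "best_segment J vs = [] \<or> (\<exists>i j. best_segment J vs = segment J vs i j)"
  proof -
    have "best_from J vs i = [] \<or> (\<exists>j. best_from J vs i = segment J vs i j)" for i
      using best_mem[of "reward_sum J" "[]" "map (segment J vs i) [0..<length vs]"] by (auto simp: best_from_def)
    moreover have "best_segment J vs = [] \<or> (\<exists>i. best_segment J vs = best_from J vs i)"
      using best_mem[of "reward_sum J" "[]" "map (best_from J vs) [0..<length vs]"] by (auto simp: best_segment_def)
    ultimately show ?thesis by metis
  qed
  thus ?thesis
  proof (elim disjE exE)
    assume "best_segment J vs = []"
    thus ?thesis using assms by (intro that[of "[]" vs]) auto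
  next
    fix i j assume "best_segment J vs = segment J vs i j"
    thus ?thesis using seg[of i j] that by auto
  qed
qed

lemma best_segment_ge:
  assumes "vs = as @ ys @ bs" "(\<Sum>v\<leftarrow>ys. b' J v) \<le> T' J"
  shows "reward_sum J ys \<le> reward_sum J (best_segment J vs)"
proof (cases "ys = []")
  case True
  thus ?thesis using best_ge[of "[]" "[]" "map (best_from J vs) [0..<length vs]" "reward_sum J"]
    by (simp add: best_segment_def)
next
  case False
  \<comment> \<open>\<open>segment\<close> takes \<open>Suc j\<close> elements, hence the
    predecessor; the empty list is covered by the default value of \<open>best\<close>.\<close>
  define i j where "i = length as" and "j = length ys - 1"
  have ij: "i < length vs" "j < length vs" using False assms(1) by (cases ys; auto simp: i_def j_def)+
  have "ys = segment J vs i j" using assms False by (simp add: segment_def i_def j_def)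
  hence "reward_sum J ys \<le> reward_sum J (best_from J vs i)"
    unfolding best_from_def using ij by (auto intro!: best_ge[where f = "reward_sum J"])
  also have "\<dots> \<le> reward_sum J (best_segment J vs)"
    unfolding best_segment_def using ij by (intro best_ge[where f = "reward_sum J"]) auto
  finally show ?thesis .
qed

text \<open>The root lies on every path, and distances and weights are nonnegative, so the rest of a
  path cannot repair a violation at the root.\<close>

lemma not_root_ok:
  assumes J: "is_KnapOrientKD J" and "\<not> root_ok J"
  shows "\<not> ok_feasible J p"
proof
  assume p: "ok_feasible J p"
  then obtain ps where ps: "p = ok_root J # ps" by (cases p) (auto simp: ok_feasible_def)
  let ?r = "ok_root J"
  have r: "?r < ok_n J" and nonneg: "\<And>v. v < ok_n J \<Longrightarrow> 0 \<le> ok_wt J v \<and> 0 \<le> ok_b J v"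
    using J by (auto simp: is_KnapOrientKD_def)
  have mem: "set p \<subseteq> {..<ok_n J}" using p by (simp add: ok_feasible_def)
  have D: "0 < rat_of_int (common_den J)" using common_den_pos by simp
  have dist: "0 \<le> ok_dist J u v" for u v
    using Metric_space.nonneg[of "{..<ok_n J}" "\<lambda>u v. real_of_rat (ok_dist J u v)" u v] J
    by (simp add: is_KnapOrientKD_def)
  have "0 \<le> walk_length (ok_dist J) p" using dist by (rule walk_length_nonneg)
  hence "0 \<le> ok_B J" using p by (simp add: ok_feasible_def)
  hence "0 \<le> rat_of_int (B' J)"
    using D by (simp add: B'_def of_int_scale den_dvd_common_den)
  moreover have "ok_wt J ?r \<le> ok_KD J ?r" using p ps by (auto simp: ok_feasible_def)
  hence "0 \<le> rat_of_int (KD' J ?r)"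
    using D r by (simp add: KD'_def wt'_def of_int_scale den_dvd_common_den mult_right_mono)
  moreover have "ok_b J ?r \<le> ok_T J"
  proof -
    have "ok_b J ?r \<le> (\<Sum>u\<in>set p. ok_b J u)"
      using mem nonneg ps by (intro member_le_sum) auto
    thus ?thesis using p by (simp add: ok_feasible_def)
  qed
  hence "0 \<le> rat_of_int (T' J)"
    using D r by (simp add: T'_def b'_def of_int_scale den_dvd_common_den mult_right_mono)
  ultimately show False using assms(2) by (simp add: root_ok_def)
qed

section \<open>Correctness for instances whose root satisfies its constraints\<close>

locale rooted_instance =
  fixes J :: knap_orientkd
  assumes J: "is_KnapOrientKD J" and root_ok: "root_ok J"
begin

abbreviation "n \<equiv> ok_n J"
abbreviation "\<rho> \<equiv> ok_root J"
abbreviation "\<delta> \<equiv> rat_of_int (common_den J)"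

lemma \<delta>_pos: "0 < \<delta>"
  using common_den_pos by simp

lemma root_less: "\<rho> < n"
  using J by (simp add: is_KnapOrientKD_def)

lemma metric: "Metric_space {..<n} (\<lambda>u v. real_of_rat (ok_dist J u v))"
  using J by (simp add: is_KnapOrientKD_def)

lemma dist_nonneg: "0 \<le> ok_dist J u v"
  using Metric_space.nonneg[OF metric, of u v] by simp

lemma scaled:
  "v < n \<Longrightarrow> of_int (wt' J v) = ok_wt J v * \<delta>"
  "v < n \<Longrightarrow> of_int (KD' J v) = (ok_KD J v - ok_wt J \<rho>) * \<delta>"
  "v < n \<Longrightarrow> of_int (b' J v) = ok_b J v * \<delta>"
  "of_int (T' J) = (ok_T J - ok_b J \<rho>) * \<delta>"
  "of_int (B' J) = ok_B J * \<delta>"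
  "v < n \<Longrightarrow> of_int (reward' J v) = ok_reward J v * \<delta>"
  using root_less by (simp_all add: wt'_def KD'_def b'_def T'_def B'_def reward'_def of_int_scale
      den_dvd_common_den algebra_simps)

lemma nonneg: "v < n \<Longrightarrow> 0 \<le> wt' J v" "v < n \<Longrightarrow> 0 \<le> b' J v" "v < n \<Longrightarrow> 0 \<le> reward' J v"
proof -
  assume v: "v < n"
  have "0 \<le> rat_of_int (wt' J v)" "0 \<le> rat_of_int (b' J v)" "0 \<le> rat_of_int (reward' J v)"
    using J v \<delta>_pos by (auto simp: scaled is_KnapOrientKD_def)
  thus "0 \<le> wt' J v" "0 \<le> b' J v" "0 \<le> reward' J v" by simp_all
qed

lemma T'_nonneg: "0 \<le> T' J" and B'_nonneg: "0 \<le> B' J"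
  using root_ok by (auto simp: root_ok_def)

lemma scaled_dist:
  assumes "u < n" "v < n"
  shows "rat_of_nat (dist' J u v) = ok_dist J u v * \<delta>"
proof -
  have eq: "rat_of_int (scale (common_den J) (ok_dist J u v)) = ok_dist J u v * \<delta>"
    using assms by (simp add: of_int_scale den_dvd_common_den)
  hence "0 \<le> rat_of_int (scale (common_den J) (ok_dist J u v))"
    using dist_nonneg[of u v] \<delta>_pos by simp
  thus ?thesis using eq assms by (simp add: dist'_def)
qed

lemma scaled_dist_real:
  assumes "u < n" "v < n"
  shows "real (dist' J u v) = real_of_rat (ok_dist J u v) * real_of_rat \<delta>"
  using arg_cong[OF scaled_dist[OF assms], of real_of_rat] by (simp add: of_rat_mult)

lemma metric': "Metric_space {..<n} (\<lambda>u v. real (dist' J u v))"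
proof
  have \<delta>: "0 < real_of_rat \<delta>" using \<delta>_pos by (simp only: zero_less_of_rat_iff)
  have sym: "ok_dist J u v = ok_dist J v u" for u v
    using Metric_space.commute[OF metric, of u v] by simp
  show "real (dist' J u v) = real (dist' J v u)" for u v
    by (simp add: dist'_def sym[of u v])
  show "(real (dist' J u v) = 0) = (u = v)" if "u \<in> {..<n}" "v \<in> {..<n}" for u v
    using that Metric_space.zero[OF metric that] \<delta> unfolding scaled_dist_real[OF that[unfolded lessThan_iff]] by simp
  show "real (dist' J u w) \<le> real (dist' J u v) + real (dist' J v w)"
    if "u \<in> {..<n}" "v \<in> {..<n}" "w \<in> {..<n}" for u v w
    using that mult_right_mono[OF Metric_space.triangle[OF metric that], of "real_of_rat \<delta>"] \<delta>
    by (simp add: scaled_dist_real algebra_simps)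
qed simp

lemma scaled_walk_length:
  assumes "set p \<subseteq> {..<n}"
  shows "rat_of_nat (walk_length (dist' J) p) = walk_length (ok_dist J) p * \<delta>"
  unfolding walk_length_def of_nat_sum sum_distrib_right
proof (rule sum.cong)
  fix i assume "i \<in> {..<length p - 1}"
  hence "p ! i \<in> set p" "p ! Suc i \<in> set p" by auto
  thus "rat_of_nat (dist' J (p ! i) (p ! Suc i)) = ok_dist J (p ! i) (p ! Suc i) * \<delta>"
    using assms by (intro scaled_dist) auto
qed simp

lemma walk_length_le_iff:
  "set p \<subseteq> {..<n} \<Longrightarrow> walk_length (dist' J) p \<le> nat (B' J) \<longleftrightarrow> walk_length (ok_dist J) p \<le> ok_B J"
proof -
  assume p: "set p \<subseteq> {..<n}"
  have "walk_length (dist' J) p \<le> nat (B' J) \<longleftrightarrow> int (walk_length (dist' J) p) \<le> B' J"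
    using B'_nonneg by linarith
  also have "\<dots> \<longleftrightarrow> rat_of_int (int (walk_length (dist' J) p)) \<le> rat_of_int (B' J)"
    by (simp only: of_int_le_iff)
  also have "\<dots> \<longleftrightarrow> walk_length (ok_dist J) p * \<delta> \<le> ok_B J * \<delta>"
    by (simp add: scaled_walk_length[OF p] scaled)
  also have "\<dots> \<longleftrightarrow> walk_length (ok_dist J) p \<le> ok_B J"
    using \<delta>_pos by simp
  finally show ?thesis .
qed

lemma usable_less: "v \<in> usable J \<Longrightarrow> v < n"
  by (simp add: usable_def)

lemma size'_int: "v \<in> usable J \<Longrightarrow> int (size' J v) = wt' J v"
  using nonneg(1)[of v] by (simp add: size'_def usable_less)

lemma deadline'_int: "v \<in> usable J \<Longrightarrow> int (deadline' J v) = KD' J v"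
  using nonneg(1)[of v] by (auto simp: deadline'_def usable_def)

context
  fixes v assumes v: "v \<in> usable J"
begin

lemma b'_bounds: "0 \<le> b' J v" "b' J v \<le> T' J"
  using v nonneg(2)[of v] by (auto simp: usable_def)

text \<open>The third claim says that the intended probability, the quotient of its two sides, is at
  most 1; it rests on \<open>b' J v \<le> T' J\<close>.\<close>

lemma rarity_pos: "0 < int n" "0 < int n * b' J v + (T' J + 1)" "int n * b' J v + (T' J + 1) \<le> 4 * int n * (T' J + 1)"
proof -
  show n: "0 < int n" using v by (simp add: usable_def)
  show "0 < int n * b' J v + (T' J + 1)" using b'_bounds T'_nonneg n by (intro add_nonneg_pos) auto
  have le4: "x + y \<le> 4 * z" if "x \<le> z" "1 * y \<le> z" "0 < y" for x y z :: int using that by linarith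
  define A where "A = int n * (T' J + 1)"
  have "int n * b' J v \<le> A" unfolding A_def using b'_bounds n by (intro mult_left_mono) auto
  moreover have "1 * (T' J + 1) \<le> A" unfolding A_def using n T'_nonneg by (intro mult_right_mono) auto
  ultimately have "int n * b' J v + (T' J + 1) \<le> 4 * A" using T'_nonneg by (intro le4) auto
  thus "int n * b' J v + (T' J + 1) \<le> 4 * int n * (T' J + 1)" by (simp add: A_def)
qed

lemma rarity_int: "int (rarity J v) = (4 * int n * (T' J + 1)) div (int n * b' J v + (T' J + 1)) + 1"
  using pos_imp_zdiv_nonneg_iff[OF rarity_pos(2), of "4 * int n * (T' J + 1)"] rarity_pos
  by (simp add: rarity_def)

lemma rarity_ge: "2 \<le> rarity J v"
proof -
  have "1 \<le> (4 * int n * (T' J + 1)) div (int n * b' J v + (T' J + 1))"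
    using rarity_pos by (simp add: pos_imp_zdiv_pos_iff int_one_le_iff_zero_less)
  thus ?thesis using rarity_int by linarith
qed

text \<open>The quotient is rounded up, so the actual probability does not exceed the intended
  one.\<close>

lemma rarity_lower: "4 * int n * (T' J + 1) \<le> int (rarity J v) * (int n * b' J v + (T' J + 1))"
proof -
  define X Y where "X = 4 * int n * (T' J + 1)" and "Y = int n * b' J v + (T' J + 1)"
  have "X mod Y < Y" using rarity_pos by (simp add: Y_def)
  hence "X \<le> (X div Y + 1) * Y"
    using minus_div_mult_eq_mod[of X Y] unfolding distrib_right by linarith
  thus ?thesis unfolding rarity_int X_def Y_def .
qed

text \<open>As the quotient is at least 1, rounding up at most doubles it, which turns the factor 4
  into 8.\<close>

lemma rarity_upper: "int (rarity J v) * b' J v \<le> 8 * (T' J + 1)"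
proof -
  define X Y where "X = 4 * int n * (T' J + 1)" and "Y = int n * b' J v + (T' J + 1)"
  have "0 \<le> X mod Y" "Y \<le> X" using rarity_pos(2,3) by (simp_all add: X_def Y_def)
  hence "(X div Y + 1) * Y \<le> 2 * X"
    using minus_div_mult_eq_mod[of X Y] unfolding distrib_right by linarith
  hence "int (rarity J v) * Y \<le> 2 * X" unfolding rarity_int X_def Y_def .
  moreover have "int (rarity J v) * (int n * b' J v) \<le> int (rarity J v) * Y"
    using T'_nonneg by (intro mult_left_mono) (auto simp: Y_def)
  ultimately have "int n * (int (rarity J v) * b' J v) \<le> int n * (8 * (T' J + 1))"
    by (simp add: X_def mult_ac)
  thus ?thesis using rarity_pos(1) mult_le_cancel_left_pos by blast
qed

end

sublocale deadline_gadget n \<rho> "dist' J" "nat (B' J)" "nat (W' J)" "usable J" "size' J" "deadline' J" "rarity J"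
  "\<lambda>v. nat (reward' J v)"
proof (rule deadline_gadget.intro)
  fix v assume v: "v \<in> usable J"
  show "size' J v \<le> deadline' J v"
    using v size'_int[OF v] deadline'_int[OF v] by (auto simp: usable_def)
  have "\<bar>KD' J v\<bar> \<le> sum_list (map (\<lambda>v. \<bar>KD' J v\<bar>) [0..<n])"
    using v by (intro member_le_sum_list) (auto simp: usable_def)
  thus "2 * deadline' J v < nat (W' J)" by (auto simp: deadline'_def W'_def)
  show "2 \<le> rarity J v" by (rule rarity_ge[OF v])
qed (use root_less metric' in \<open>auto simp: usable_def size'_def\<close>)

lemma scaled_sum:
  assumes "set vs \<subseteq> {..<n}"
  shows "rat_of_int (\<Sum>v\<leftarrow>vs. b' J v) = (\<Sum>v\<leftarrow>vs. ok_b J v) * \<delta>"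
    "rat_of_int (\<Sum>v\<leftarrow>vs. wt' J v) = (\<Sum>v\<leftarrow>vs. ok_wt J v) * \<delta>"
    "rat_of_int (reward_sum J vs) = (\<Sum>v\<leftarrow>vs. ok_reward J v) * \<delta>"
  using assms by (induction vs) (auto simp: scaled algebra_simps)

lemma size'_sum: "set us \<subseteq> usable J \<Longrightarrow> int (\<Sum>u\<leftarrow>us. size' J u) = (\<Sum>u\<leftarrow>us. wt' J u)"
  by (induction us) (auto simp: size'_int)

lemma feasible_decompose:
  assumes "ok_feasible J q"
  obtains ps where "q = \<rho> # ps" "distinct (\<rho> # ps)" "set ps \<subseteq> usable J"
    "walk_length (dist' J) (\<rho> # ps) \<le> nat (B' J)" "(\<Sum>v\<leftarrow>ps. b' J v) \<le> T' J"
    "\<And>as v bs. ps = as @ v # bs \<Longrightarrow> (\<Sum>u\<leftarrow>as. size' J u) + size' J v \<le> deadline' J v"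
proof -
  obtain ps where q: "q = \<rho> # ps"
    using assms by (cases q) (auto simp: ok_feasible_def)
  have dist: "distinct (\<rho> # ps)" and sub: "set (\<rho> # ps) \<subseteq> {..<n}"
    using assms by (auto simp: ok_feasible_def q)
  have walk: "walk_length (dist' J) (\<rho> # ps) \<le> nat (B' J)"
    using assms walk_length_le_iff[OF sub] by (simp add: ok_feasible_def q)
  have "(\<Sum>u\<in>set (\<rho> # ps). ok_b J u) \<le> ok_T J"
    using assms unfolding ok_feasible_def q by blast
  hence "(\<Sum>u\<leftarrow>\<rho> # ps. ok_b J u) \<le> ok_T J"
    unfolding sum.distinct_set_conv_list[OF dist] .
  hence "(\<Sum>u\<leftarrow>ps. ok_b J u) * \<delta> \<le> (ok_T J - ok_b J \<rho>) * \<delta>"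
    using \<delta>_pos by (intro mult_right_mono) auto
  hence "rat_of_int (\<Sum>v\<leftarrow>ps. b' J v) \<le> rat_of_int (T' J)"
    using sub by (simp add: scaled scaled_sum)
  hence b: "(\<Sum>v\<leftarrow>ps. b' J v) \<le> T' J" by (simp only: of_int_le_iff)
  have deadline: "(\<Sum>u\<leftarrow>as. wt' J u) + wt' J v \<le> KD' J v" if "ps = as @ v # bs" for as v bs
  proof -
    \<comment> \<open>This prefix of \<open>q\<close> consists of the root, \<open>as\<close> and
      \<open>v\<close>.\<close>
    have "(\<Sum>u\<leftarrow>take (Suc (Suc (length as))) q. ok_wt J u) \<le> ok_KD J (q ! Suc (length as))"
    proof -
      have "\<forall>i<length q. (\<Sum>u\<leftarrow>take (Suc i) q. ok_wt J u) \<le> ok_KD J (q ! i)"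
        using assms unfolding ok_feasible_def by blast
      thus ?thesis by (rule allE[of _ "Suc (length as)"]) (simp add: q that)
    qed
    hence "(\<Sum>u\<leftarrow>as. ok_wt J u) + ok_wt J v \<le> ok_KD J v - ok_wt J \<rho>" by (simp add: q that algebra_simps)
    hence "((\<Sum>u\<leftarrow>as. ok_wt J u) + ok_wt J v) * \<delta> \<le> (ok_KD J v - ok_wt J \<rho>) * \<delta>"
      using \<delta>_pos by (intro mult_right_mono) auto
    hence "rat_of_int ((\<Sum>u\<leftarrow>as. wt' J u) + wt' J v) \<le> rat_of_int (KD' J v)"
      using sub that scaled_sum(2)[of as] by (simp add: scaled algebra_simps)
    thus ?thesis by (simp only: of_int_le_iff)
  qed
  \<comment> \<open>The load of earlier vertices and the weight \<open>b\<close> of the others are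
    nonnegative, so \<open>v\<close> meets both bounds by itself.\<close>
  have usable: "set ps \<subseteq> usable J"
  proof
    fix v assume v: "v \<in> set ps"
    then obtain as bs where split: "ps = as @ v # bs" by (auto dest: split_list)
    have "0 \<le> (\<Sum>u\<leftarrow>as. wt' J u)" using sub split nonneg by (intro sum_list_nonneg) auto
    with deadline[OF split] have "wt' J v \<le> KD' J v" by linarith
    moreover have "b' J v \<le> (\<Sum>v\<leftarrow>ps. b' J v)"
      using v sub nonneg by (intro member_le_sum_list) auto
    ultimately show "v \<in> usable J" using b v sub dist by (auto simp: usable_def)
  qed
  have "(\<Sum>u\<leftarrow>as. size' J u) + size' J v \<le> deadline' J v" if "ps = as @ v # bs" for as v bs
    using deadline[OF that] usable that size'_sum[of as] size'_int[of v] deadline'_int[of v] by auto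
  with q dist usable walk b that show ?thesis by metis
qed

section \<open>The answer obtained from a feasible policy of the gadget\<close>

context
  fixes \<pi>
  assumes \<pi>: "policy_feasible (gadget J) \<pi>"
begin

abbreviation "answer \<equiv> best_segment J (in_time J \<pi>)"

lemma visited_eq: "visited J \<pi> = quiet_run \<pi>"
  by (simp add: visited_def quiet_run_def)

lemma in_time_usable: "set (in_time J \<pi>) \<subseteq> usable J"
  using set_ontime unfolding in_time_def by fastforce

text \<open>The answer is a subsequence of the quiet run: shortcuts preserve the length bound, and
  omitting earlier vertices only lowers the load.\<close>

lemma answer_feasible: "ok_feasible J (\<rho> # answer)"
proof -
  define fs where "fs = in_time J \<pi>"
  define ans where "ans = best_segment J fs"
  have in_time: "set fs \<subseteq> usable J" using in_time_usable by (simp add: fs_def)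
  obtain as bs where split: "fs = as @ ans @ bs" and b: "(\<Sum>v\<leftarrow>ans. b' J v) \<le> T' J"
    unfolding ans_def by (rule best_segment_cases[OF T'_nonneg, of fs])
  have "subseq ans (fs)"
    by (subst split) (auto intro: subseq_append_le_same_iff list_emb_append2)
  also have "subseq (fs) (quiet_run \<pi>)"
    unfolding fs_def in_time_def visited_eq by (rule subseq_ontime)
  finally have sub: "subseq ans (quiet_run \<pi>)" .
  note run = quiet_run_feasible[OF \<pi>]
  have set_ans: "set ans \<subseteq> usable J" using in_time split by auto
  hence less: "set (\<rho> # ans) \<subseteq> {..<n}" using usable_less root_less by auto
  have "subseq (\<rho> # ans) (\<rho> # quiet_run \<pi>)" using sub by simp
  hence dist: "distinct (\<rho> # ans)" using run(2) by (metis subseq_conv_nths distinct_nthsI)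
  have tri: "dist' J x z \<le> dist' J x y + dist' J y z" if "x \<in> {..<n}" "y \<in> {..<n}" "z \<in> {..<n}" for x y z
    using Metric_space.triangle[OF metric' that] by linarith
  have "walk_length (dist' J) (\<rho> # ans) \<le> walk_length (dist' J) (\<rho> # quiet_run \<pi>)"
    using sub tri root_less run(1) by (intro walk_length_subseq[where S = "{..<n}"]) auto
  hence walk: "walk_length (ok_dist J) (\<rho> # ans) \<le> ok_B J"
    using run(3) walk_length_le_iff[OF less] by linarith
  have rat_le: "x \<le> y" if "x * \<delta> = of_int a" "y * \<delta> = of_int c" "a \<le> c" for x y a c
  proof -
    have "rat_of_int a \<le> of_int c" using that(3) by simp
    thus ?thesis using that(1,2) \<delta>_pos by (metis mult_le_cancel_right_pos)
  qed
  have KD: "(\<Sum>u\<leftarrow>take (Suc i) (\<rho> # ans). ok_wt J u) \<le> ok_KD J ((\<rho> # ans) ! i)"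
    if "i < length (\<rho> # ans)" for i
  proof (cases i)
    case 0
    have "0 \<le> ok_KD J \<rho> - ok_wt J \<rho>"
      by (rule rat_le[of _ 0 _ "KD' J \<rho>"]) (use root_ok scaled root_less in \<open>auto simp: root_ok_def\<close>)
    thus ?thesis using 0 by simp
  next
    case (Suc j)
    hence j: "j < length ans" using that by simp
    define v us where "v = ans ! j" and "us = take j ans"
    have ans: "ans = us @ v # drop (Suc j) ans" using j by (simp add: us_def v_def id_take_nth_drop)
    have us: "set us \<subseteq> usable J" "v \<in> usable J" "set as \<subseteq> usable J"
      using set_ans in_time split j by (auto simp: us_def v_def dest: in_set_takeD)
    have "fs = (as @ us) @ v # drop (Suc j) ans @ bs"
      using split ans by (metis append.assoc append_Cons)
    hence "(\<Sum>u\<leftarrow>as @ us. size' J u) + size' J v \<le> deadline' J v"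
      unfolding fs_def in_time_def using ontime_deadline by fastforce
    \<comment> \<open>The load of \<open>as\<close>, the vertices before the segment, is nonnegative
      and can be discarded.\<close>
    hence le: "(\<Sum>u\<leftarrow>us @ [v]. wt' J u) \<le> KD' J v"
      using size'_sum[OF us(1)] size'_int[OF us(2)] deadline'_int[OF us(2)] by simp
    have sub: "set (us @ [v]) \<subseteq> {..<n}" and "v < n" using us usable_less by auto
    have "(\<Sum>u\<leftarrow>us @ [v]. ok_wt J u) \<le> ok_KD J v - ok_wt J \<rho>"
      by (rule rat_le[OF scaled_sum(2)[OF sub, symmetric] scaled(2)[OF \<open>v < n\<close>, symmetric] le])
    moreover have "take (Suc j) ans = us @ [v]" using j by (simp add: us_def v_def take_Suc_conv_app_nth)
    ultimately show ?thesis by (simp add: Suc v_def)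
  qed
  have "(\<Sum>u\<leftarrow>ans. ok_b J u) \<le> ok_T J - ok_b J \<rho>"
    using less b by (intro rat_le[of _ "\<Sum>u\<leftarrow>ans. b' J u" _ "T' J"]) (auto simp: scaled_sum(1)[symmetric] scaled)
  hence "(\<Sum>u\<in>set (\<rho> # ans). ok_b J u) \<le> ok_T J"
    unfolding sum.distinct_set_conv_list[OF dist] by simp
  with dist less walk KD show ?thesis unfolding fs_def [symmetric] ans_def [symmetric] ok_feasible_def by auto
qed

lemma reward_sum_real: "set vs \<subseteq> {..<n} \<Longrightarrow> (\<Sum>v\<leftarrow>vs. real (nat (reward' J v))) = real_of_int (reward_sum J vs)"
  using nonneg(3) by (induction vs) auto

lemma policy_value_le: "policy_value (gadget J) \<pi> \<le> 18 * real_of_int (reward_sum J answer)"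
proof -
  have "policy_value (gadget J) \<pi> \<le> stop_value (\<lambda>v. real (nat (reward' J v))) p (in_time J \<pi>)"
    unfolding policy_value_eq[OF \<pi>] in_time_def visited_eq
    using p_bounds by (intro deadline_value_le_ontime) (auto intro: less_imp_le)
  also have "\<dots> \<le> 18 * real_of_int (reward_sum J answer)"
  proof (rule stop_value_le_segment[where b = "b' J" and T = "T' J"])
    fix v assume "v \<in> set (in_time J \<pi>)"
    hence v: "v \<in> usable J" using in_time_usable by auto
    have "real_of_int (int (rarity J v) * b' J v) \<le> real_of_int (8 * (T' J + 1))"
      using rarity_upper[OF v] by (simp only: of_int_le_iff)
    hence "real_of_int (b' J v) \<le> p v * real_of_int (8 * (T' J + 1))"
      using rarity_ge[OF v] v by (simp add: p_def field_simps)
    thus "0 \<le> real (nat (reward' J v)) \<and> 0 \<le> p v \<and> p v \<le> 1 \<and> 0 \<le> b' J v \<and> b' J v \<le> T' J \<and>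
        real_of_int (b' J v) \<le> p v * real_of_int (8 * (T' J + 1))"
      using p_bounds[of v] b'_bounds[OF v] by auto
  next
    fix as ys bs assume split: "in_time J \<pi> = as @ ys @ bs" and "(\<Sum>v\<leftarrow>ys. b' J v) \<le> T' J"
    hence "reward_sum J ys \<le> reward_sum J answer" by (rule best_segment_ge)
    moreover have "set ys \<subseteq> {..<n}" using split in_time_usable usable_less by fastforce
    ultimately show "(\<Sum>v\<leftarrow>ys. real (nat (reward' J v))) \<le> real_of_int (reward_sum J answer)"
      by (simp only: reward_sum_real of_int_le_iff)
  qed (rule T'_nonneg)
  finally show ?thesis .
qed

lemma p_le:
  assumes "v \<in> usable J"
  shows "p v \<le> real_of_int (b' J v) / (4 * real_of_int (T' J + 1)) + 1 / (4 * real n)"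
proof -
  have "real_of_int (4 * int n * (T' J + 1)) \<le> real_of_int (int (rarity J v) * (int n * b' J v + (T' J + 1)))"
    using rarity_lower[OF assms] by (simp only: of_int_le_iff)
  hence "4 * real n * (real_of_int (T' J + 1)) \<le> real (rarity J v) * (real n * real_of_int (b' J v) + real_of_int (T' J + 1))"
    by simp
  moreover have "0 < real_of_int (T' J + 1)" "0 < real n" "0 < real (rarity J v)"
    using T'_nonneg root_less rarity_ge[OF assms] by auto
  ultimately show ?thesis using assms
    by (simp add: p_def divide_simps del: of_int_add) (simp add: algebra_simps)
qed

text \<open>One quarter comes from the total weight \<open>b\<close>, which is at most
  \<open>T\<close>, and one quarter from at most \<open>n\<close> summands
  \<open>1 / (4 * n)\<close>.\<close>

lemma sum_p_le:
  assumes "distinct ps" "set ps \<subseteq> usable J" "(\<Sum>v\<leftarrow>ps. b' J v) \<le> T' J"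
  shows "(\<Sum>v\<leftarrow>ps. p v) \<le> 1 / 2"
proof -
  define t where "t = real_of_int (T' J + 1)"
  have t: "0 < t" using T'_nonneg by (simp add: t_def)
  have n: "0 < real n" using root_less by simp
  have "(\<Sum>v\<leftarrow>ps. p v) \<le> real_of_int (\<Sum>v\<leftarrow>ps. b' J v) / (4 * t) + real (length ps) / (4 * real n)"
    using assms(2)
  proof (induction ps)
    case (Cons v ps)
    with p_le[of v, folded t_def] show ?case by (simp add: add_divide_distrib)
  qed simp
  also have "real_of_int (\<Sum>v\<leftarrow>ps. b' J v) \<le> t" using assms(3) unfolding t_def of_int_le_iff by linarith
  hence "real_of_int (\<Sum>v\<leftarrow>ps. b' J v) / (4 * t) \<le> 1 / 4" using t by (simp add: field_simps)
  also have "length ps \<le> n"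
    using assms(1,2) card_mono[of "{..<n}" "set ps"] usable_less by (auto simp: distinct_card)
  hence "real (length ps) / (4 * real n) \<le> 1 / 4" using n by (simp add: field_simps)
  finally show ?thesis by simp
qed

text \<open>The path \<open>q\<close> is turned into the policy \<open>follow ps\<close>, which
  keeps half of its reward; \<open>\<pi>\<close> is worth at least a fraction \<open>1 / a\<close>
  of that policy, and the answer at least 1/18 of \<open>\<pi>\<close>.\<close>

lemma answer_value:
  assumes opt: "\<And>\<pi>'. policy_feasible (gadget J) \<pi>' \<Longrightarrow> policy_value (gadget J) \<pi>' \<le> a * policy_value (gadget J) \<pi>"
    and a: "1 \<le> a" and q: "ok_feasible J q"
  shows "real_of_rat (ok_value J q) \<le> 36 * a * real_of_rat (ok_value J (\<rho> # answer))"
proof -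
  obtain ps where ps: "q = \<rho> # ps" "distinct (\<rho> # ps)" "set ps \<subseteq> usable J"
    "walk_length (dist' J) (\<rho> # ps) \<le> nat (B' J)" "(\<Sum>v\<leftarrow>ps. b' J v) \<le> T' J"
    "\<And>as v bs. ps = as @ v # bs \<Longrightarrow> (\<Sum>u\<leftarrow>as. size' J u) + size' J v \<le> deadline' J v"
    using feasible_decompose[OF q] by blast
  have ps_less: "set ps \<subseteq> {..<n}" using ps(3) usable_less by auto
  have ans_less: "set answer \<subseteq> {..<n}" and ans_distinct: "distinct (\<rho> # answer)"
    using answer_feasible by (auto simp: ok_feasible_def)
  define R where "R = real_of_int (reward_sum J ps)"
  have "0 \<le> R" unfolding R_def reward_sum_real[OF ps_less, symmetric] by (intro sum_list_nonneg) auto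
  hence "1 / 2 * R \<le> (1 - (\<Sum>v\<leftarrow>ps. p v)) * R"
    using sum_p_le[of ps] ps by (intro mult_right_mono) auto
  also have "\<dots> \<le> policy_value (gadget J) (follow ps)"
    using follow_value[OF ps(2-4,6)] unfolding R_def reward_sum_real[OF ps_less] .
  also have "\<dots> \<le> a * policy_value (gadget J) \<pi>"
    using opt follow_feasible[OF ps(2-4,6)] by simp
  also have "\<dots> \<le> a * (18 * real_of_int (reward_sum J answer))"
    using a policy_value_le by (intro mult_left_mono) auto
  finally have "R \<le> 36 * a * real_of_int (reward_sum J answer)" by simp
  define \<delta>' where "\<delta>' = real_of_rat \<delta>"
  have \<delta>': "0 < \<delta>'" using \<delta>_pos unfolding \<delta>'_def by (simp only: zero_less_of_rat_iff)
  have real_sum: "real_of_int (reward_sum J vs) = real_of_rat (\<Sum>v\<leftarrow>vs. ok_reward J v) * \<delta>'" if "set vs \<subseteq> {..<n}" for vs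
    using arg_cong[OF scaled_sum(3)[OF that], of real_of_rat] by (simp add: of_rat_mult \<delta>'_def)
  define x y z where "x = real_of_rat (\<Sum>v\<leftarrow>ps. ok_reward J v)" and "y = real_of_rat (\<Sum>v\<leftarrow>answer. ok_reward J v)"
    and "z = real_of_rat (ok_reward J \<rho>)"
  have "x * \<delta>' \<le> (36 * a * y) * \<delta>'"
    using \<open>R \<le> _\<close> unfolding R_def real_sum[OF ps_less] real_sum[OF ans_less] x_def y_def by simp
  hence "x \<le> 36 * a * y" using \<delta>' by simp
  \<comment> \<open>The root lies on both paths but not in the gadget; its reward \<open>z\<close>
    is absorbed because \<open>1 \<le> 36 * a\<close>.\<close>
  moreover have "0 \<le> z" using J root_less by (simp add: is_KnapOrientKD_def z_def)
  hence "z * 1 \<le> z * (36 * a)" using a by (intro mult_left_mono) auto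
  ultimately have "z + x \<le> 36 * a * (z + y)" by (simp add: algebra_simps)
  moreover have "real_of_rat (ok_value J q) = z + x"
    unfolding ok_value_def ps(1) sum.distinct_set_conv_list[OF ps(2)] by (simp add: z_def x_def of_rat_add)
  moreover have "real_of_rat (ok_value J (\<rho> # answer)) = z + y"
    unfolding ok_value_def sum.distinct_set_conv_list[OF ans_distinct] by (simp add: z_def y_def of_rat_add)
  ultimately show ?thesis by simp
qed

end

end

section \<open>Running time of the reduction\<close>

lemma enc_rat_eq: "enc_rat r = Node (Leaf (fst (quotient_of r))) (Leaf (den r))"
  by (simp add: enc_rat_def den_def split: prod.split)

text \<open>\<open>enc_rat\<close> stores reduced fractions. A program may emit numerator and
  denominator directly if they are coprime, without computing a gcd.\<close>

lemma enc_rat_divide: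
  assumes "0 < b" "coprime a b"
  shows "enc_rat (of_int a / of_int b) = Node (Leaf a) (Leaf b)"
  using assms by (simp add: enc_rat_def Fract_of_int_quotient [symmetric] quotient_of_Fract normalize_stable)

lemma enc_rat_of_int: "enc_rat (of_int a) = Node (Leaf a) (Leaf 1)"
  using enc_rat_divide[of 1 a] by simp

lemma ptime_den: "ptime X e (\<lambda>i. enc_rat (f i)) \<Longrightarrow> ptime X e (\<lambda>i. Leaf (den (f i)))"
  unfolding enc_rat_eq by (rule ptime_snd)

lemma ptime_scale:
  assumes "ptime X e (\<lambda>i. Leaf (D i))" "ptime X e (\<lambda>i. enc_rat (f i))"
  shows "ptime X e (\<lambda>i. Leaf (scale (D i) (f i)))"
  unfolding scale_def
  by (intro ptime_mult ptime_div assms(1) ptime_den[OF assms(2)] ptime_fst[OF assms(2)[unfolded enc_rat_eq]])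

lemma ptime_nat:
  assumes "ptime X e (\<lambda>i. Leaf (f i))"
  shows "ptime X e (\<lambda>i. Leaf (int (nat (f i))))"
proof -
  have "ptime X e (\<lambda>i. if 0 \<le> f i then Leaf (f i) else Leaf 0)"
    by (intro ptime_if ptime_le ptime_const ptime_subset[OF assms] assms) auto
  thus ?thesis by (rule ptime_cong) auto
qed

lemma ptime_abs:
  fixes f :: "'i \<Rightarrow> int"
  assumes "ptime X e (\<lambda>i. Leaf (f i))"
  shows "ptime X e (\<lambda>i. Leaf \<bar>f i\<bar>)"
proof -
  have "ptime X e (\<lambda>i. if 0 \<le> f i then Leaf (f i) else Leaf (0 - f i))"
    by (intro ptime_if ptime_le ptime_diff ptime_const ptime_subset[OF assms] assms) auto
  thus ?thesis by (rule ptime_cong) auto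
qed

lemma ptime_prod_den:
  assumes "ptime X e (\<lambda>i. enc_list enc_rat (xs i))"
  shows "ptime X e (\<lambda>i. Leaf (prod_list (map den (xs i))))"
proof (rule ptime_prod_list)
  have "ptime X e (\<lambda>i. enc_list (\<lambda>r. Leaf (den r)) (xs i))"
    by (rule ptime_map[OF assms]) (rule ptime_den[OF ptime_item])
  thus "ptime X e (\<lambda>i. enc_list Leaf (map den (xs i)))" by simp
qed

lemma prod_list_map_den: "prod_list (map den (map a [0..<n])) = vec_den n a"
  by (simp add: vec_den_def comp_def)

section \<open>Computing the scaled data and the gadget\<close>

abbreviation "enc_J \<equiv> enc_knap_orientkd"

lemma ptime_components:
  "ptime X enc_J (\<lambda>J. Leaf (int (ok_n J)))"
  "ptime X enc_J (\<lambda>J. Leaf (int (ok_root J)))"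
  "ptime X enc_J (\<lambda>J. enc_list (enc_list enc_rat) (map (\<lambda>u. map (ok_dist J u) [0..<ok_n J]) [0..<ok_n J]))"
  "ptime X enc_J (\<lambda>J. enc_rat (ok_B J))"
  "ptime X enc_J (\<lambda>J. enc_list enc_rat (map (ok_reward J) [0..<ok_n J]))"
  "ptime X enc_J (\<lambda>J. enc_list enc_rat (map (ok_wt J) [0..<ok_n J]))"
  "ptime X enc_J (\<lambda>J. enc_list enc_rat (map (ok_KD J) [0..<ok_n J]))"
  "ptime X enc_J (\<lambda>J. enc_list enc_rat (map (ok_b J) [0..<ok_n J]))"
  "ptime X enc_J (\<lambda>J. enc_rat (ok_T J))"
proof -
  have 0: "ptime X enc_J (\<lambda>J. Node (Leaf (int (ok_n J))) (Node (Leaf (int (ok_root J)))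
       (Node (enc_list (enc_list enc_rat) (map (\<lambda>u. map (ok_dist J u) [0..<ok_n J]) [0..<ok_n J])) (Node (enc_rat (ok_B J))
         (Node (enc_list enc_rat (map (ok_reward J) [0..<ok_n J])) (Node (enc_list enc_rat (map (ok_wt J) [0..<ok_n J]))
           (Node (enc_list enc_rat (map (ok_KD J) [0..<ok_n J])) (Node (enc_list enc_rat (map (ok_b J) [0..<ok_n J]))
             (enc_rat (ok_T J))))))))))"
    by (rule ptime_cong[OF ptime_id]) (simp add: enc_knap_orientkd_def enc_mat_def enc_vec_def enc_nat_def)
  note 1 = ptime_snd[OF 0] note 2 = ptime_snd[OF 1] note 3 = ptime_snd[OF 2] note 4 = ptime_snd[OF 3]
  note 5 = ptime_snd[OF 4] note 6 = ptime_snd[OF 5] note 7 = ptime_snd[OF 6] note 8 = ptime_snd[OF 7]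
  show "ptime X enc_J (\<lambda>J. Leaf (int (ok_n J)))" by (rule ptime_fst[OF 0])
  show "ptime X enc_J (\<lambda>J. Leaf (int (ok_root J)))" by (rule ptime_fst[OF 1])
  show "ptime X enc_J (\<lambda>J. enc_list (enc_list enc_rat) (map (\<lambda>u. map (ok_dist J u) [0..<ok_n J]) [0..<ok_n J]))" by (rule ptime_fst[OF 2])
  show "ptime X enc_J (\<lambda>J. enc_rat (ok_B J))" by (rule ptime_fst[OF 3])
  show "ptime X enc_J (\<lambda>J. enc_list enc_rat (map (ok_reward J) [0..<ok_n J]))" by (rule ptime_fst[OF 4])
  show "ptime X enc_J (\<lambda>J. enc_list enc_rat (map (ok_wt J) [0..<ok_n J]))" by (rule ptime_fst[OF 5])
  show "ptime X enc_J (\<lambda>J. enc_list enc_rat (map (ok_KD J) [0..<ok_n J]))" by (rule ptime_fst[OF 6])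
  show "ptime X enc_J (\<lambda>J. enc_list enc_rat (map (ok_b J) [0..<ok_n J]))" by (rule ptime_fst[OF 7])
  show "ptime X enc_J (\<lambda>J. enc_rat (ok_T J))" by (rule 8)
qed

lemma ptime_indices: "ptime X enc_J (\<lambda>J. enc_list enc_nat [0..<ok_n J])"
  using ptime_upt[OF ptime_components(5)] by simp

lemma ptime_common_den: "ptime X enc_J (\<lambda>J. Leaf (common_den J))"
proof -
  have "ptime X enc_J (\<lambda>J. enc_list (\<lambda>row. Leaf (prod_list (map den row)))
      (map (\<lambda>u. map (ok_dist J u) [0..<ok_n J]) [0..<ok_n J]))"
    by (rule ptime_map[OF ptime_components(3)]) (rule ptime_prod_den[OF ptime_item])
  hence "ptime X enc_J (\<lambda>J. enc_list Leaf (map (\<lambda>u. vec_den (ok_n J) (ok_dist J u)) [0..<ok_n J]))"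
    unfolding enc_list_map prod_list_map_den .
  from ptime_prod_list[OF this] show ?thesis
    unfolding common_den_def prod_list_map_den[symmetric]
    by (intro ptime_mult ptime_prod_den ptime_den ptime_components)
qed


text \<open>All that is needed for table lookups at the root to stay in range.\<close>

definition rooted :: "knap_orientkd set" where "rooted = {J. ok_root J < ok_n J}"

definition vertices :: "(knap_orientkd \<times> nat) set" where "vertices = (SIGMA J:rooted. {..<ok_n J})"

abbreviation "enc_Jv \<equiv> (\<lambda>z. Node (enc_J (fst z)) (enc_nat (snd z)))"

lemma ptime_lift_vertices: "(\<And>X. ptime X enc_J f) \<Longrightarrow> ptime vertices enc_Jv (\<lambda>z. f (fst z))"
  unfolding vertices_def by (rule ptime_lift)

lemma ptime_vertex: "ptime vertices enc_Jv (\<lambda>z. Leaf (int (snd z)))"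
  unfolding vertices_def by (rule ptime_item_nat)

text \<open>Makes a function of instance and vertex a subroutine that can be called at any computed
  vertex in range.\<close>

lemma ptime_at_vertex:
  assumes "ptime vertices enc_Jv (\<lambda>z. F (fst z) (snd z))"
    and "ptime Y e (\<lambda>j. enc_J (m j))" "ptime Y e (\<lambda>j. Leaf (int (v j)))"
    and "\<And>j. j \<in> Y \<Longrightarrow> m j \<in> rooted \<and> v j < ok_n (m j)"
  shows "ptime Y e (\<lambda>j. F (m j) (v j))"
proof (rule ptime_comp)
  show "ptime Y e (\<lambda>j. Node (enc_J (m j)) (enc_nat (v j)))"
    unfolding enc_nat_def by (intro ptime_Node assms(2,3))
  show "ptime Y (\<lambda>j. Node (enc_J (m j)) (enc_nat (v j))) (\<lambda>j. F (m j) (v j))"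
    using ptime_reindex[OF assms(1), of Y "\<lambda>j. (m j, v j)"] assms(4) by (simp add: vertices_def)
qed

lemma ptime_at_root:
  assumes "ptime vertices enc_Jv (\<lambda>z. F (fst z) (snd z))" "X \<subseteq> rooted"
  shows "ptime X enc_J (\<lambda>J. F J (ok_root J))"
  by (rule ptime_at_vertex[OF assms(1) ptime_id ptime_components(2)]) (use assms(2) in \<open>auto simp: rooted_def\<close>)

lemma ptime_entry:
  assumes "\<And>X. ptime X enc_J (\<lambda>J. enc_list enc_rat (map (a J) [0..<ok_n J]))"
  shows "ptime vertices enc_Jv (\<lambda>z. Leaf (scale (common_den (fst z)) (a (fst z) (snd z))))"
proof (rule ptime_scale)
  show "ptime vertices enc_Jv (\<lambda>z. Leaf (common_den (fst z)))"
    by (rule ptime_lift_vertices) (rule ptime_common_den)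
  have "ptime vertices enc_Jv (\<lambda>z. enc_rat (map (a (fst z)) [0..<ok_n (fst z)] ! snd z))"
    by (rule ptime_nth[OF ptime_lift_vertices[OF assms] ptime_vertex]) (auto simp: vertices_def)
  thus "ptime vertices enc_Jv (\<lambda>z. enc_rat (a (fst z) (snd z)))"
    by (rule ptime_cong) (auto simp: vertices_def)
qed

lemma ptime_wt': "ptime vertices enc_Jv (\<lambda>z. Leaf (wt' (fst z) (snd z)))"
  unfolding wt'_def by (rule ptime_entry) (rule ptime_components)

lemma ptime_b': "ptime vertices enc_Jv (\<lambda>z. Leaf (b' (fst z) (snd z)))"
  unfolding b'_def by (rule ptime_entry) (rule ptime_components)

lemma ptime_reward': "ptime vertices enc_Jv (\<lambda>z. Leaf (reward' (fst z) (snd z)))"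
  unfolding reward'_def by (rule ptime_entry) (rule ptime_components)

lemma ptime_root_lift:
  assumes "ptime vertices enc_Jv (\<lambda>z. F (fst z) (snd z))"
  shows "ptime vertices enc_Jv (\<lambda>z. F (fst z) (ok_root (fst z)))"
  unfolding vertices_def
  by (rule ptime_lift[of rooted enc_J "\<lambda>J. F J (ok_root J)"]) (rule ptime_at_root[OF assms order_refl])

lemma ptime_KD': "ptime vertices enc_Jv (\<lambda>z. Leaf (KD' (fst z) (snd z)))"
  unfolding KD'_def by (intro ptime_diff ptime_entry ptime_components ptime_root_lift[OF ptime_wt'])

lemma ptime_T': "X \<subseteq> rooted \<Longrightarrow> ptime X enc_J (\<lambda>J. Leaf (T' J))"
  unfolding T'_def
  by (intro ptime_diff ptime_scale ptime_common_den ptime_components ptime_at_root[OF ptime_b'])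

lemma ptime_B': "ptime X enc_J (\<lambda>J. Leaf (B' J))"
  unfolding B'_def by (intro ptime_scale ptime_common_den ptime_components)

lemma ptime_T'_vertices: "ptime vertices enc_Jv (\<lambda>z. Leaf (T' (fst z)))"
  unfolding vertices_def by (rule ptime_lift[of rooted enc_J "\<lambda>J. Leaf (T' J)"]) (rule ptime_T'[OF order_refl])

lemma ptime_usable: "ptime vertices enc_Jv (\<lambda>z. Leaf (of_bool (snd z \<in> usable (fst z))))"
proof -
  have "ptime vertices enc_Jv (\<lambda>z. Leaf (of_bool (int (snd z) \<noteq> int (ok_root (fst z)) \<and>
      wt' (fst z) (snd z) \<le> KD' (fst z) (snd z) \<and> b' (fst z) (snd z) \<le> T' (fst z))))"
    by (intro ptime_conj ptime_neq ptime_le ptime_vertex ptime_wt' ptime_KD' ptime_b' ptime_T'_vertices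
        ptime_lift_vertices[OF ptime_components(2)])
  thus ?thesis by (rule ptime_cong) (auto simp: vertices_def usable_def)
qed

lemma ptime_size': "ptime vertices enc_Jv (\<lambda>z. Leaf (int (size' (fst z) (snd z))))"
proof -
  have "ptime vertices enc_Jv (\<lambda>z. if snd z \<in> usable (fst z) then Leaf (int (nat (wt' (fst z) (snd z)))) else Leaf 0)"
    by (intro ptime_if ptime_usable ptime_const ptime_nat ptime_subset[OF ptime_wt']) auto
  thus ?thesis by (rule ptime_cong) (auto simp: size'_def)
qed

lemma ptime_deadline': "ptime vertices enc_Jv (\<lambda>z. Leaf (int (deadline' (fst z) (snd z))))"
  unfolding deadline'_def by (intro ptime_nat ptime_KD')

lemma ptime_rarity: "ptime vertices enc_Jv (\<lambda>z. Leaf (int (rarity (fst z) (snd z))))"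
  unfolding rarity_def
  by (intro ptime_nat ptime_add ptime_div ptime_mult ptime_const ptime_b' ptime_T'_vertices
      ptime_lift_vertices[OF ptime_components(1)])

lemma ptime_vertex_map:
  assumes "ptime vertices enc_Jv (\<lambda>z. F (fst z) (snd z))" "X \<subseteq> rooted"
  shows "ptime X enc_J (\<lambda>J. enc_list (F J) [0..<ok_n J])"
  by (rule ptime_map[OF ptime_indices],
      rule ptime_at_vertex[OF assms(1) ptime_lift[OF ptime_id] ptime_item_nat]) (use assms(2) in auto)

lemma ptime_W':
  assumes "X \<subseteq> rooted"
  shows "ptime X enc_J (\<lambda>J. Leaf (W' J))"
proof -
  have "ptime X enc_J (\<lambda>J. enc_list (\<lambda>v. Leaf \<bar>KD' J v\<bar>) [0..<ok_n J])"
    by (rule ptime_vertex_map[OF ptime_abs[OF ptime_KD'] assms])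
  hence "ptime X enc_J (\<lambda>J. enc_list Leaf (map (\<lambda>v. \<bar>KD' J v\<bar>) [0..<ok_n J]))" by simp
  from ptime_sum_list[OF this] show ?thesis
    unfolding W'_def by (intro ptime_add ptime_mult ptime_const)
qed

lemma ptime_dist': "ptime X enc_J (\<lambda>J. enc_mat enc_nat (ok_n J) (dist' J))"
proof -
  have "ptime X enc_J (\<lambda>J. enc_list (\<lambda>row. enc_list (\<lambda>r. Leaf (int (nat (scale (common_den J) r)))) row)
      (map (\<lambda>u. map (ok_dist J u) [0..<ok_n J]) [0..<ok_n J]))"
  proof (rule ptime_map[OF ptime_components(3)], rule ptime_map[OF ptime_item], rule ptime_nat, rule ptime_scale)
    show "ptime (SIGMA z:SIGMA J:X. set (map (\<lambda>u. map (ok_dist J u) [0..<ok_n J]) [0..<ok_n J]). set (snd z))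
      (\<lambda>z. Node (Node (enc_J (fst (fst z))) (enc_list enc_rat (snd (fst z)))) (enc_rat (snd z)))
      (\<lambda>z. Leaf (common_den (fst (fst z))))"
      using ptime_lift[OF ptime_lift[OF ptime_common_den]] .
  qed (rule ptime_item)
  thus ?thesis
    by (rule ptime_cong) (auto simp: enc_mat_def enc_vec_def enc_nat_def dist'_def intro!: enc_list_cong)
qed

text \<open>The encoding of a gadget job written out in integer arithmetic, with all fractions
  already reduced.\<close>

definition job_code :: "knap_orientkd \<Rightarrow> nat \<Rightarrow> dat" where
  "job_code J v = (if v \<in> usable J then
     Node (Node (Node (Leaf (W' J - KD' J v + wt' J v)) (Node (Leaf (reward' J v * int (rarity J v))) (Leaf 1)))
            (Node (Leaf 1) (Leaf (int (rarity J v)))))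
       (Node (Node (Node (Leaf (wt' J v)) (Node (Leaf 0) (Leaf 1)))
            (Node (Leaf (int (rarity J v) - 1)) (Leaf (int (rarity J v))))) (Leaf 0))
     else Node (Node (Node (Leaf 0) (Node (Leaf 0) (Leaf 1))) (Node (Leaf 1) (Leaf 1))) (Leaf 0))"

lemma ptime_job_code: "ptime vertices enc_Jv (\<lambda>z. job_code (fst z) (snd z))"
proof -
  let ?Y = "{z \<in> vertices. snd z \<in> usable (fst z)}"
  have sub: "ptime vertices enc_Jv f \<Longrightarrow> ptime ?Y enc_Jv f" for f
    by (rule ptime_subset) auto
  have W: "ptime vertices enc_Jv (\<lambda>z. Leaf (W' (fst z)))"
    unfolding vertices_def by (rule ptime_lift[of rooted enc_J "\<lambda>J. Leaf (W' J)"]) (rule ptime_W'[OF order_refl])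
  show ?thesis
    unfolding job_code_def
    by (rule ptime_if[OF ptime_usable])
      (intro ptime_Node ptime_const ptime_add ptime_diff ptime_mult sub W ptime_KD' ptime_wt' ptime_reward' ptime_rarity)+
qed

context rooted_instance
begin

lemma enc_job: "v < n \<Longrightarrow> enc_list (enc_prod (enc_prod enc_nat enc_rat) enc_rat) (job v) = job_code J v"
proof (cases "v \<in> usable J")
  case True
  have k: "2 \<le> rarity J v" by (rule rarity_ge[OF True])
  have rew: "rat_of_nat (nat (reward' J v) * rarity J v) = of_int (reward' J v * int (rarity J v))"
    using nonneg(3)[of v] True by (simp add: usable_less)
  have p1: "enc_rat (1 / of_nat (rarity J v)) = Node (Leaf 1) (Leaf (int (rarity J v)))"
    using enc_rat_divide[of "int (rarity J v)" 1] k by simp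
  \<comment> \<open>Consecutive integers are coprime, so \<open>(k - 1) / k\<close> is
    reduced.\<close>
  have cop: "coprime (int (rarity J v) - 1) (int (rarity J v))"
    by (metis add_diff_cancel_left' coprime_add_one_left coprime_commute diff_add_cancel)
  have p2: "enc_rat (of_nat (rarity J v - 1) / of_nat (rarity J v)) =
      Node (Leaf (int (rarity J v) - 1)) (Leaf (int (rarity J v)))"
    using enc_rat_divide[OF _ cop] k by (simp add: of_nat_diff)
  \<comment> \<open>The subtraction on \<open>nat\<close> is not truncated, since deadlines are
    below \<open>W\<close>.\<close>
  have s: "int (nat (W' J) - deadline' J v) = W' J - KD' J v"
    using KW[OF True] deadline'_int[OF True] by linarith
  show ?thesis using True
    by (simp add: job_def job_code_def big_def small_def enc_prod_def enc_nat_def p1 p2[unfolded One_nat_def] s rew enc_rat_of_int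
        size'_int enc_rat_of_int[of 0, simplified] del: of_nat_mult of_int_mult of_nat_diff)
next
  case False
  thus ?thesis
    by (simp add: job_def job_code_def enc_prod_def enc_nat_def enc_rat_of_int[of 0, simplified]
        enc_rat_of_int[of 1, simplified])
qed

lemma enc_gadget: "enc_corrko (gadget J) = Node (Leaf (int n)) (Node (Leaf (int \<rho>))
    (Node (enc_mat enc_nat n (dist' J)) (Node (Leaf (B' J)) (Node (Leaf (W' J)) (enc_list (job_code J) [0..<n])))))"
proof -
  have "0 \<le> W' J" unfolding W'_def by (intro add_nonneg_nonneg mult_nonneg_nonneg sum_list_nonneg) auto
  moreover have "enc_list (\<lambda>v. enc_list (enc_prod (enc_prod enc_nat enc_rat) enc_rat) (job v)) [0..<n] =
      enc_list (job_code J) [0..<n]"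
    by (rule enc_list_cong) (simp add: enc_job)
  ultimately show ?thesis using B'_nonneg
    by (simp only: enc_corrko_def inst_simps enc_vec_def enc_list_map) (simp add: enc_nat_def)
qed

end

definition good :: "knap_orientkd set" where "good = {J. is_KnapOrientKD J \<and> root_ok J}"

lemma good_rooted: "good \<subseteq> rooted"
  by (auto simp: good_def rooted_def is_KnapOrientKD_def)

lemma rooted_instance_good: "J \<in> good \<Longrightarrow> rooted_instance J"
  by (simp add: good_def rooted_instance_def)

lemma ptime_gadget: "ptime good enc_J (\<lambda>J. enc_corrko (gadget J))"
proof (rule ptime_cong)
  show "ptime good enc_J (\<lambda>J. Node (Leaf (int (ok_n J))) (Node (Leaf (int (ok_root J)))
    (Node (enc_mat enc_nat (ok_n J) (dist' J)) (Node (Leaf (B' J)) (Node (Leaf (W' J))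
      (enc_list (job_code J) [0..<ok_n J]))))))"
    by (intro ptime_Node ptime_components ptime_dist' ptime_B' ptime_W'[OF good_rooted]
        ptime_vertex_map[OF ptime_job_code good_rooted])
qed (simp add: rooted_instance.enc_gadget[OF rooted_instance_good])

section \<open>Simulating the policy on small jobs\<close>

context
  fixes \<pi> :: "knap_orientkd \<Rightarrow> policy"
  assumes feasible: "\<And>J. J \<in> good \<Longrightarrow> policy_feasible (gadget J) (\<pi> J)"
    and decision: "ptime (SIGMA J:good. UNIV)
      (\<lambda>z. Node (enc_corrko (gadget (fst z))) (enc_history (play (\<pi> (fst z)) (quiet (fst z)) (snd z))))
      (\<lambda>z. enc_option enc_nat (\<pi> (fst z) (play (\<pi> (fst z)) (quiet (fst z)) (snd z))))"
begin

text \<open>Feasibility on the quiet run keeps all visited vertices in range, so their data can be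
  looked up.\<close>

lemma play_less:
  assumes g: "J \<in> good" and "k \<le> ok_n J" "(v, x) \<in> set (play (\<pi> J) (quiet J) k)"
  shows "v < ok_n J"
proof -
  interpret rooted_instance J by (rule rooted_instance_good[OF g])
  obtain h where "play (\<pi> J) (quiet J) (ok_n J) = play (\<pi> J) (quiet J) k @ h"
    using play_prefix[OF assms(2)] by blast
  with assms(3) have "v \<in> set (quiet_run (\<pi> J))" by (force simp: quiet_run_def)
  thus ?thesis using quiet_run_feasible(1)[OF feasible[OF g]] by auto
qed

lemma quiet_eq: "J \<in> good \<Longrightarrow> quiet J v = (size' J v, 0)"
proof -
  assume "J \<in> good"
  then interpret rooted_instance J by (rule rooted_instance_good)
  show ?thesis by (rule small_def)
qed

definition entry_code :: "knap_orientkd \<Rightarrow> nat \<Rightarrow> dat" where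
  "entry_code J v = Node (Leaf (int v)) (Node (Leaf (int (size' J v))) (Node (Leaf 0) (Leaf 1)))"

abbreviation "enc_entry \<equiv> enc_prod enc_nat (enc_prod enc_nat enc_rat)"

lemma enc_entry_eq: "J \<in> good \<Longrightarrow> enc_entry (v, quiet J v) = entry_code J v"
  by (simp add: quiet_eq enc_prod_def enc_nat_def entry_code_def enc_rat_of_int[of 0, simplified])

text \<open>The size bound for the fold that simulates the policy: at most \<open>n\<close> entries,
  each with a vertex below \<open>n\<close>, a size of polynomial length and the reward 0.\<close>

lemma play_size:
  obtains q where "\<And>J k. J \<in> good \<Longrightarrow> k \<le> ok_n J \<Longrightarrow>
    dsize (enc_history (play (\<pi> J) (quiet J) k)) \<le> poly q (dsize (enc_J J))"
proof -
  obtain qn where qn: "\<And>J. J \<in> good \<Longrightarrow> dsize (enc_list enc_nat [0..<ok_n J]) \<le> poly qn (dsize (enc_J J))"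
    using ptime_size[OF ptime_indices] by blast
  obtain qs where qs: "\<And>z. z \<in> vertices \<Longrightarrow> dsize (Leaf (int (size' (fst z) (snd z)))) \<le> poly qs (dsize (enc_Jv z))"
    using ptime_size[OF ptime_size'] by blast
  \<comment> \<open>The 7 counts three \<open>Node\<close>s, \<open>Leaf 0\<close> of size 1,
    \<open>Leaf 1\<close> of size 2, and 1 from the bound on the code of the vertex. The inner
    polynomial bounds the encoded pair of instance and vertex.\<close>
  define qb where "qb = [:7:] + qn + pcompose qs ([:2, 1:] + qn)"
  show ?thesis
  proof (rule that[of "[:1:] + qn * ([:1:] + qb)"])
    fix J k assume J: "J \<in> good" and k: "k \<le> ok_n J"
    define x where "x = dsize (enc_J J)"
    have n: "ok_n J \<le> poly qn x"
      using qn[OF J] length_le_dsize[of "[0..<ok_n J]" enc_nat] by (simp add: x_def)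
    have "dsize (enc_entry y) \<le> poly qb x" if y: "y \<in> set (play (\<pi> J) (quiet J) k)" for y
    proof -
      obtain v where v: "y = (v, quiet J v)" using play_entries y by (cases y) blast
      have "v < ok_n J" using play_less[OF J k] y v by blast
      hence vn: "dsize (Leaf (int v)) \<le> Suc (poly qn x)" using dsize_int_le[of v] n by linarith
      have "dsize (Leaf (int (size' J v))) \<le> poly qs (dsize (enc_Jv (J, v)))"
        using qs[of "(J, v)"] \<open>v < ok_n J\<close> J good_rooted by (auto simp: vertices_def)
      also have "dsize (enc_Jv (J, v)) \<le> poly ([:2, 1:] + qn) x"
        using vn by (simp add: enc_nat_def x_def)
      hence "poly qs (dsize (enc_Jv (J, v))) \<le> poly qs (poly ([:2, 1:] + qn) x)" by (rule poly_nat_mono)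
      finally have "dsize (Leaf (int (size' J v))) \<le> poly (pcompose qs ([:2, 1:] + qn)) x"
        by (simp only: poly_pcompose)
      moreover have "floorlog 2 1 = 1" by (simp add: floorlog_def)
      ultimately show ?thesis using vn
        unfolding v enc_entry_eq[OF J] entry_code_def qb_def by (simp add: poly_add)
    qed
    hence "dsize (enc_history (play (\<pi> J) (quiet J) k)) \<le> Suc (length (play (\<pi> J) (quiet J) k) * Suc (poly qb x))"
      unfolding enc_history_def by (rule dsize_enc_list_le)
    also have "\<dots> \<le> Suc (poly qn x * Suc (poly qb x))"
      using length_play[of "\<pi> J" "quiet J" k] k n by (intro Suc_le_mono[THEN iffD2] mult_le_mono1) linarith
    finally show "dsize (enc_history (play (\<pi> J) (quiet J) k)) \<le> poly ([:1:] + qn * ([:1:] + qb)) (dsize (enc_J J))"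
      by (simp add: x_def)
  qed
qed

text \<open>The index list acts as a clock for \<open>n\<close> steps. After the policy has stopped,
  further steps leave the history unchanged.\<close>

lemma ptime_play: "ptime good enc_J (\<lambda>J. enc_history (play (\<pi> J) (quiet J) (ok_n J)))"
proof -
  obtain q where q: "\<And>J k. J \<in> good \<Longrightarrow> k \<le> ok_n J \<Longrightarrow>
      dsize (enc_history (play (\<pi> J) (quiet J) k)) \<le> poly q (dsize (enc_J J))"
    by (rule play_size) blast
  let ?Y = "SIGMA J:good. {..<length [0..<ok_n J]}"
  define h where "h = (\<lambda>z. play (\<pi> (fst z)) (quiet (fst z)) (snd z))"
  \<comment> \<open>Meaningful only on \<open>?S\<close>, where the policy moves;
    \<open>ptime_if\<close> confines its use to that case.\<close>
  define v where "v = (\<lambda>z. the (\<pi> (fst z) (h z)))"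
  let ?e = "\<lambda>z. Node (enc_J (fst z)) (Node (enc_nat ([0..<ok_n (fst z)] ! snd z)) (enc_history (h z)))"
  let ?S = "{z \<in> ?Y. \<pi> (fst z) (h z) \<noteq> None}"
  have hist: "ptime ?Y ?e (\<lambda>z. enc_history (h z))"
    by (rule ptime_snd[OF ptime_item])
  have "ptime ?Y ?e (\<lambda>z. Node (enc_corrko (gadget (fst z))) (enc_history (h z)))"
    by (intro ptime_Node hist ptime_lift[OF ptime_gadget])
  moreover have "ptime ?Y (\<lambda>z. Node (enc_corrko (gadget (fst z))) (enc_history (h z)))
      (\<lambda>z. enc_option enc_nat (\<pi> (fst z) (h z)))"
    unfolding h_def by (rule ptime_subset[OF decision]) auto
  ultimately have dec: "ptime ?Y ?e (\<lambda>z. enc_option enc_nat (\<pi> (fst z) (h z)))"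
    by (rule ptime_comp)
  have some: "ptime ?Y ?e (\<lambda>z. Leaf (of_bool (\<pi> (fst z) (h z) \<noteq> None)))"
    by (rule ptime_cong[OF ptime_prim'[OF dec, of IsNode]]) (auto simp: enc_option_def)
  have sub: "ptime ?Y ?e f \<Longrightarrow> ptime ?S ?e f" for f by (rule ptime_subset) auto
  have next_v: "ptime ?S ?e (\<lambda>z. Leaf (int (v z)))"
    by (rule ptime_cong[OF ptime_prim'[OF sub[OF dec], of Snd]]) (auto simp: enc_option_def enc_nat_def v_def)
  have suc: "play (\<pi> (fst z)) (quiet (fst z)) (Suc (snd z)) = h z @ [(v z, quiet (fst z) (v z))]"
    if "\<pi> (fst z) (h z) \<noteq> None" for z
    using that by (auto simp: h_def v_def Let_def)
  have v_less: "fst z \<in> rooted \<and> v z < ok_n (fst z)" if z: "z \<in> ?S" for z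
    using play_less[of "fst z" "Suc (snd z)" "v z" "quiet (fst z) (v z)"] suc[of z] z good_rooted by auto
  have size: "ptime ?S ?e (\<lambda>z. Leaf (int (size' (fst z) (v z))))"
    by (rule ptime_at_vertex[OF ptime_size' sub[OF ptime_lift[OF ptime_id]] next_v v_less])
  have "ptime ?S ?e (\<lambda>z. Node (entry_code (fst z) (v z)) (Leaf 0))"
    unfolding entry_code_def by (intro ptime_Node ptime_const next_v size)
  hence "ptime ?S ?e (\<lambda>z. enc_list enc_entry [(v z, quiet (fst z) (v z))])"
    by (rule ptime_cong) (auto simp: enc_entry_eq)
  hence "ptime ?S ?e (\<lambda>z. enc_list enc_entry (h z @ [(v z, quiet (fst z) (v z))]))"
    using sub[OF hist] unfolding enc_history_def by (intro ptime_append)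
  hence "ptime ?Y ?e (\<lambda>z. if \<pi> (fst z) (h z) \<noteq> None
      then enc_list enc_entry (h z @ [(v z, quiet (fst z) (v z))]) else enc_history (h z))"
    by (intro ptime_if some ptime_subset[OF hist]) auto
  hence step: "ptime ?Y ?e (\<lambda>z. enc_history (play (\<pi> (fst z)) (quiet (fst z)) (Suc (snd z))))"
    by (rule ptime_cong) (auto simp: enc_history_def h_def v_def Let_def)
  have "ptime good enc_J (\<lambda>J. enc_history (play (\<pi> J) (quiet J) (length [0..<ok_n J])))"
    by (rule ptime_fold[OF ptime_indices, where acc = "\<lambda>J k. enc_history (play (\<pi> J) (quiet J) k)"])
      (use q step in \<open>auto simp: h_def enc_history_def intro: ptime_const\<close>)
  thus ?thesis by simp
qed

lemma ptime_visited: "ptime good enc_J (\<lambda>J. enc_list enc_nat (visited J (\<pi> J)))"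
proof -
  have "ptime good enc_J (\<lambda>J. enc_list (\<lambda>y. enc_nat (fst y)) (play (\<pi> J) (quiet J) (ok_n J)))"
  proof (rule ptime_map[OF ptime_play[unfolded enc_history_def]])
    show "ptime (SIGMA J:good. set (play (\<pi> J) (quiet J) (ok_n J)))
      (\<lambda>z. Node (enc_J (fst z)) (enc_entry (snd z))) (\<lambda>z. enc_nat (fst (snd z)))"
      unfolding enc_prod_def by (rule ptime_fst[OF ptime_item])
  qed
  thus ?thesis by (simp add: visited_def)
qed

lemma visited_less: "J \<in> good \<Longrightarrow> set (visited J (\<pi> J)) \<subseteq> {..<ok_n J}"
  using play_less[of J "ok_n J"] by (auto simp: visited_def)

lemma int_sum_list: "int (sum_list (map f xs)) = sum_list (map (\<lambda>x. int (f x)) xs)"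
  by (induction xs) auto

text \<open>Follows \<open>ontime_filter\<close>: the load is recomputed as a prefix sum at each
  index.\<close>

lemma ptime_in_time: "ptime good enc_J (\<lambda>J. enc_list enc_nat (in_time J (\<pi> J)))"
proof -
  define vs where "vs = (\<lambda>J. visited J (\<pi> J))"
  define P where "P = (\<lambda>J i. vs J ! i \<in> usable J \<and>
    sum_list (take (Suc i) (map (\<lambda>v. int (size' J v)) (vs J))) \<le> int (deadline' J (vs J ! i)))"
  have vs: "ptime good enc_J (\<lambda>J. enc_list enc_nat (vs J))"
    unfolding vs_def by (rule ptime_visited)
  have less: "set (vs J) \<subseteq> {..<ok_n J}" "J \<in> rooted" if "J \<in> good" for J
    using visited_less good_rooted that by (auto simp: vs_def)
  have "ptime good enc_J (\<lambda>J. enc_list (\<lambda>v. Leaf (int (size' J v))) (vs J))"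
    by (rule ptime_map[OF vs], rule ptime_at_vertex[OF ptime_size' ptime_lift[OF ptime_id] ptime_item_nat])
      (use less in fastforce)
  hence sizes: "ptime good enc_J (\<lambda>J. enc_list Leaf (map (\<lambda>v. int (size' J v)) (vs J)))" by simp
  let ?Y = "SIGMA J:good. set [0..<length (vs J)]"
  have "ptime ?Y enc_Jv (\<lambda>z. enc_nat (vs (fst z) ! snd z))"
    by (rule ptime_nth[OF ptime_lift[OF vs] ptime_item_nat]) auto
  hence v: "ptime ?Y enc_Jv (\<lambda>z. Leaf (int (vs (fst z) ! snd z)))"
    by (rule ptime_cong) (simp add: enc_nat_def)
  have mem: "fst z \<in> rooted \<and> vs (fst z) ! snd z < ok_n (fst z)" if z: "z \<in> ?Y" for z
  proof -
    have "fst z \<in> good" "vs (fst z) ! snd z \<in> set (vs (fst z))" using z by auto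
    thus ?thesis using less[of "fst z"] by blast
  qed
  note at = ptime_at_vertex[OF _ ptime_lift[OF ptime_id] v mem]
  have "ptime ?Y enc_Jv (\<lambda>z. Leaf (of_bool (P (fst z) (snd z))))"
    unfolding P_def
  proof (intro ptime_conj ptime_le ptime_sum_list ptime_take)
    show "ptime ?Y enc_Jv (\<lambda>z. Leaf (of_bool (vs (fst z) ! snd z \<in> usable (fst z))))"
      by (rule at[OF ptime_usable])
    show "ptime ?Y enc_Jv (\<lambda>z. Leaf (int (deadline' (fst z) (vs (fst z) ! snd z))))"
      by (rule at[OF ptime_deadline'])
    show "ptime ?Y enc_Jv (\<lambda>z. enc_list Leaf (map (\<lambda>v. int (size' (fst z) v)) (vs (fst z))))"
      by (rule ptime_lift[OF sizes])
    show "ptime ?Y enc_Jv (\<lambda>z. Leaf (int (Suc (snd z))))"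
      using ptime_add[OF ptime_const[of _ _ "Leaf 1"] ptime_item_nat] by simp
  qed
  hence "ptime good enc_J (\<lambda>J. enc_list enc_nat (filter (P J) [0..<length (vs J)]))"
    by (rule ptime_filter[OF ptime_upt[OF vs]])
  hence "ptime good enc_J (\<lambda>J. enc_list (\<lambda>i. enc_nat (vs J ! i)) (filter (P J) [0..<length (vs J)]))"
    by (rule ptime_map) (rule ptime_nth[OF ptime_lift[OF vs] ptime_item_nat], auto)
  moreover have "map ((!) (vs J)) (filter (P J) [0..<length (vs J)]) = in_time J (\<pi> J)" for J
  proof -
    have "P J = (\<lambda>i. vs J ! i \<in> usable J \<and> 0 + (\<Sum>v\<leftarrow>take (Suc i) (vs J). size' J v) \<le> deadline' J (vs J ! i))"
      unfolding P_def take_map int_sum_list[symmetric] by auto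
    thus ?thesis unfolding in_time_def ontime_filter vs_def by simp
  qed
  ultimately show ?thesis by (simp only: enc_list_map[symmetric])
qed

end

section \<open>Searching for the best light segment\<close>

lemma ptime_vertex_sum:
  assumes "ptime vertices enc_Jv (\<lambda>z. Leaf (f (fst z) (snd z)))"
    and "ptime Y e (\<lambda>j. enc_J (m j))" and s: "ptime Y e (\<lambda>j. enc_list enc_nat (s j))"
    and less: "\<And>j. j \<in> Y \<Longrightarrow> m j \<in> rooted \<and> set (s j) \<subseteq> {..<ok_n (m j)}"
  shows "ptime Y e (\<lambda>j. Leaf (\<Sum>v\<leftarrow>s j. f (m j) v))"
proof (rule ptime_sum_list)
  have "ptime Y e (\<lambda>j. enc_list (\<lambda>v. Leaf (f (m j) v)) (s j))"
    by (rule ptime_map[OF s], rule ptime_at_vertex[OF assms(1) ptime_lift[OF assms(2)] ptime_item_nat])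
      (use less in fastforce)
  thus "ptime Y e (\<lambda>j. enc_list Leaf (map (f (m j)) (s j)))" by simp
qed

lemma ptime_reward_sum:
  assumes "ptime Y e (\<lambda>z. enc_J (m z))"
    and "\<And>z s. z \<in> Y \<Longrightarrow> s \<in> S z \<Longrightarrow> m z \<in> rooted \<and> set s \<subseteq> {..<ok_n (m z)}"
  shows "ptime (Sigma Y S) (\<lambda>z. Node (e (fst z)) (enc_list enc_nat (snd z)))
    (\<lambda>z. Leaf (reward_sum (m (fst z)) (snd z)))"
proof (rule ptime_vertex_sum[OF ptime_reward' ptime_lift[OF assms(1)] ptime_item])
  fix z assume "z \<in> Sigma Y S"
  hence "fst z \<in> Y" "snd z \<in> S (fst z)" by auto
  thus "m (fst z) \<in> rooted \<and> set (snd z) \<subseteq> {..<ok_n (m (fst z))}" by (rule assms(2))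
qed

lemma set_segment: "set (segment J vs i j) \<subseteq> set vs"
  by (auto simp: segment_def dest: in_set_takeD in_set_dropD)

lemma set_best_from: "set (best_from J vs i) \<subseteq> set vs"
  using best_mem[of "reward_sum J" "[]" "map (segment J vs i) [0..<length vs]"]
  by (auto simp: best_from_def dest: subsetD[OF set_segment])

text \<open>There are only quadratically many pairs of start and length, so two nested maximisations
  try them all. \<open>Y1\<close> adds the start to the instance, \<open>Y2\<close> also the
  length.\<close>

lemma ptime_best_segment:
  assumes fs: "ptime X enc_J (\<lambda>J. enc_list enc_nat (fs J))"
    and less: "\<And>J. J \<in> X \<Longrightarrow> set (fs J) \<subseteq> {..<ok_n J}" and X: "X \<subseteq> rooted"
  shows "ptime X enc_J (\<lambda>J. enc_list enc_nat (best_segment J (fs J)))"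
proof -
  define Y1 where "Y1 = (SIGMA J:X. set [0..<length (fs J)])"
  define Y2 where "Y2 = (SIGMA z:Y1. set [0..<length (fs (fst z))])"
  define e2 where "e2 = (\<lambda>z. Node (enc_Jv (fst z)) (enc_nat (snd z)))"
  have lift1: "ptime Y1 enc_Jv (\<lambda>z. f (fst z))" if "ptime X enc_J f" for f
    unfolding Y1_def by (rule ptime_lift[OF that])
  have lift2: "ptime Y2 e2 (\<lambda>z. f (fst z))" if "ptime Y1 enc_Jv f" for f
    unfolding Y2_def e2_def by (rule ptime_lift[OF that])
  have i: "ptime Y1 enc_Jv (\<lambda>z. Leaf (int (snd z)))" unfolding Y1_def by (rule ptime_item_nat)
  have j: "ptime Y2 e2 (\<lambda>z. Leaf (int (snd z)))" unfolding Y2_def e2_def by (rule ptime_item_nat)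
  define t where "t = (\<lambda>z. take (Suc (snd z)) (drop (snd (fst z)) (fs (fst (fst z)))))"
  have "ptime Y2 e2 (\<lambda>z. Leaf (int (Suc (snd z))))"
    using ptime_add[OF ptime_const[of _ _ "Leaf 1"] j] by simp
  hence t: "ptime Y2 e2 (\<lambda>z. enc_list enc_nat (t z))"
    unfolding t_def by (rule ptime_take[OF ptime_drop[OF lift2[OF lift1[OF fs]] lift2[OF i]]])
  have "ptime Y2 e2 (\<lambda>z. Leaf (\<Sum>v\<leftarrow>t z. b' (fst (fst z)) v))"
  proof (rule ptime_vertex_sum[OF ptime_b' lift2[OF lift1[OF ptime_id]] t])
    fix z assume "z \<in> Y2"
    hence "fst (fst z) \<in> X" by (auto simp: Y1_def Y2_def)
    moreover have "set (t z) \<subseteq> set (fs (fst (fst z)))" by (auto simp: t_def dest: in_set_takeD in_set_dropD)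
    ultimately show "fst (fst z) \<in> rooted \<and> set (t z) \<subseteq> {..<ok_n (fst (fst z))}" using less X by blast
  qed
  hence "ptime Y2 e2 (\<lambda>z. if (\<Sum>v\<leftarrow>t z. b' (fst (fst z)) v) \<le> T' (fst (fst z)) then enc_list enc_nat (t z) else Leaf 0)"
    by (intro ptime_if ptime_le lift2[OF lift1[OF ptime_T'[OF X]]] ptime_subset[OF t] ptime_const) auto
  hence seg: "ptime Y2 e2 (\<lambda>z. enc_list enc_nat (segment (fst (fst z)) (fs (fst (fst z))) (snd (fst z)) (snd z)))"
    by (rule ptime_cong) (simp add: segment_def t_def)
  have "ptime Y1 enc_Jv (\<lambda>z. enc_list (\<lambda>j. enc_list enc_nat (segment (fst z) (fs (fst z)) (snd z) j)) [0..<length (fs (fst z))])"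
    by (rule ptime_map[OF lift1[OF ptime_upt[OF fs]]]) (rule seg[unfolded Y2_def e2_def])
  hence segs: "ptime Y1 enc_Jv (\<lambda>z. enc_list (enc_list enc_nat) (map (segment (fst z) (fs (fst z)) (snd z)) [0..<length (fs (fst z))]))"
    by simp
  have "ptime Y1 enc_Jv (\<lambda>z. enc_list enc_nat (best_from (fst z) (fs (fst z)) (snd z)))"
    unfolding best_from_def
  proof (rule ptime_best[OF segs])
    show "ptime Y1 enc_Jv (\<lambda>z. enc_list enc_nat [])" using ptime_const[of Y1 enc_Jv "Leaf 0"] by simp
    show "ptime (SIGMA z:Y1. insert [] (set (map (segment (fst z) (fs (fst z)) (snd z)) [0..<length (fs (fst z))])))
        (\<lambda>z. Node (enc_Jv (fst z)) (enc_list enc_nat (snd z))) (\<lambda>z. Leaf (reward_sum (fst (fst z)) (snd z)))"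
    proof (rule ptime_reward_sum[OF lift1[OF ptime_id]])
      fix z s assume "z \<in> Y1"
        and "s \<in> insert [] (set (map (segment (fst z) (fs (fst z)) (snd z)) [0..<length (fs (fst z))]))"
      hence "fst z \<in> X" "set s \<subseteq> set (fs (fst z))"
        by (auto simp: Y1_def dest: subsetD[OF set_segment])
      thus "fst z \<in> rooted \<and> set s \<subseteq> {..<ok_n (fst z)}" using less X by blast
    qed
  qed
  from ptime_map[OF ptime_upt[OF fs] this[unfolded Y1_def]]
  have froms: "ptime X enc_J (\<lambda>J. enc_list (enc_list enc_nat) (map (best_from J (fs J)) [0..<length (fs J)]))"
    by simp
  show ?thesis
    unfolding best_segment_def
  proof (rule ptime_best[OF froms])
    show "ptime X enc_J (\<lambda>z. enc_list enc_nat [])" using ptime_const[of X enc_J "Leaf 0"] by simp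
    show "ptime (SIGMA J:X. insert [] (set (map (best_from J (fs J)) [0..<length (fs J)])))
        (\<lambda>z. Node (enc_J (fst z)) (enc_list enc_nat (snd z))) (\<lambda>z. Leaf (reward_sum (fst z) (snd z)))"
    proof (rule ptime_reward_sum[OF ptime_id])
      fix J s assume "J \<in> X" and "s \<in> insert [] (set (map (best_from J (fs J)) [0..<length (fs J)]))"
      moreover from this have "set s \<subseteq> set (fs J)" by (auto dest: subsetD[OF set_best_from])
      ultimately show "J \<in> rooted \<and> set s \<subseteq> {..<ok_n J}" using less X by blast
    qed
  qed
qed

theorem theorem5p5:
  shows "\<exists>C>0. \<forall>(\<alpha> :: nat \<Rightarrow> real) A.
           (\<forall>n. 1 \<le> \<alpha> n) \<longrightarrow> approx_alg_2CorrKO \<alpha> A \<longrightarrow>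
           (\<exists>A'. approx_alg_KnapOrientKD (\<lambda>n. C * \<alpha> n) A')"
proof (intro exI[of _ 36] conjI allI impI)
  fix \<alpha> :: "nat \<Rightarrow> real" and A
  assume \<alpha>: "\<forall>n. 1 \<le> \<alpha> n" and A: "approx_alg_2CorrKO \<alpha> A"
  obtain q where "\<forall>I\<in>{I. is_2CorrKO I}. \<exists>\<pi>. policy_feasible I \<pi> \<and>
      (\<forall>\<pi>'. policy_feasible I \<pi>' \<longrightarrow> policy_value I \<pi>' \<le> \<alpha> (co_n I) * policy_value I \<pi>) \<and>
      (\<forall>\<omega>\<in>set_pmf (outcomes I). \<forall>k.
        computes_within A q (Node (enc_corrko I) (enc_history (play \<pi> \<omega> k))) (enc_option enc_nat (\<pi> (play \<pi> \<omega> k))))"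
    using A unfolding approx_alg_2CorrKO_def by auto
  \<comment> \<open>One policy is fixed per instance. This choice need not be effective:
    \<open>A\<close> computes the decisions of the chosen policy.\<close>
  from bchoice[OF this] obtain pol where pol: "\<forall>I\<in>{I. is_2CorrKO I}. policy_feasible I (pol I) \<and>
      (\<forall>\<pi>'. policy_feasible I \<pi>' \<longrightarrow> policy_value I \<pi>' \<le> \<alpha> (co_n I) * policy_value I (pol I)) \<and>
      (\<forall>\<omega>\<in>set_pmf (outcomes I). \<forall>k.
        computes_within A q (Node (enc_corrko I) (enc_history (play (pol I) \<omega> k))) (enc_option enc_nat (pol I (play (pol I) \<omega> k))))"
    by blast
  define \<pi> where "\<pi> = (\<lambda>J. pol (gadget J))"
  have \<pi>: "policy_feasible (gadget J) (\<pi> J)"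
    "policy_feasible (gadget J) \<pi>' \<Longrightarrow> policy_value (gadget J) \<pi>' \<le> \<alpha> (ok_n J) * policy_value (gadget J) (\<pi> J)"
    "computes_within A q (Node (enc_corrko (gadget J)) (enc_history (play (\<pi> J) (quiet J) k)))
       (enc_option enc_nat (\<pi> J (play (\<pi> J) (quiet J) k)))"
    if "J \<in> good" for J \<pi>' k
  proof -
    interpret rooted_instance J by (rule rooted_instance_good[OF that])
    show "policy_feasible (gadget J) (\<pi> J)"
      "policy_feasible (gadget J) \<pi>' \<Longrightarrow> policy_value (gadget J) \<pi>' \<le> \<alpha> (ok_n J) * policy_value (gadget J) (\<pi> J)"
      "computes_within A q (Node (enc_corrko (gadget J)) (enc_history (play (\<pi> J) (quiet J) k)))
        (enc_option enc_nat (\<pi> J (play (\<pi> J) (quiet J) k)))"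
      \<comment> \<open>The gadget has the same number of vertices, so \<open>\<alpha>\<close> is
        evaluated at the same argument.\<close>
      using pol[rule_format, of "gadget J"] is_2CorrKO_inst small_in_outcomes by (auto simp: \<pi>_def)
  qed
  define path where "path = (\<lambda>J. ok_root J # best_segment J (in_time J (\<pi> J)))"
  define ans where "ans = (\<lambda>J. if root_ok J then Some (path J) else None)"
  have decision: "ptime (SIGMA J:good. UNIV)
      (\<lambda>z. Node (enc_corrko (gadget (fst z))) (enc_history (play (\<pi> (fst z)) (quiet (fst z)) (snd z))))
      (\<lambda>z. enc_option enc_nat (\<pi> (fst z) (play (\<pi> (fst z)) (quiet (fst z)) (snd z))))"
    unfolding ptime_def using \<pi>(3) by (intro exI[of _ A] exI[of _ q]) auto
  have in_time: "ptime good enc_J (\<lambda>J. enc_list enc_nat (in_time J (\<pi> J)))"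
    by (rule ptime_in_time[OF \<pi>(1) decision])
  have "ptime good enc_J (\<lambda>J. enc_list enc_nat (best_segment J (in_time J (\<pi> J))))"
  proof (rule ptime_best_segment[OF in_time _ good_rooted])
    fix J assume g: "J \<in> good"
    interpret rooted_instance J by (rule rooted_instance_good[OF g])
    show "set (in_time J (\<pi> J)) \<subseteq> {..<ok_n J}"
      using in_time_usable[OF \<pi>(1)[OF g]] usable_less by auto
  qed
  hence some: "ptime good enc_J (\<lambda>J. Node (Leaf 1) (Node (Leaf (int (ok_root J))) (enc_list enc_nat (best_segment J (in_time J (\<pi> J))))))"
    by (intro ptime_Node ptime_const ptime_components)
  let ?X = "{J. is_KnapOrientKD J}"
  have X: "?X \<subseteq> rooted" by (auto simp: rooted_def is_KnapOrientKD_def)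
  have ok: "ptime ?X enc_J (\<lambda>J. Leaf (of_bool (root_ok J)))"
    unfolding root_ok_def
    by (intro ptime_conj ptime_le ptime_const ptime_B' ptime_T'[OF X] ptime_at_root[OF ptime_KD' X])
  have "ptime ?X enc_J (\<lambda>J. if root_ok J then
      Node (Leaf 1) (Node (Leaf (int (ok_root J))) (enc_list enc_nat (best_segment J (in_time J (\<pi> J))))) else Leaf 0)"
    by (intro ptime_if ok ptime_const ptime_subset[OF some]) (auto simp: good_def)
  hence "ptime ?X enc_J (\<lambda>J. enc_option (enc_list enc_nat) (ans J))"
    by (rule ptime_cong) (simp add: ans_def path_def enc_option_def enc_nat_def)
  then obtain A' q' where A': "\<forall>J\<in>?X. computes_within A' q' (enc_J J) (enc_option (enc_list enc_nat) (ans J))"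
    unfolding ptime_def by blast
  show "\<exists>A'. approx_alg_KnapOrientKD (\<lambda>n. 36 * \<alpha> n) A'"
    unfolding approx_alg_KnapOrientKD_def
  proof (intro exI allI impI conjI)
    fix J assume J: "is_KnapOrientKD J"
    show "computes_within A' q' (enc_J J) (enc_option (enc_list enc_nat) (ans J))"
      using A' J by simp
    show "case ans J of None \<Rightarrow> \<not> (\<exists>p. ok_feasible J p)
      | Some p \<Rightarrow> ok_feasible J p \<and> (\<forall>p'. ok_feasible J p' \<longrightarrow>
          real_of_rat (ok_value J p') \<le> 36 * \<alpha> (ok_n J) * real_of_rat (ok_value J p))"
    proof (cases "root_ok J")
      case False
      thus ?thesis using not_root_ok[OF J] by (simp add: ans_def)
    next
      case True
      hence good: "J \<in> good" using J by (simp add: good_def)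
      interpret rooted_instance J by (rule rooted_instance_good[OF good])
      show ?thesis
        using answer_feasible[OF \<pi>(1)[OF good]] answer_value[OF \<pi>(1)[OF good] \<pi>(2)[OF good]] \<alpha> True
        by (simp add: ans_def path_def)
    qed
  qed
qed simp

end
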